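(* Let $d\ge2$ and $M\ge2$ be integers, let $p_1,\dots,p_d\in(0,1)$, and let $\overline{E}^{(1)},\dots,\overline{E}^{(d)}\subset[0,1]$ be independent one-dimensional fractal percolations, where $\overline{E}^{(i)}$ has parameters $M,p_i$. Assume that $$\prod_{i=1}^d p_i>M^{-d+1}.$$ Then for every $\mathbf{a}=(a_1,\dots,a_d)\in\mathbb{R}^d$ with $a_i\neq0$ for all $i=1,\dots,d$, the algebraic sum $$\widetilde{E}_{\mathbf a}:=a_1\overline{E}^{(1)}+\cdots+a_d\overline{E}^{(d)}=\Big\{\sum_{i=1}^d a_ie^{(i)}: e^{(i)}\in\overline{E}^{(i)}\Big\}$$ contains an interval almost surely, conditioned on all $\overline{E}^{(i)}$ being nonempty.
   Context: One-dimensional fractal percolation with parameters $M,p$: the interval $[0,1]$ is divided into $M$ congruent closed intervals; each is retained with probability $p$ and discarded with probability $1-p$, independently; in each retained interval the division into $M$ congruent closed intervals and the independent retaining/discarding is repeated, ad infinitum. The percolation set is the intersection over $n$ of the unions of the retained level-$n$ intervals (of length $M^{-n}$). "Interval" means an interval of positive length. *)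

theory Defs
  imports "HOL-Probability.Probability"
begin

text \<open>
  The level-\<open>n\<close> interval with index \<open>k < M ^ n\<close> is \<open>[k / M ^ n, (k + 1) / M ^ n]\<close>; its \<open>M\<close>
  subintervals of level \<open>n + 1\<close> have the indices \<open>M * k + j\<close> with \<open>j < M\<close>.
\<close>

definition level_interval :: "nat \<Rightarrow> nat \<Rightarrow> nat \<Rightarrow> real set" where
  "level_interval M n k = {real k / real M ^ n .. (real k + 1) / real M ^ n}"

text \<open>
  \<open>x n k\<close> is the outcome of the retain/discard trial of the level-\<open>n\<close> interval with index \<open>k\<close>.
  The trials at descendants of a discarded interval exist as well but have no effect. There is no
  trial at level \<open>0\<close>: the unit interval is always subdivided.
\<close>

primrec retained :: "nat \<Rightarrow> (nat \<Rightarrow> nat \<Rightarrow> bool) \<Rightarrow> nat \<Rightarrow> nat set" where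
  "retained M x 0 = {0}"
| "retained M x (Suc n) =
     {M * k + j |k j. k \<in> retained M x n \<and> j < M \<and> x (Suc n) (M * k + j)}"

definition percolation_set :: "nat \<Rightarrow> (nat \<Rightarrow> nat \<Rightarrow> bool) \<Rightarrow> real set" where
  "percolation_set M x = (\<Inter>n. \<Union>k\<in>retained M x n. level_interval M n k)"

text \<open>
  \<open>d\<close> independent fractal percolations with parameters \<open>M\<close> and \<open>p i\<close>, for \<open>i < d\<close>, on a common
  probability space: all trials, both within one percolation and across the \<open>d\<close> percolations, are
  independent. The random set number \<open>i\<close> is \<open>E i\<close>.
\<close>

locale independent_fractal_percolations = prob_space P
  for P :: "'w measure" +
  fixes d M :: nat and p :: "nat \<Rightarrow> real" and X :: "nat \<Rightarrow> nat \<Rightarrow> nat \<Rightarrow> 'w \<Rightarrow> bool"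
    and E :: "nat \<Rightarrow> 'w \<Rightarrow> real set"
  assumes indep_trials:
      "indep_vars (\<lambda>_. count_space UNIV) (\<lambda>(i, n, k). X i n k)
         (SIGMA i:{..<d}. SIGMA n:{1..}. {..<M ^ n})"
    and prob_retain:
      "\<And>i n k. i < d \<Longrightarrow> 1 \<le> n \<Longrightarrow> k < M ^ n \<Longrightarrow> prob {\<omega> \<in> space P. X i n k \<omega>} = p i"
    and E_eq:
      "\<And>i \<omega>. i < d \<Longrightarrow> \<omega> \<in> space P \<Longrightarrow> E i \<omega> = percolation_set M (\<lambda>n k. X i n k \<omega>)"

definition algebraic_sum :: "nat \<Rightarrow> (nat \<Rightarrow> real) \<Rightarrow> (nat \<Rightarrow> real set) \<Rightarrow> real set" where
  "algebraic_sum d a S = {\<Sum>i<d. a i * e i |e. \<forall>i<d. e i \<in> S i}"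

definition contains_interval :: "real set \<Rightarrow> bool" where
  "contains_interval S \<longleftrightarrow> (\<exists>u v. u < v \<and> {u..v} \<subseteq> S)"

end

theory Submission
  imports Defs "HOL-Real_Asymp.Real_Asymp"
begin

text \<open>
  Push the product of the natural measures of the \<open>d\<close> percolations, truncated at finite levels, forward
  under \<open>x \<mapsto> \<Sum>i<d. a i * x i\<close>. The image has a Lipschitz density \<open>f\<close>, and \<open>f t > 0\<close> implies that \<open>t\<close>
  is a sum of points of the level sets. Refine the coordinates one at a time. Given the past, refining
  coordinate \<open>i\<close> to level \<open>n\<close> changes \<open>f t\<close> by a sum of independent centred variables whose
  coefficients are controlled by the density of the sum over the other coordinates. Hoeffding's
  inequality and a union bound over a grid of exponentially many \<open>t\<close> show that almost surely,
  eventually, the squared increment is at most \<open>4 * n\<^sup>2 * (M * p i) ^ (- n)\<close> times the product of the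
  suprema (plus one each) of these two densities. The same estimate holds for the sum over every set
  \<open>S\<close> of coordinates, and induction on the cardinality of \<open>S\<close> bounds the growth of the suprema. For
  \<open>S = {..<d}\<close> the hypothesis on the \<open>p i\<close> makes the increments geometrically small, uniformly in \<open>t\<close>.

  On the other hand, the total mass of a surviving percolation decays more slowly than any geometric
  sequence. So at some late level the density exceeds the sum of all later increments on an interval,
  stays positive there for ever, and compactness puts the interval into the algebraic sum.
\<close>

section \<open>Retained intervals\<close>

text \<open>Refining all coordinates at once would make the increment of the density a polynomial of
  degree \<open>d\<close> in the fresh trials; one coordinate at a time, it is linear in them and
  Hoeffding's inequality applies. The sum of squared coefficients is at most the largest coefficient
  times their sum. The former sees only the density of the other coordinates, the latter is the
  density itself divided by \<open>p i\<close>. So the bound for \<open>S\<close> feeds on the one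
  for \<open>S - {i}\<close> and on itself, which forces all subsets to be treated, down to
  singletons, where the trivial bound is good enough. The factor \<open>n\<close> in the threshold
  makes the tail Gaussian in \<open>n\<close>, which beats any exponential number of grid points.
  The added ones keep the threshold above \<open>M ^ (- n)\<close>, so that the mesh can be chosen
  before the outcome is known. Convolutions are never formed as measures: each is a finite
  combination of shifted truncated powers, and the estimates become bounds on primitives. Nor do
  conditional expectations occur: at any time finitely many trials have been seen, and one sums over
  their values.\<close>

lemma retained_subset: "retained M x n \<subseteq> {..<M ^ n}"
proof (induction n)
  case (Suc n)
  have "M * k + j < M ^ Suc n" if "k < M ^ n" "j < M" for k j
  proof -
    have "M * k + j < M * (k + 1)"
      using that by simp
    also have "\<dots> \<le> M * M ^ n"
      using that by (intro mult_le_mono) auto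
    finally show ?thesis
      by simp
  qed
  with Suc show ?case
    by fastforce
qed auto

lemma finite_retained [simp]: "finite (retained M x n)"
  using retained_subset finite_lessThan by (rule finite_subset)

lemma retained_Suc_iff:
  assumes "0 < M"
  shows "q \<in> retained M x (Suc n) \<longleftrightarrow> q div M \<in> retained M x n \<and> x (Suc n) q"
proof
  show "q \<in> retained M x (Suc n) \<Longrightarrow> q div M \<in> retained M x n \<and> x (Suc n) q"
    using assms by auto
next
  assume *: "q div M \<in> retained M x n \<and> x (Suc n) q"
  have q: "M * (q div M) + q mod M = q" "q mod M < M"
    using assms by auto
  have "\<exists>k j. q = M * k + j \<and> k \<in> retained M x n \<and> j < M \<and> x (Suc n) (M * k + j)"
    by (rule exI[of _ "q div M"], rule exI[of _ "q mod M"]) (use * q in simp)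
  then show "q \<in> retained M x (Suc n)"
    by simp
qed

text \<open>Basis of the measurability arguments and of conditioning on the past: level
  \<open>n\<close> is decided by finitely many trials.\<close>

lemma retained_cong:
  assumes "0 < M" and "\<And>m k. 1 \<le> m \<Longrightarrow> m \<le> n \<Longrightarrow> k < M ^ m \<Longrightarrow> x m k = y m k"
  shows "retained M x n = retained M y n"
  using assms(2)
proof (induction n)
  case (Suc n)
  then have IH: "retained M x n = retained M y n"
    by simp
  have "x (Suc n) q = y (Suc n) q" if "q \<in> retained M x (Suc n) \<union> retained M y (Suc n)" for q
  proof -
    have "q < M ^ Suc n"
      using that retained_subset[of M x "Suc n"] retained_subset[of M y "Suc n"] by blast
    then show ?thesis
      by (intro Suc.prems) auto
  qed
  then show ?case
    unfolding set_eq_iff Un_iff using IH \<open>0 < M\<close> by (metis retained_Suc_iff)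
qed simp

text \<open>All children, before their trials are consulted. When \<open>R\<close> is the retained
  set of a level, they index exactly the fresh trials that influence the next one.\<close>

definition children :: "nat \<Rightarrow> nat set \<Rightarrow> nat set" where
  "children M R = {q. q div M \<in> R}"

lemma sum_children:
  assumes "0 < M"
  shows "(\<Sum>q\<in>children M R. f q) = (\<Sum>k\<in>R. \<Sum>j<M. f (M * k + j))"
proof -
  have "(\<Sum>k\<in>R. \<Sum>j<M. f (M * k + j)) = (\<Sum>(k, j)\<in>R \<times> {..<M}. f (M * k + j))"
    by (rule sum.cartesian_product)
  also have "\<dots> = (\<Sum>q\<in>children M R. f q)"
    using assms
    by (intro sum.reindex_bij_witness[of _ "\<lambda>q. (q div M, q mod M)" "\<lambda>(k, j). M * k + j"])
       (auto simp: children_def)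
  finally show ?thesis ..
qed

lemma card_children: "0 < M \<Longrightarrow> card (children M R) = M * card R"
  using sum_children[of M "\<lambda>_. 1::nat" R] by simp

lemma finite_children: "0 < M \<Longrightarrow> finite R \<Longrightarrow> finite (children M R)"
proof -
  assume "0 < M" "finite R"
  have "children M R \<subseteq> (\<lambda>(k, j). M * k + j) ` (R \<times> {..<M})"
  proof
    fix q assume "q \<in> children M R"
    then have "(q div M, q mod M) \<in> R \<times> {..<M}" "q = M * (q div M) + q mod M"
      using \<open>0 < M\<close> by (auto simp: children_def)
    then show "q \<in> (\<lambda>(k, j). M * k + j) ` (R \<times> {..<M})"
      by (metis (mono_tags, lifting) case_prod_conv image_eqI)
  qed
  then show ?thesis
    by (rule finite_subset) (use \<open>finite R\<close> in auto)
qed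

lemma children_subset:
  assumes "0 < M" "R \<subseteq> {..<M ^ n}"
  shows "children M R \<subseteq> {..<M ^ Suc n}"
proof
  fix q assume "q \<in> children M R"
  then have "q div M < M ^ n"
    using assms by (auto simp: children_def)
  then show "q \<in> {..<M ^ Suc n}"
    using assms by (simp add: div_less_iff_less_mult mult.commute)
qed

lemma retained_Suc_children:
  assumes "0 < M"
  shows "retained M x (Suc n) = {q \<in> children M (retained M x n). x (Suc n) q}"
  using assms by (auto simp: retained_Suc_iff children_def simp del: retained.simps(2))

section \<open>Nested compact level sets\<close>

lemma level_interval_child:
  assumes "0 < M"
  shows "level_interval M (Suc n) q \<subseteq> level_interval M n (q div M)"
proof -
  have "real (q div M) * real M \<le> real q"
    by (metis of_nat_le_iff of_nat_mult div_times_less_eq_dividend)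
  then have lower: "real (q div M) / real M ^ n \<le> real q / real M ^ Suc n"
    using assms by (simp add: field_simps)
  have "real q + 1 \<le> (real (q div M) + 1) * real M"
  proof -
    have "q < (q div M + 1) * M"
      using assms dividend_less_div_times[of M q] by (simp add: mult.commute)
    then have "q + 1 \<le> (q div M + 1) * M"
      by simp
    then have "real (q + 1) \<le> real ((q div M + 1) * M)"
      by (simp only: of_nat_le_iff)
    then show ?thesis
      by (simp add: algebra_simps)
  qed
  then have "(real q + 1) / real M ^ Suc n \<le> ((real (q div M) + 1) * real M) / real M ^ Suc n"
    using assms by (intro divide_right_mono) auto
  moreover have "((real (q div M) + 1) * real M) / real M ^ Suc n = (real (q div M) + 1) / real M ^ n"
    using assms by simp
  ultimately show ?thesis
    using lower assms unfolding level_interval_def atLeastatMost_subset_iff by linarith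
qed

definition level_set :: "nat \<Rightarrow> (nat \<Rightarrow> nat \<Rightarrow> bool) \<Rightarrow> nat \<Rightarrow> real set" where
  "level_set M x n = (\<Union>k\<in>retained M x n. level_interval M n k)"

lemma percolation_set_eq: "percolation_set M x = (\<Inter>n. level_set M x n)"
  by (simp add: percolation_set_def level_set_def)

lemma level_set_antimono: "0 < M \<Longrightarrow> decseq (level_set M x)"
proof (rule decseq_SucI)
  fix n assume "0 < M"
  have "level_interval M (Suc n) q \<subseteq> level_set M x n" if "q \<in> retained M x (Suc n)" for q
    using level_interval_child[OF \<open>0 < M\<close>, of n q] that \<open>0 < M\<close>
    by (auto simp: level_set_def retained_Suc_iff simp del: retained.simps(2))
  then show "level_set M x (Suc n) \<subseteq> level_set M x n"
    by (auto simp: level_set_def simp del: retained.simps(2))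
qed

lemma compact_level_set: "compact (level_set M x n)"
  unfolding level_set_def level_interval_def by (intro compact_UN) auto

section \<open>Primitives\<close>

text \<open>Stated by integrals rather than derivatives, since the density of a single coordinate is
  a step function and its distribution function has kinks.\<close>

definition primitive :: "(real \<Rightarrow> real) \<Rightarrow> (real \<Rightarrow> real) \<Rightarrow> bool" where
  "primitive U u \<longleftrightarrow> (\<forall>x y. x \<le> y \<longrightarrow> (u has_integral (U y - U x)) {x..y})"

lemma primitiveD: "primitive U u \<Longrightarrow> x \<le> y \<Longrightarrow> (u has_integral (U y - U x)) {x..y}"
  by (simp add: primitive_def)

lemma primitive_shift: "primitive U u \<Longrightarrow> primitive (\<lambda>t. U (t - c)) (\<lambda>t. u (t - c))"
  using has_integral_shift_Icc_real[of u "-c"] by (force simp: primitive_def o_def)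

lemma primitive_diff:
  assumes "primitive U u" "primitive V v"
  shows "primitive (\<lambda>t. U t - V t) (\<lambda>t. u t - v t)"
  unfolding primitive_def
proof (intro allI impI)
  fix x y :: real assume "x \<le> y"
  from has_integral_diff[OF primitiveD[OF assms(1) this] primitiveD[OF assms(2) this]]
  show "((\<lambda>t. u t - v t) has_integral (U y - V y - (U x - V x))) {x..y}"
    by (simp add: algebra_simps)
qed

lemma primitive_divide: "primitive U u \<Longrightarrow> primitive (\<lambda>t. U t / c) (\<lambda>t. u t / c)"
  by (auto simp: primitive_def simp flip: diff_divide_distrib intro: has_integral_divide)

lemma primitive_sum:
  assumes "finite A" "\<And>k. k \<in> A \<Longrightarrow> primitive (U k) (u k)"
  shows "primitive (\<lambda>t. \<Sum>k\<in>A. U k t) (\<lambda>t. \<Sum>k\<in>A. u k t)"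
  using assms by (auto simp: primitive_def simp flip: sum_subtractf intro: has_integral_sum)

lemma primitive_le:
  assumes "primitive U u" "x \<le> y" "\<And>t. t \<in> {x..y} \<Longrightarrow> u t \<le> B"
  shows "U y - U x \<le> B * (y - x)"
  using has_integral_le[OF primitiveD[OF assms(1,2)] has_integral_const_real[of B x y]] assms by (auto simp: mult.commute)

lemma primitive_ge:
  assumes "primitive U u" "x \<le> y" "\<And>t. t \<in> {x..y} \<Longrightarrow> B \<le> u t"
  shows "B * (y - x) \<le> U y - U x"
  using has_integral_le[OF has_integral_const_real[of B x y] primitiveD[OF assms(1,2)]] assms by (auto simp: mult.commute)

text \<open>The factor \<open>1 / a\<close> makes the bounds on the difference quotients independent of the sign of \<open>a\<close>.\<close>

lemma primitive_quotient_bounds: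
  assumes "primitive U u" "a \<noteq> 0" "s \<le> s'"
    and "\<And>r. r \<in> {s..s'} \<Longrightarrow> A \<le> u (t - a * r) \<and> u (t - a * r) \<le> B"
  shows "(U (t - a * s) - U (t - a * s')) / a \<in> {A * (s' - s)..B * (s' - s)}"
proof (cases "a > 0")
  case True
  have *: "A \<le> u y \<and> u y \<le> B" if "y \<in> {t - a * s'..t - a * s}" for y
    using assms(4)[of "(t - y) / a"] that True by (auto simp: field_simps)
  have "t - a * s' \<le> t - a * s"
    using True assms by simp
  from primitive_le[OF assms(1) this, of B] primitive_ge[OF assms(1) this, of A] * 
  have "A * (a * (s' - s)) \<le> U (t - a * s) - U (t - a * s')" "U (t - a * s) - U (t - a * s') \<le> B * (a * (s' - s))"
    by (auto simp: algebra_simps)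
  then show ?thesis
    using True by (auto simp: field_simps)
next
  case False
  then have "a < 0"
    using assms by auto
  have *: "A \<le> u y \<and> u y \<le> B" if "y \<in> {t - a * s..t - a * s'}" for y
    using assms(4)[of "(t - y) / a"] that \<open>a < 0\<close> by (auto simp: field_simps)
  have "t - a * s \<le> t - a * s'"
    using \<open>a < 0\<close> assms by simp
  from primitive_le[OF assms(1) this, of B] primitive_ge[OF assms(1) this, of A] * 
  have "A * (- a * (s' - s)) \<le> U (t - a * s') - U (t - a * s)" "U (t - a * s') - U (t - a * s) \<le> B * (- a * (s' - s))"
    by (auto simp: algebra_simps)
  then show ?thesis
    using \<open>a < 0\<close> by (auto simp: field_simps)
qed

text \<open>Since \<open>0 ^ 0 = 1\<close>, \<open>truncated_power 0\<close> is the Heaviside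
  function with value \<open>1\<close> at \<open>0\<close>, the distribution function of the empty
  sum. The others are its iterated primitives.\<close>

definition truncated_power :: "nat \<Rightarrow> real \<Rightarrow> real" where
  "truncated_power m t = (if t < 0 then 0 else t ^ m / fact m)"

lemma primitive_truncated_power: "primitive (truncated_power (Suc m)) (truncated_power m)"
  unfolding primitive_def
proof (intro allI impI)
  fix x y :: real assume "x \<le> y"
  have D: "(truncated_power (Suc m) has_real_derivative truncated_power m t) (at t)" if "t \<noteq> 0" for t
  proof (cases "t < 0")
    case True
    have "((\<lambda>_. 0) has_real_derivative 0) (at t)"
      by simp
    then have "(truncated_power (Suc m) has_real_derivative 0) (at t)"
      by (rule has_field_derivative_transform_within_open[where S = "{..<0}"])
         (use True in \<open>auto simp: truncated_power_def dist_real_def\<close>)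
    then show ?thesis
      using True by (simp add: truncated_power_def)
  next
    case False
    have "((\<lambda>t. t ^ Suc m / fact (Suc m)) has_real_derivative t ^ m / fact m) (at t)"
      by (rule derivative_eq_intros refl | simp)+
    then have "(truncated_power (Suc m) has_real_derivative t ^ m / fact m) (at t)"
      by (rule has_field_derivative_transform_within_open[where S = "{0<..}"])
         (use False that in \<open>auto simp: truncated_power_def dist_real_def\<close>)
    then show ?thesis
      using False by (simp add: truncated_power_def)
  qed
  have "continuous_on UNIV (truncated_power (Suc m))"
  proof -
    \<comment> \<open>The two branches agree at \<open>0\<close> because the exponent is
      positive.\<close>
    have "truncated_power (Suc m) = (\<lambda>t. max 0 t ^ Suc m / fact (Suc m))"
      by (auto simp: fun_eq_iff truncated_power_def max_def)
    then show ?thesis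
      by (simp only:) (intro continuous_intros, auto)
  qed
  then show "(truncated_power m has_integral (truncated_power (Suc m) y - truncated_power (Suc m) x)) {x..y}"
    using \<open>x \<le> y\<close> D
    by (intro fundamental_theorem_of_calculus_interior_strong[of "{0}"])
       (auto simp flip: has_real_derivative_iff_has_vector_derivative intro: continuous_on_subset)
qed

lemma mono_primitive:
  assumes "primitive U u" "\<And>t. 0 \<le> u t"
  shows "mono U"
  using primitive_ge[OF assms(1), of _ _ 0] assms(2) by (intro monoI) auto

lemma mono_quotient_nonneg:
  fixes U :: "real \<Rightarrow> real"
  assumes "mono U" "s \<le> s'"
  shows "0 \<le> (U (t - a * s) - U (t - a * s')) / a"
proof (cases "a \<ge> 0")
  case True
  then have "a * s \<le> a * s'"
    using assms by (simp add: mult_left_mono)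
  then have "U (t - a * s') \<le> U (t - a * s)"
    using assms by (intro monoD[OF assms(1)]) auto
  then show ?thesis
    using True by simp
next
  case False
  then have "a * s' \<le> a * s"
    using assms by (simp add: mult_left_mono_neg)
  then have "U (t - a * s') \<ge> U (t - a * s)"
    using assms by (intro monoD[OF assms(1)]) auto
  then show ?thesis
    using False by (simp add: divide_nonpos_neg)
qed

section \<open>Densities of the sum of the natural measures\<close>

text \<open>No probability space: what is proved in this locale holds for an arbitrary configuration
  \<open>x\<close>, where \<open>x i n k\<close> is the trial of coordinate
  \<open>i\<close>.\<close>

locale percolation_parameters =
  fixes d M :: nat and p a :: "nat \<Rightarrow> real"
  assumes two_le_d: "2 \<le> d" and two_le_M: "2 \<le> M"
    and p_range: "\<And>i. i < d \<Longrightarrow> 0 < p i \<and> p i < 1"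
    and a_nonzero: "\<And>i. i < d \<Longrightarrow> a i \<noteq> 0"
    and supercritical: "(\<Prod>i<d. p i) > real M powi (- int d + 1)"
begin

lemma M_pos [simp]: "0 < M" "M \<noteq> 0"
  using two_le_M by auto

text \<open>
  The convolution of \<open>u'\<close> with the image under \<open>x \<mapsto> a i * x\<close> of the level-\<open>n\<close> natural measure (the
  one with density \<open>p i ^ (- n)\<close> on the retained intervals), computed from a primitive \<open>u\<close> of \<open>u'\<close>.
\<close>

definition smear :: "(nat \<Rightarrow> nat \<Rightarrow> nat \<Rightarrow> bool) \<Rightarrow> nat \<Rightarrow> nat \<Rightarrow> (real \<Rightarrow> real) \<Rightarrow> real \<Rightarrow> real" where
  "smear x i n u t =
     (\<Sum>k\<in>retained M (x i) n.
        u (t - a i * (real k / real M ^ n)) - u (t - a i * ((real k + 1) / real M ^ n))) / (a i * p i ^ n)"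

text \<open>With the division by \<open>a i\<close> inside the sum, every summand is nonnegative for
  monotone \<open>u\<close>, whatever the sign of \<open>a i\<close>.\<close>

lemma smear_eq:
  "smear x i n u t =
     (\<Sum>k\<in>retained M (x i) n.
        (u (t - a i * (real k / real M ^ n)) - u (t - a i * ((real k + 1) / real M ^ n))) / a i) / p i ^ n"
  by (simp add: smear_def sum_divide_distrib[symmetric])

text \<open>Both sides are the same double sum of mixed second differences. This lets the
  convolutions be folded over a set of coordinates without fixing an order.\<close>

lemma smear_commute: "smear x i n (smear x j m u) = smear x j m (smear x i n u)"
proof
  fix t
  have *: "(\<Sum>k\<in>A. (\<Sum>l\<in>B. u (t - \<alpha> k - \<gamma> l) - u (t - \<alpha> k - \<delta> l)) / c'
              - (\<Sum>l\<in>B. u (t - \<beta> k - \<gamma> l) - u (t - \<beta> k - \<delta> l)) / c') / c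
    = (\<Sum>k\<in>A. \<Sum>l\<in>B. u (t - \<alpha> k - \<gamma> l) - u (t - \<alpha> k - \<delta> l) - u (t - \<beta> k - \<gamma> l) + u (t - \<beta> k - \<delta> l)) / (c * c')"
    for A B :: "nat set" and \<alpha> \<beta> \<gamma> \<delta> :: "nat \<Rightarrow> real" and c c' :: real
    by (simp add: sum_subtractf[symmetric] diff_divide_distrib[symmetric] sum_divide_distrib[symmetric]
          algebra_simps)
  show "smear x i n (smear x j m u) t = smear x j m (smear x i n u) t"
    unfolding smear_def * by (subst sum.swap) (simp add: algebra_simps)
qed

text \<open>Each smearing differentiates once and convolves. Starting from
  \<open>truncated_power m\<close>, the case \<open>m = card S\<close> leaves a convolution with the
  Heaviside function, and \<open>m = card S - 1\<close> one with the point mass at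
  \<open>0\<close>.\<close>

definition spline :: "(nat \<Rightarrow> nat \<Rightarrow> nat \<Rightarrow> bool) \<Rightarrow> (nat \<Rightarrow> nat) \<Rightarrow> nat \<Rightarrow> nat set \<Rightarrow> real \<Rightarrow> real" where
  "spline x l m S = Finite_Set.fold (\<lambda>i. smear x i (l i)) (truncated_power m) S"

lemma spline_empty [simp]: "spline x l m {} = truncated_power m"
  by (simp add: spline_def)

lemma spline_insert:
  assumes "finite S" "i \<notin> S"
  shows "spline x l m (insert i S) = smear x i (l i) (spline x l m S)"
proof -
  interpret comp_fun_commute "\<lambda>i. smear x i (l i)"
    by standard (auto simp: fun_eq_iff smear_commute)
  show ?thesis
    using assms by (simp add: spline_def)
qed

lemma primitive_smear: "primitive U u \<Longrightarrow> primitive (smear x i n U) (smear x i n u)"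
  unfolding smear_def by (intro primitive_divide primitive_sum primitive_diff primitive_shift) auto

lemma primitive_spline: "finite S \<Longrightarrow> primitive (spline x l (Suc m) S) (spline x l m S)"
  by (induction S rule: finite_induct)
     (auto simp: spline_insert primitive_truncated_power intro: primitive_smear)

text \<open>
  The density and the distribution function of \<open>\<Sum>i\<in>S. a i * Y i\<close> under the product of the natural
  measures of levels \<open>l i\<close>.
\<close>

definition sum_density :: "(nat \<Rightarrow> nat \<Rightarrow> nat \<Rightarrow> bool) \<Rightarrow> (nat \<Rightarrow> nat) \<Rightarrow> nat set \<Rightarrow> real \<Rightarrow> real" where
  "sum_density x l S = spline x l (card S - 1) S"

definition sum_cdf :: "(nat \<Rightarrow> nat \<Rightarrow> nat \<Rightarrow> bool) \<Rightarrow> (nat \<Rightarrow> nat) \<Rightarrow> nat set \<Rightarrow> real \<Rightarrow> real" where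
  "sum_cdf x l S = spline x l (card S) S"

lemma finite_indices: "S \<subseteq> {..<d} \<Longrightarrow> finite S"
  using finite_subset by blast

lemma sum_cdf_empty [simp]: "sum_cdf x l {} = truncated_power 0"
  by (simp add: sum_cdf_def)

lemma sum_density_insert:
  assumes "S \<subseteq> {..<d}" "i \<notin> S"
  shows "sum_density x l (insert i S) = smear x i (l i) (sum_cdf x l S)"
  using assms finite_indices[OF assms(1)] by (simp add: sum_density_def sum_cdf_def spline_insert)

text \<open>\<open>S\<close> must be nonempty: on \<open>{}\<close> the truncated subtraction
  \<open>card S - 1\<close> makes density and distribution function both equal to
  \<open>truncated_power 0\<close>.\<close>

lemma primitive_sum_cdf:
  assumes "S \<subseteq> {..<d}" "S \<noteq> {}"
  shows "primitive (sum_cdf x l S) (sum_density x l S)"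
proof -
  have "card S > 0"
    using assms finite_indices[OF assms(1)] by (simp add: card_gt_0_iff)
  then show ?thesis
    using primitive_spline[OF finite_indices[OF assms(1)], of x l "card S - 1"]
    by (simp add: sum_density_def sum_cdf_def)
qed

lemma spline_cong:
  assumes "finite S" "\<And>i. i \<in> S \<Longrightarrow> l i = l' i"
    and "\<And>i. i \<in> S \<Longrightarrow> retained M (x i) (l i) = retained M (y i) (l i)"
  shows "spline x l m S = spline y l' m S"
  using assms
proof (induction S rule: finite_induct)
  case (insert i S)
  then have IH: "spline x l m S = spline y l' m S"
    by simp
  show ?case
    using insert.hyps insert.prems(1,2)[of i] by (auto simp: spline_insert IH smear_def fun_eq_iff)
qed simp

lemma sum_density_cong:
  assumes "S \<subseteq> {..<d}" "\<And>i. i \<in> S \<Longrightarrow> l i = l' i"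
    and "\<And>i. i \<in> S \<Longrightarrow> retained M (x i) (l i) = retained M (y i) (l i)"
  shows "sum_density x l S = sum_density y l' S"
  using spline_cong[OF finite_indices[OF assms(1)] assms(2,3)] by (simp add: sum_density_def)

lemma sum_cdf_cong:
  assumes "S \<subseteq> {..<d}" "\<And>i. i \<in> S \<Longrightarrow> l i = l' i"
    and "\<And>i. i \<in> S \<Longrightarrow> retained M (x i) (l i) = retained M (y i) (l i)"
  shows "sum_cdf x l S = sum_cdf y l' S"
  using spline_cong[OF finite_indices[OF assms(1)] assms(2,3)] by (simp add: sum_cdf_def)

section \<open>Positivity, a priori bounds and Lipschitz continuity of the densities\<close>

lemma smear_nonneg:
  assumes "mono U" "i < d"
  shows "0 \<le> smear x i n U t"
proof -
  have "0 \<le> (\<Sum>k\<in>retained M (x i) n.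
     (U (t - a i * (real k / real M ^ n)) - U (t - a i * ((real k + 1) / real M ^ n))) / a i)"
    by (intro sum_nonneg mono_quotient_nonneg[OF assms(1)] divide_right_mono) auto
  then show ?thesis
    using p_range[OF assms(2)] by (simp add: smear_eq)
qed

text \<open>Monotonicity and positivity climb together: a monotone distribution function of
  \<open>S'\<close> gives a nonnegative density of \<open>insert i S'\<close>, whose primitive is
  monotone again.\<close>

lemma mono_sum_cdf: "S \<subseteq> {..<d} \<Longrightarrow> mono (sum_cdf x l S)"
proof (induction "card S" arbitrary: S)
  case 0
  then have "S = {}"
    using finite_indices by fastforce
  then show ?case
    by (auto simp: truncated_power_def intro!: monoI)
next
  case (Suc m)
  then obtain i S' where S: "S = insert i S'" "i \<notin> S'" "card S' = m"
    by (metis card_Suc_eq)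
  then have S': "S' \<subseteq> {..<d}" "i < d"
    using Suc.prems by auto
  show ?case
  proof (rule mono_primitive)
    show "primitive (sum_cdf x l S) (sum_density x l S)"
      using Suc.prems S by (intro primitive_sum_cdf) auto
    show "0 \<le> sum_density x l S t" for t
      using Suc.hyps(1)[of S'] S S' by (simp add: sum_density_insert smear_nonneg)
  qed
qed

lemma sum_density_nonneg:
  assumes "S \<subseteq> {..<d}" "S \<noteq> {}"
  shows "0 \<le> sum_density x l S t"
proof -
  obtain i where "i \<in> S"
    using assms by auto
  then have "sum_density x l S = smear x i (l i) (sum_cdf x l (S - {i}))"
    using sum_density_insert[of "S - {i}" i x l] assms by (auto simp: insert_absorb)
  moreover have "i < d"
    using \<open>i \<in> S\<close> assms by auto
  ultimately show ?thesis
    using smear_nonneg[OF mono_sum_cdf[of "S - {i}"] \<open>i < d\<close>, of x "l i" x l t] assms by auto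
qed

text \<open>Discarded intervals only lower the sum. With all \<open>M ^ n\<close> intervals present
  it telescopes to a single difference across \<open>[0, 1]\<close>.\<close>

lemma smear_le:
  assumes "mono U" "i < d" "(U t - U (t - a i)) / a i \<le> B"
  shows "smear x i n U t \<le> B / p i ^ n"
proof -
  define g where "g k = U (t - a i * (real k / real M ^ n)) / a i" for k
  have "(\<Sum>k\<in>retained M (x i) n.
     (U (t - a i * (real k / real M ^ n)) - U (t - a i * ((real k + 1) / real M ^ n))) / a i)
    \<le> (\<Sum>k<M ^ n. (U (t - a i * (real k / real M ^ n)) - U (t - a i * ((real k + 1) / real M ^ n))) / a i)"
    using retained_subset[of M "x i" n]
    by (intro sum_mono2 mono_quotient_nonneg[OF assms(1)] divide_right_mono) auto
  also have "\<dots> = (\<Sum>k<M ^ n. g k - g (Suc k))"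
    by (simp add: g_def diff_divide_distrib add.commute)
  also have "\<dots> = g 0 - g (M ^ n)"
    by (rule sum_lessThan_telescope')
  also have "\<dots> = (U t - U (t - a i)) / a i"
    by (simp add: g_def diff_divide_distrib)
  also have "\<dots> \<le> B"
    by (rule assms)
  finally have "(\<Sum>k\<in>retained M (x i) n.
     (U (t - a i * (real k / real M ^ n)) - U (t - a i * ((real k + 1) / real M ^ n))) / a i) \<le> B" .
  then show ?thesis
    using p_range[OF assms(2)]
    by (simp add: smear_eq divide_right_mono)
qed

lemma sum_density_insert_le:
  assumes "S \<subseteq> {..<d}" "i \<notin> S" "i < d" "S \<noteq> {}" "\<And>t. sum_density x l S t \<le> B"
  shows "sum_density x l (insert i S) t \<le> B / p i ^ l i"
proof -
  have "(sum_cdf x l S (t - a i * 0) - sum_cdf x l S (t - a i * 1)) / a i \<in> {0 * (1 - 0)..B * (1 - 0)}"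
    by (rule primitive_quotient_bounds[OF primitive_sum_cdf])
       (use assms a_nonzero sum_density_nonneg in auto)
  then show ?thesis
    unfolding sum_density_insert[OF assms(1,2)]
    by (intro smear_le mono_sum_cdf assms) auto
qed

lemma sum_density_singleton_le:
  assumes "i < d"
  shows "sum_density x l {i} t \<le> 1 / \<bar>a i\<bar> / p i ^ l i"
proof -
  have "sum_density x l {i} t = smear x i (l i) (sum_cdf x l {}) t"
    by (subst sum_density_insert) auto
  also have "\<dots> \<le> 1 / \<bar>a i\<bar> / p i ^ l i"
    using assms a_nonzero[OF assms]
    by (intro smear_le mono_sum_cdf) (auto simp: truncated_power_def field_simps abs_if)
  finally show ?thesis .
qed

definition density_constant :: real where
  "density_constant = (\<Sum>i<d. 1 / \<bar>a i\<bar>)"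

text \<open>A crude bound, exponential in the levels. It makes the suprema finite and controls the
  Lipschitz constants; the sharper growth rate comes from \<open>density_sup_growth\<close>.\<close>

lemma sum_density_le:
  assumes "S \<subseteq> {..<d}" "S \<noteq> {}"
  shows "sum_density x l S t \<le> density_constant / (\<Prod>i\<in>S. p i ^ l i)"
  using finite_indices[OF assms(1)] assms(2,1)
proof (induction S arbitrary: t rule: finite_ne_induct)
  case (singleton i)
  then have i: "i < d"
    by auto
  have "1 / \<bar>a i\<bar> \<le> density_constant"
    unfolding density_constant_def by (rule member_le_sum[of i]) (use i in auto)
  then have "1 / \<bar>a i\<bar> / p i ^ l i \<le> density_constant / p i ^ l i"
    using p_range[OF i] by (intro divide_right_mono) auto
  then show ?case
    using sum_density_singleton_le[OF i, of x l t] by simp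
next
  case (insert i S)
  then have "sum_density x l (insert i S) t \<le> density_constant / (\<Prod>i\<in>S. p i ^ l i) / p i ^ l i"
    by (intro sum_density_insert_le) auto
  then show ?case
    using insert by (simp add: mult.commute)
qed

lemma sum_cdf_lipschitz:
  assumes "S \<subseteq> {..<d}" "S \<noteq> {}" "\<And>t. sum_density x l S t \<le> B"
  shows "\<bar>sum_cdf x l S t - sum_cdf x l S t'\<bar> \<le> B * \<bar>t - t'\<bar>"
proof -
  have *: "\<bar>sum_cdf x l S t - sum_cdf x l S t'\<bar> \<le> B * (t - t')" if "t' \<le> t" for t t'
    using primitive_le[OF primitive_sum_cdf that, of S x l B] assms
          monoD[OF mono_sum_cdf that, of S x l] by auto
  show ?thesis
    using *[of t t'] *[of t' t] by (cases "t' \<le> t") (auto simp: abs_minus_commute)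
qed

text \<open>The distribution function over \<open>S\<close> is \<open>B\<close>-Lipschitz and enters
  at the two endpoints of at most \<open>M ^ l i\<close> intervals. A single coordinate is excluded
  because its density jumps.\<close>

lemma sum_density_lipschitz:
  assumes "S \<subseteq> {..<d}" "i \<notin> S" "i < d" "S \<noteq> {}" "\<And>t. sum_density x l S t \<le> B"
  shows "\<bar>sum_density x l (insert i S) t - sum_density x l (insert i S) t'\<bar>
    \<le> 2 * B * real M ^ l i / (\<bar>a i\<bar> * p i ^ l i) * \<bar>t - t'\<bar>"
proof -
  define U where "U = sum_cdf x l S"
  define n where "n = l i"
  have B: "0 \<le> B"
    using assms(5)[of 0] sum_density_nonneg[OF assms(1,4), of x l 0] by linarith
  have U: "\<bar>U t - U t'\<bar> \<le> B * \<bar>t - t'\<bar>" for t t'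
    unfolding U_def by (rule sum_cdf_lipschitz) fact+
  define h where "h t k = U (t - a i * (real k / real M ^ n)) - U (t - a i * ((real k + 1) / real M ^ n))" for t k
  have "\<bar>(\<Sum>k\<in>retained M (x i) n. h t k) - (\<Sum>k\<in>retained M (x i) n. h t' k)\<bar>
    \<le> (\<Sum>k\<in>retained M (x i) n. \<bar>h t k - h t' k\<bar>)"
    by (simp flip: sum_subtractf)
  also have "\<dots> \<le> (\<Sum>k\<in>retained M (x i) n. 2 * B * \<bar>t - t'\<bar>)"
  proof (rule sum_mono)
    fix k
    show "\<bar>h t k - h t' k\<bar> \<le> 2 * B * \<bar>t - t'\<bar>"
      using U[of "t - a i * (real k / real M ^ n)" "t' - a i * (real k / real M ^ n)"]
        U[of "t - a i * ((real k + 1) / real M ^ n)" "t' - a i * ((real k + 1) / real M ^ n)"]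
      by (simp add: h_def)
  qed
  also have "\<dots> \<le> real M ^ n * (2 * B * \<bar>t - t'\<bar>)"
  proof -
    have "card (retained M (x i) n) \<le> M ^ n"
      using card_mono[OF _ retained_subset] by fastforce
    then have "real (card (retained M (x i) n)) \<le> real M ^ n"
      by (metis of_nat_le_iff of_nat_power)
    then show ?thesis
      using B by (auto intro!: mult_right_mono)
  qed
  finally have "\<bar>(\<Sum>k\<in>retained M (x i) n. h t k) - (\<Sum>k\<in>retained M (x i) n. h t' k)\<bar> / (\<bar>a i\<bar> * p i ^ n)
     \<le> real M ^ n * (2 * B * \<bar>t - t'\<bar>) / (\<bar>a i\<bar> * p i ^ n)"
    using p_range[OF assms(3)] by (intro divide_right_mono) auto
  moreover have "sum_density x l (insert i S) t = (\<Sum>k\<in>retained M (x i) n. h t k) / (a i * p i ^ n)" for t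
    unfolding sum_density_insert[OF assms(1,2)] smear_def h_def U_def n_def ..
  ultimately show ?thesis
    using p_range[OF assms(3)]
    by (simp add: n_def diff_divide_distrib[symmetric] abs_mult mult_ac)
qed

section \<open>Support of the densities\<close>

text \<open>A nonzero value needs a retained interval of coordinate \<open>i\<close> across which
  the distribution function of the rest changes, hence a point \<open>r\<close> of it where the
  density of the rest is nonzero. Peeling off the coordinates yields the summands.\<close>

lemma sum_density_nonzeroD:
  assumes "S \<subseteq> {..<d}" "S \<noteq> {}" "sum_density x l S t \<noteq> 0"
  shows "\<exists>e. (\<forall>i\<in>S. e i \<in> level_set M (x i) (l i)) \<and> t = (\<Sum>i\<in>S. a i * e i)"
  using finite_indices[OF assms(1)] assms(2,1,3)
proof (induction S arbitrary: t rule: finite_ne_induct)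
  case (singleton i)
  have "sum_density x l {i} = smear x i (l i) (truncated_power 0)"
    by (subst sum_density_insert) auto
  with singleton.prems obtain k where k: "k \<in> retained M (x i) (l i)"
      "truncated_power 0 (t - a i * (real k / real M ^ l i)) \<noteq> truncated_power 0 (t - a i * ((real k + 1) / real M ^ l i))"
    by (force simp: smear_def intro: ccontr sum.neutral)
  define y where "y = t / a i"
  have t: "t = a i * y"
    using a_nonzero singleton.prems by (simp add: y_def)
  have "(0 \<le> a i * (y - real k / real M ^ l i)) \<noteq> (0 \<le> a i * (y - (real k + 1) / real M ^ l i))"
    using k(2) by (auto simp: truncated_power_def t algebra_simps split: if_splits)
  moreover have "real k / real M ^ l i \<le> (real k + 1) / real M ^ l i"
    by (intro divide_right_mono) auto
  ultimately have "y \<in> {real k / real M ^ l i..(real k + 1) / real M ^ l i}"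
    by (auto simp: zero_le_mult_iff)
  then have "y \<in> level_set M (x i) (l i)"
    using k(1) by (auto simp: level_set_def level_interval_def)
  then show ?case
    using t by (intro exI[of _ "\<lambda>_. y"]) auto
next
  case (insert i S)
  then have S: "S \<subseteq> {..<d}" "S \<noteq> {}" "i < d"
    by auto
  define U where "U = sum_cdf x l S"
  have "sum_density x l (insert i S) = smear x i (l i) U"
    using insert.hyps S by (simp add: U_def sum_density_insert)
  with insert.prems obtain k where k: "k \<in> retained M (x i) (l i)"
      "U (t - a i * (real k / real M ^ l i)) - U (t - a i * ((real k + 1) / real M ^ l i)) \<noteq> 0"
    by (force simp: smear_def intro: ccontr sum.neutral)
  obtain r where r: "r \<in> {real k / real M ^ l i..(real k + 1) / real M ^ l i}"
      "sum_density x l S (t - a i * r) \<noteq> 0"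
  \<comment> \<open>Otherwise the quotient bounds apply with \<open>A = B = 0\<close>, and the
    distribution function does not change across the interval.\<close>
  proof (rule ccontr)
    assume "\<not> thesis"
    then have *: "sum_density x l S (t - a i * r) = 0"
      if "r \<in> {real k / real M ^ l i..(real k + 1) / real M ^ l i}" for r
      using that \<open>\<And>r. r \<in> _ \<Longrightarrow> _ \<Longrightarrow> thesis\<close> by blast
    have "(U (t - a i * (real k / real M ^ l i)) - U (t - a i * ((real k + 1) / real M ^ l i))) / a i
       \<in> {0 * ((real k + 1) / real M ^ l i - real k / real M ^ l i)..0 * ((real k + 1) / real M ^ l i - real k / real M ^ l i)}"
      unfolding U_def
      by (rule primitive_quotient_bounds[OF primitive_sum_cdf[OF S(1,2)] a_nonzero[OF S(3)]])
         (use * in \<open>auto simp: divide_right_mono\<close>)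
    then show False
      using k(2) a_nonzero[OF S(3)] by auto
  qed
  obtain e where e: "\<forall>i\<in>S. e i \<in> level_set M (x i) (l i)" "t - a i * r = (\<Sum>i\<in>S. a i * e i)"
    using insert.IH[OF S(1) r(2)] by auto
  have r': "r \<in> level_set M (x i) (l i)"
    using k(1) r(1) by (auto simp: level_set_def level_interval_def)
  show ?case
  proof (intro exI[of _ "e(i := r)"] conjI)
    have "(\<Sum>j\<in>S. a j * (e(i := r)) j) = (\<Sum>j\<in>S. a j * e j)"
      using insert.hyps by (intro sum.cong) auto
    then show "t = (\<Sum>j\<in>insert i S. a j * (e(i := r)) j)"
      using e(2) insert.hyps by simp
  qed (use e(1) r' insert.hyps in auto)
qed

section \<open>Total mass and a lower bound on the largest density value\<close>

text \<open>Total mass of the level-\<open>n\<close> natural measure: each retained interval has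
  length \<open>M ^ (- n)\<close> and density \<open>p i ^ (- n)\<close>.\<close>

definition mass :: "(nat \<Rightarrow> nat \<Rightarrow> nat \<Rightarrow> bool) \<Rightarrow> nat \<Rightarrow> nat \<Rightarrow> real" where
  "mass x i n = real (card (retained M (x i) n)) / (real M * p i) ^ n"

text \<open>\<open>spline x l (Suc (card S)) S\<close> serves as a primitive of \<open>sum_cdf x l S\<close>.\<close>

lemma sum_cdf_eq_mass:
  assumes "S \<subseteq> {..<d}" "c = 0 \<and> t < - (\<Sum>i\<in>S. \<bar>a i\<bar>) \<or> c = 1 \<and> t \<ge> (\<Sum>i\<in>S. \<bar>a i\<bar>)"
  shows "sum_cdf x l S t = c * (\<Prod>i\<in>S. mass x i (l i))"
  using finite_indices[OF assms(1)] assms(1,2)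
proof (induction S arbitrary: t rule: finite_induct)
  case empty
  then show ?case
    by (auto simp: truncated_power_def)
next
  case (insert i S)
  then have S: "S \<subseteq> {..<d}" "i < d"
    by auto
  define V where "V = spline x l (Suc (card S)) S"
  define m where "m = (\<Prod>i\<in>S. mass x i (l i))"
  have V: "primitive V (sum_cdf x l S)"
    unfolding V_def sum_cdf_def using finite_indices[OF S(1)] by (rule primitive_spline)
  have "(V (t - a i * (real k / real M ^ l i)) - V (t - a i * ((real k + 1) / real M ^ l i))) / a i
        = c * m / real M ^ l i" if "k \<in> retained M (x i) (l i)" for k
  proof -
    have *: "sum_cdf x l S (t - a i * r) = c * m"
      if r: "r \<in> {real k / real M ^ l i..(real k + 1) / real M ^ l i}" for r
    proof -
      have "k + 1 \<le> M ^ l i"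
        using retained_subset[of M "x i" "l i"] \<open>k \<in> retained M (x i) (l i)\<close> by auto
      then have "real (k + 1) \<le> real (M ^ l i)"
        by (simp only: of_nat_le_iff)
      then have "(real k + 1) / real M ^ l i \<le> 1"
        by (simp add: field_simps)
      moreover have "0 \<le> real k / real M ^ l i"
        by simp
      ultimately have "\<bar>r\<bar> \<le> 1"
        using r unfolding atLeastAtMost_iff by linarith
      then have "\<bar>a i * r\<bar> \<le> \<bar>a i\<bar>"
        by (simp add: abs_mult mult_left_le)
      then have "c = 0 \<and> t - a i * r < - (\<Sum>i\<in>S. \<bar>a i\<bar>) \<or> c = 1 \<and> t - a i * r \<ge> (\<Sum>i\<in>S. \<bar>a i\<bar>)"
        using insert.prems insert.hyps by auto
      from insert.IH[OF S(1) this] show ?thesis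
        by (simp add: m_def)
    qed
    have "(V (t - a i * (real k / real M ^ l i)) - V (t - a i * ((real k + 1) / real M ^ l i))) / a i
       \<in> {c * m * ((real k + 1) / real M ^ l i - real k / real M ^ l i)..c * m * ((real k + 1) / real M ^ l i - real k / real M ^ l i)}"
      by (rule primitive_quotient_bounds[OF V a_nonzero[OF S(2)]]) (use * in \<open>auto simp: divide_right_mono\<close>)
    then show ?thesis
      by (simp add: diff_divide_distrib[symmetric])
  qed
  then have "(\<Sum>k\<in>retained M (x i) (l i). (V (t - a i * (real k / real M ^ l i)) - V (t - a i * ((real k + 1) / real M ^ l i))) / a i)
      = real (card (retained M (x i) (l i))) * (c * m / real M ^ l i)"
    by simp
  moreover have "sum_cdf x l (insert i S) t = smear x i (l i) V t"
    using insert.hyps by (simp add: sum_cdf_def V_def spline_insert)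
  ultimately have "sum_cdf x l (insert i S) t = c * (mass x i (l i) * m)"
    by (simp add: smear_eq mass_def power_mult_distrib)
  then show ?case
    using insert.hyps by (simp add: m_def)
qed

text \<open>The distribution function climbs from \<open>0\<close> to the total mass over an
  interval slightly longer than the support, so the density must somewhere reach the average
  slope.\<close>

lemma sum_density_ge:
  assumes "S \<subseteq> {..<d}" "S \<noteq> {}"
  shows "\<exists>t. sum_density x l S t \<ge> (\<Prod>i\<in>S. mass x i (l i)) / (2 * (\<Sum>i<d. \<bar>a i\<bar>) + 1)"
proof (rule ccontr)
  define A where "A = (\<Sum>i<d. \<bar>a i\<bar>)"
  define A' where "A' = (\<Sum>i\<in>S. \<bar>a i\<bar>)"
  define m where "m = (\<Prod>i\<in>S. mass x i (l i))"
  have A': "0 \<le> A'" "A' \<le> A"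
    unfolding A_def A'_def using assms by (auto intro: sum_nonneg sum_mono2)
  assume "\<not> ?thesis"
  then have *: "sum_density x l S t < m / (2 * A + 1)" for t
    by (simp add: not_le m_def A_def)
  have m: "0 < m"
  proof -
    have "0 < m / (2 * A + 1)"
      using *[of 0] sum_density_nonneg[OF assms, of x l 0] by linarith
    then show ?thesis
      using A' by (simp add: zero_less_divide_iff)
  qed
  \<comment> \<open>The extra \<open>1/2\<close> moves strictly to the left of the support, as
    \<open>sum_cdf_eq_mass\<close> demands, and stays below the \<open>1\<close> added in the
    denominator.\<close>
  have "sum_cdf x l S A' - sum_cdf x l S (- A' - 1/2) \<le> m / (2 * A + 1) * (A' - (- A' - 1/2))"
    using A' less_imp_le[OF *] by (intro primitive_le[OF primitive_sum_cdf[OF assms]]) auto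
  moreover have "sum_cdf x l S A' = m"
    using sum_cdf_eq_mass[OF assms(1), of 1 A' x l] by (simp add: A'_def m_def)
  moreover have "sum_cdf x l S (- A' - 1/2) = 0"
    using sum_cdf_eq_mass[OF assms(1), of 0 "- A' - 1/2" x l] by (simp add: A'_def m_def)
  moreover have "m / (2 * A + 1) * (A' - (- A' - 1/2)) < m / (2 * A + 1) * (2 * A + 1)"
    using A' m by (intro mult_strict_left_mono) auto
  ultimately show False
    using A' m by simp
qed

lemma sum_density_eq_0:
  assumes "S \<subseteq> {..<d}" "S \<noteq> {}" "\<bar>t\<bar> > (\<Sum>i<d. \<bar>a i\<bar>)"
  shows "sum_density x l S t = 0"
proof (rule ccontr)
  assume "sum_density x l S t \<noteq> 0"
  from sum_density_nonzeroD[OF assms(1,2) this] obtain e where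
    e: "\<forall>i\<in>S. e i \<in> level_set M (x i) (l i)" "t = (\<Sum>i\<in>S. a i * e i)"
    by auto
  have "\<bar>e i\<bar> \<le> 1" if "i \<in> S" for i
  proof -
    obtain k where k: "k \<in> retained M (x i) (l i)" "real k / real M ^ l i \<le> e i" "e i \<le> (real k + 1) / real M ^ l i"
      using bspec[OF e(1) \<open>i \<in> S\<close>] by (auto simp: level_set_def level_interval_def)
    have "k + 1 \<le> M ^ l i"
      using retained_subset[of M "x i" "l i"] k(1) by auto
    then have "real (k + 1) \<le> real (M ^ l i)"
      by (simp only: of_nat_le_iff)
    then have "(real k + 1) / real M ^ l i \<le> 1"
      by (simp add: field_simps)
    moreover have "0 \<le> real k / real M ^ l i"
      by simp
    ultimately show ?thesis
      using k by linarith
  qed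
  then have "\<bar>t\<bar> \<le> (\<Sum>i\<in>S. \<bar>a i\<bar>)"
    unfolding e(2) by (intro sum_abs[THEN order_trans] sum_mono) (auto simp: abs_mult mult_left_le)
  also have "\<dots> \<le> (\<Sum>i<d. \<bar>a i\<bar>)"
    using assms by (intro sum_mono2) auto
  finally show False
    using assms by simp
qed

section \<open>A refinement step as a centred weighted sum\<close>

text \<open>The contribution of child \<open>q\<close> to the refined density if it is retained,
  that is, the coefficient of its trial. Only coordinate \<open>i\<close> goes one level
  deeper.\<close>

definition child_weight :: "(nat \<Rightarrow> nat \<Rightarrow> nat \<Rightarrow> bool) \<Rightarrow> (nat \<Rightarrow> nat) \<Rightarrow> nat set \<Rightarrow> nat \<Rightarrow> real \<Rightarrow> nat \<Rightarrow> real" where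
  "child_weight x l S i t q =
     (sum_cdf x l S (t - a i * (real q / real M ^ Suc (l i)))
      - sum_cdf x l S (t - a i * ((real q + 1) / real M ^ Suc (l i)))) / (a i * p i ^ Suc (l i))"

lemma child_weight_nonneg:
  assumes "S \<subseteq> {..<d}" "i < d"
  shows "0 \<le> child_weight x l S i t q"
proof -
  have "0 \<le> (sum_cdf x l S (t - a i * (real q / real M ^ Suc (l i)))
      - sum_cdf x l S (t - a i * ((real q + 1) / real M ^ Suc (l i)))) / a i / p i ^ Suc (l i)"
    using p_range[OF assms(2)]
    by (intro divide_nonneg_nonneg mono_quotient_nonneg mono_sum_cdf assms divide_right_mono) auto
  then show ?thesis
    by (simp add: child_weight_def)
qed

lemma child_weight_le:
  assumes "S \<subseteq> {..<d}" "i < d" "S \<noteq> {}" "\<And>t. sum_density x l S t \<le> B"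
  shows "child_weight x l S i t q \<le> B / (real M * p i) ^ Suc (l i)"
proof -
  define n where "n = Suc (l i)"
  have "(sum_cdf x l S (t - a i * (real q / real M ^ n)) - sum_cdf x l S (t - a i * ((real q + 1) / real M ^ n))) / a i
       \<in> {0 * ((real q + 1) / real M ^ n - real q / real M ^ n)..B * ((real q + 1) / real M ^ n - real q / real M ^ n)}"
    by (rule primitive_quotient_bounds[OF primitive_sum_cdf])
       (use assms sum_density_nonneg a_nonzero in \<open>auto simp: divide_right_mono\<close>)
  then have "(sum_cdf x l S (t - a i * (real q / real M ^ n)) - sum_cdf x l S (t - a i * ((real q + 1) / real M ^ n))) / a i
     \<le> B / real M ^ n"
    by (simp add: diff_divide_distrib[symmetric])
  then have "(sum_cdf x l S (t - a i * (real q / real M ^ n)) - sum_cdf x l S (t - a i * ((real q + 1) / real M ^ n))) / a i / p i ^ n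
     \<le> B / real M ^ n / p i ^ n"
    using p_range[OF assms(2)] by (intro divide_right_mono) auto
  then show ?thesis
    unfolding child_weight_def n_def[symmetric] by (simp add: power_mult_distrib mult.commute)
qed

text \<open>The differences over the \<open>M\<close> children of an interval telescope to the
  difference over the interval; \<open>1 / p i\<close> is the change of normalisation between the
  two levels. With \<open>child_weight_le\<close> this controls the sum of squared weights.\<close>

lemma sum_child_weight:
  assumes "S \<subseteq> {..<d}" "i < d" "i \<notin> S"
  shows "(\<Sum>q\<in>children M (retained M (x i) (l i)). child_weight x l S i t q) = sum_density x l (insert i S) t / p i"
proof -
  define U where "U = sum_cdf x l S"
  define n where "n = l i"
  have "(\<Sum>j<M. U (t - a i * (real (M * k + j) / real M ^ Suc n)) - U (t - a i * ((real (M * k + j) + 1) / real M ^ Suc n)))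
     = U (t - a i * (real k / real M ^ n)) - U (t - a i * ((real k + 1) / real M ^ n))" for k
  proof -
    define g where "g j = U (t - a i * (real (M * k + j) / real M ^ Suc n))" for j
    have "(\<Sum>j<M. U (t - a i * (real (M * k + j) / real M ^ Suc n)) - U (t - a i * ((real (M * k + j) + 1) / real M ^ Suc n)))
       = (\<Sum>j<M. g j - g (Suc j))"
      by (simp add: g_def add_ac)
    also have "\<dots> = g 0 - g M"
      by (rule sum_lessThan_telescope')
    also have "g 0 = U (t - a i * (real k / real M ^ n))"
      by (simp add: g_def)
    also have "real (M * k + M) / real M ^ Suc n = (real k + 1) / real M ^ n"
      by (simp add: field_simps)
    then have "g M = U (t - a i * ((real k + 1) / real M ^ n))"
      by (simp only: g_def)
    finally show ?thesis .
  qed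
  then have "(\<Sum>q\<in>children M (retained M (x i) n). child_weight x l S i t q)
    = (\<Sum>k\<in>retained M (x i) n. U (t - a i * (real k / real M ^ n)) - U (t - a i * ((real k + 1) / real M ^ n)))
        / (a i * p i ^ Suc n)"
    unfolding sum_children[OF M_pos(1)] child_weight_def U_def[symmetric] n_def[symmetric] sum_divide_distrib[symmetric]
    by simp
  then show ?thesis
    unfolding sum_density_insert[OF assms(1,3)] smear_def U_def[symmetric] n_def[symmetric]
    by (simp add: mult_ac)
qed

text \<open>By \<open>sum_child_weight\<close> the old density is \<open>p i\<close> times the total
  weight of all children, which is the conditional mean of the new one; subtracting it centres every
  trial.\<close>

lemma sum_density_step:
  assumes "S \<subseteq> {..<d}" "i < d" "i \<notin> S"
  shows "sum_density x (l(i := Suc (l i))) (insert i S) t - sum_density x l (insert i S) t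
    = (\<Sum>q\<in>children M (retained M (x i) (l i)).
         (of_bool (x i (Suc (l i)) q) - p i) * child_weight x l S i t q)"
proof -
  define l' where "l' = l(i := Suc (l i))"
  have U: "sum_cdf x l' S = sum_cdf x l S"
    using assms by (intro sum_cdf_cong) (auto simp: l'_def)
  have "sum_density x l' (insert i S) t
    = (\<Sum>q\<in>retained M (x i) (Suc (l i)). child_weight x l S i t q)"
    unfolding sum_density_insert[OF assms(1,3)] smear_def U
    by (simp add: l'_def child_weight_def sum_divide_distrib[symmetric] del: retained.simps)
  also have "\<dots> = (\<Sum>q\<in>children M (retained M (x i) (l i)). of_bool (x i (Suc (l i)) q) * child_weight x l S i t q)"
    unfolding retained_Suc_children[OF M_pos(1)]
    by (rule sum.mono_neutral_cong_left) (auto intro: finite_children)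
  finally show ?thesis
    using sum_child_weight[OF assms, of x l t] p_range[OF assms(2)]
    by (simp add: l'_def left_diff_distrib sum_subtractf sum_distrib_left[symmetric])
qed

end

section \<open>Conditioning on finitely many trials\<close>

text \<open>Stands in for the sigma-algebra generated by the trials in \<open>J\<close>. For finite
  \<open>J\<close> such a function factors through a finite discrete product, so it is measurable,
  and independence from other trials applies to it.\<close>

definition depends_on :: "'i set \<Rightarrow> (('i \<Rightarrow> bool) \<Rightarrow> 'b) \<Rightarrow> bool" where
  "depends_on J f \<longleftrightarrow> (\<forall>v w. (\<forall>j\<in>J. v j = w j) \<longrightarrow> f v = f w)"

lemma depends_onI: "(\<And>v w. (\<And>j. j \<in> J \<Longrightarrow> v j = w j) \<Longrightarrow> f v = f w) \<Longrightarrow> depends_on J f"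
  unfolding depends_on_def by blast

lemma depends_onD: "depends_on J f \<Longrightarrow> (\<And>j. j \<in> J \<Longrightarrow> v j = w j) \<Longrightarrow> f v = f w"
  unfolding depends_on_def by blast

lemma depends_on_restrict: "depends_on J f \<Longrightarrow> f (restrict v J) = f v"
  by (rule depends_onD) auto

lemma depends_on_mono: "depends_on J f \<Longrightarrow> J \<subseteq> K \<Longrightarrow> depends_on K f"
  unfolding depends_on_def by blast

lemma PiM_bool: "finite J \<Longrightarrow> PiM J (\<lambda>_. count_space UNIV :: bool measure) = count_space (PiE J (\<lambda>_. UNIV))"
  by (rule count_space_PiM_finite) auto

locale independent_trials = prob_space P for P :: "'w measure" +
  fixes Y :: "'i \<Rightarrow> 'w \<Rightarrow> bool" and I :: "'i set"
  assumes indep: "indep_vars (\<lambda>_. count_space UNIV) Y I"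
begin

definition outcome :: "'w \<Rightarrow> 'i \<Rightarrow> bool" where
  "outcome \<omega> = (\<lambda>j. Y j \<omega>)"

lemma trial_measurable: "j \<in> I \<Longrightarrow> Y j \<in> measurable P (count_space UNIV)"
  using indep by (auto simp: indep_vars_def)

lemma measurable_restrict_outcome:
  assumes "finite J" "J \<subseteq> I"
  shows "(\<lambda>\<omega>. restrict (outcome \<omega>) J) \<in> measurable P (count_space (PiE J (\<lambda>_. UNIV)))"
proof -
  have "(\<lambda>\<omega>. restrict (\<lambda>j. Y j \<omega>) J) \<in> measurable P (PiM J (\<lambda>_. count_space UNIV))"
    using assms trial_measurable by (intro measurable_restrict) auto
  then show ?thesis
    using assms by (simp add: PiM_bool outcome_def)
qed

lemma event_depends_on:
  assumes "finite J" "J \<subseteq> I" "depends_on J G"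
  shows "{\<omega> \<in> space P. G (outcome \<omega>)} \<in> events"
proof -
  have "{\<omega> \<in> space P. G (outcome \<omega>)}
    = (\<lambda>\<omega>. restrict (outcome \<omega>) J) -` {v \<in> PiE J (\<lambda>_. UNIV). G v} \<inter> space P"
    using depends_on_restrict[OF assms(3)] by auto
  also have "\<dots> \<in> events"
    by (rule measurable_sets[OF measurable_restrict_outcome[OF assms(1,2)]]) simp
  finally show ?thesis .
qed

text \<open>Conditioning as a finite case distinction: where the trials in \<open>J\<close> take the
  values \<open>v\<close>, the first argument of \<open>Q\<close> is frozen, and the second is seen
  only through the independent trials in \<open>T\<close>.\<close>

lemma prob_conditional_le:
  assumes J: "finite J" "J \<subseteq> I" and T: "finite T" "T \<subseteq> I" and "J \<inter> T = {}"
    and G: "depends_on J G" and QJ: "\<And>x. depends_on J (\<lambda>v. Q v x)" and QT: "\<And>v. depends_on T (Q v)"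
    and le: "\<And>v. G v \<Longrightarrow> prob {\<omega> \<in> space P. Q v (outcome \<omega>)} \<le> \<epsilon>"
  shows "prob {\<omega> \<in> space P. G (outcome \<omega>) \<and> Q (outcome \<omega>) (outcome \<omega>)}
    \<le> \<epsilon> * prob {\<omega> \<in> space P. G (outcome \<omega>)}"
proof -
  \<comment> \<open>Finitely many pasts, each extended by \<open>undefined\<close> outside
    \<open>J\<close>.\<close>
  define V where "V = {v \<in> PiE J (\<lambda>_. UNIV). G v}"
  define A where "A v = {\<omega> \<in> space P. restrict (outcome \<omega>) J = v}" for v
  define B where "B v = {\<omega> \<in> space P. Q v (outcome \<omega>)}" for v
  have "finite V"
    using J by (auto simp: V_def intro: finite_subset[OF _ finite_PiE])
  have A_sets: "A v \<in> events" if "v \<in> V" for v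
  proof -
    have "A v = (\<lambda>\<omega>. restrict (outcome \<omega>) J) -` {v} \<inter> space P"
      by (auto simp: A_def)
    then show ?thesis
      using measurable_sets[OF measurable_restrict_outcome[OF J], of "{v}"] that by (auto simp: V_def)
  qed
  have B_sets: "B v \<in> events" for v
    unfolding B_def using T QT by (rule event_depends_on)
  have AB: "prob (A v \<inter> B v) = prob (A v) * prob (B v)" if "v \<in> V" for v
  proof -
    have "indep_var (PiM J (\<lambda>_. count_space UNIV)) (\<lambda>\<omega>. restrict (outcome \<omega>) J)
                    (PiM T (\<lambda>_. count_space UNIV)) (\<lambda>\<omega>. restrict (outcome \<omega>) T)"
      unfolding outcome_def using indep \<open>J \<inter> T = {}\<close> J(2) T(2) by (rule indep_var_restrict)
    then have "indep_var (count_space (PiE J (\<lambda>_. UNIV))) (\<lambda>\<omega>. restrict (outcome \<omega>) J)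
                    (count_space (PiE T (\<lambda>_. UNIV))) (\<lambda>\<omega>. restrict (outcome \<omega>) T)"
      using J T by (simp only: PiM_bool)
    from indep_varD[OF this, of "{v}" "{x \<in> PiE T (\<lambda>_. UNIV). Q v x}"] that
    have "prob ((\<lambda>\<omega>. (restrict (outcome \<omega>) J, restrict (outcome \<omega>) T)) -`
             ({v} \<times> {x \<in> PiE T (\<lambda>_. UNIV). Q v x}) \<inter> space P) =
          prob ((\<lambda>\<omega>. restrict (outcome \<omega>) J) -` {v} \<inter> space P) *
          prob ((\<lambda>\<omega>. restrict (outcome \<omega>) T) -` {x \<in> PiE T (\<lambda>_. UNIV). Q v x} \<inter> space P)"
      by (auto simp: V_def)
    moreover have "(\<lambda>\<omega>. (restrict (outcome \<omega>) J, restrict (outcome \<omega>) T)) -`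
             ({v} \<times> {x \<in> PiE T (\<lambda>_. UNIV). Q v x}) \<inter> space P = A v \<inter> B v"
      using depends_on_restrict[OF QT[of v]] by (auto simp: A_def B_def)
    moreover have "(\<lambda>\<omega>. restrict (outcome \<omega>) J) -` {v} \<inter> space P = A v"
      by (auto simp: A_def)
    moreover have "(\<lambda>\<omega>. restrict (outcome \<omega>) T) -` {x \<in> PiE T (\<lambda>_. UNIV). Q v x} \<inter> space P = B v"
      using depends_on_restrict[OF QT[of v]] by (auto simp: B_def)
    ultimately show ?thesis
      by simp
  qed
  have Q: "Q (restrict v J) x = Q v x" for v x
    using depends_on_restrict[OF QJ[of x]] .
  have "{\<omega> \<in> space P. G (outcome \<omega>) \<and> Q (outcome \<omega>) (outcome \<omega>)} = (\<Union>v\<in>V. A v \<inter> B v)"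
    using depends_on_restrict[OF G] Q by (auto simp: A_def B_def V_def)
  also have "prob \<dots> \<le> (\<Sum>v\<in>V. prob (A v \<inter> B v))"
    using A_sets B_sets \<open>finite V\<close> by (intro finite_measure_subadditive_finite) auto
  also have "\<dots> \<le> (\<Sum>v\<in>V. \<epsilon> * prob (A v))"
  proof (rule sum_mono)
    fix v assume v: "v \<in> V"
    then have "prob (B v) \<le> \<epsilon>"
      using le[of v] by (simp add: V_def B_def)
    then show "prob (A v \<inter> B v) \<le> \<epsilon> * prob (A v)"
      unfolding AB[OF v] by (subst mult.commute) (rule mult_right_mono, auto)
  qed
  also have "\<dots> = \<epsilon> * prob (\<Union>v\<in>V. A v)"
    unfolding sum_distrib_left[symmetric]
    using A_sets \<open>finite V\<close>
    by (subst finite_measure_finite_Union) (auto simp: disjoint_family_on_def A_def)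
  also have "(\<Union>v\<in>V. A v) = {\<omega> \<in> space P. G (outcome \<omega>)}"
    using depends_on_restrict[OF G] by (auto simp: A_def V_def)
  finally show ?thesis .
qed

text \<open>The variables \<open>of_bool (Y j \<omega>) * w j\<close> range over
  \<open>[0, w j]\<close>, so the squared ranges in Hoeffding's inequality are the squared
  weights.\<close>

lemma weighted_Hoeffding:
  assumes T: "finite T" "T \<subseteq> I" and p: "\<And>j. j \<in> T \<Longrightarrow> prob {\<omega> \<in> space P. Y j \<omega>} = p"
    and w: "\<And>j. j \<in> T \<Longrightarrow> 0 \<le> w j" and b: "(\<Sum>j\<in>T. (w j)\<^sup>2) \<le> b" and "0 < r"
  shows "prob {\<omega> \<in> space P. \<bar>\<Sum>j\<in>T. (of_bool (outcome \<omega> j) - p) * w j\<bar> \<ge> r} \<le> 2 * exp (-2 * r\<^sup>2 / b)"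
\<comment> \<open>Hoeffding's inequality needs a positive sum of squares. If it vanishes, so does
  the random sum, and the event is empty because \<open>0 < r\<close>.\<close>
proof (cases "(\<Sum>j\<in>T. (w j)\<^sup>2) = 0")
  case True
  then have "\<forall>j\<in>T. w j = 0"
    using T by (simp add: sum_nonneg_eq_0_iff)
  then show ?thesis
    using \<open>0 < r\<close> by simp
next
  case False
  then have pos: "(\<Sum>j\<in>T. (w j)\<^sup>2) > 0"
    by (simp add: sum_nonneg less_le)
  define Z where "Z = (\<lambda>j \<omega>. of_bool (Y j \<omega>) * w j :: real)"
  have exp_Z: "expectation (Z j) = p * w j" if "j \<in> T" for j
  proof -
    have meas: "{\<omega> \<in> space P. Y j \<omega>} \<in> events"
      using event_depends_on[of "{j}" "\<lambda>v. v j"] that T by (auto simp: depends_on_def outcome_def)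
    have "expectation (Z j) = expectation (\<lambda>\<omega>. indicator {\<omega> \<in> space P. Y j \<omega>} \<omega> * w j)"
      by (intro Bochner_Integration.integral_cong) (auto simp: Z_def indicator_def)
    also have "\<dots> = p * w j"
      using meas p[OF that] by (simp add: emeasure_eq_measure)
    finally show ?thesis .
  qed
  interpret Hoeffding_ineq P T Z "\<lambda>_. 0" w "\<Sum>j\<in>T. p * w j"
  proof (unfold_locales, goal_cases)
    case 1
    show ?case by (rule T)
  next
    case 2
    show ?case
      unfolding Z_def by (rule indep_vars_compose2[OF indep_vars_subset[OF indep T(2)]]) auto
  next
    case (3 j)
    then show ?case
      using w by (auto simp: Z_def)
  next
    case 4
    show "(\<Sum>j\<in>T. p * w j) \<equiv> (\<Sum>j\<in>T. expectation (Z j))"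
      by (rule eq_reflection, rule sum.cong) (auto simp: exp_Z)
  qed
  have "{\<omega> \<in> space P. \<bar>\<Sum>j\<in>T. (of_bool (outcome \<omega> j) - p) * w j\<bar> \<ge> r}
    = {\<omega> \<in> space P. \<bar>(\<Sum>j\<in>T. Z j \<omega>) - (\<Sum>j\<in>T. p * w j)\<bar> \<ge> r}"
    by (auto simp: Z_def outcome_def left_diff_distrib sum_subtractf)
  also have "prob \<dots> \<le> 2 * exp (-2 * r\<^sup>2 / (\<Sum>j\<in>T. (w j - 0)\<^sup>2))"
    using \<open>0 < r\<close> pos by (intro Hoeffding_ineq_abs_ge) auto
  also have "\<dots> \<le> 2 * exp (-2 * r\<^sup>2 / b)"
    using pos b \<open>0 < r\<close> by (auto intro!: divide_left_mono mult_pos_pos)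
  finally show ?thesis .
qed

lemma prob_all_fail:
  assumes T: "finite T" "T \<subseteq> I" and p: "\<And>j. j \<in> T \<Longrightarrow> prob {\<omega> \<in> space P. Y j \<omega>} = p"
  shows "prob {\<omega> \<in> space P. \<forall>j\<in>T. \<not> outcome \<omega> j} = (1 - p) ^ card T"
proof (cases "T = {}")
  case False
  have "{\<omega> \<in> space P. \<forall>j\<in>T. \<not> outcome \<omega> j} = (\<Inter>j\<in>T. Y j -` {False} \<inter> space P)"
    using False by (auto simp: outcome_def)
  also have "prob \<dots> = (\<Prod>j\<in>T. prob (Y j -` {False} \<inter> space P))"
    using False T by (intro indep_varsD[OF indep]) auto
  also have "\<dots> = (\<Prod>j\<in>T. 1 - p)"
  proof (rule prod.cong)
    fix j assume j: "j \<in> T"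
    have meas: "{\<omega> \<in> space P. Y j \<omega>} \<in> events"
      using event_depends_on[of "{j}" "\<lambda>v. v j"] j T by (auto simp: depends_on_def outcome_def)
    have "Y j -` {False} \<inter> space P = space P - {\<omega> \<in> space P. Y j \<omega>}"
      by auto
    then show "prob (Y j -` {False} \<inter> space P) = 1 - p"
      using prob_compl[OF meas] p[OF j] by simp
  qed simp
  finally show ?thesis
    by simp
qed (simp add: prob_space)

end

section \<open>Growth of a surviving percolation\<close>

lemma sum_singleton_times: "(\<Sum>j\<in>{c} \<times> B. f j) = (\<Sum>q\<in>B. f (c, q))" for f :: "'a \<times> 'b \<Rightarrow> real"
  by (rule sum.reindex_bij_witness[of _ "\<lambda>q. (c, q)" snd]) auto

locale single_percolation = independent_trials P "\<lambda>(n, k). X n k" "SIGMA n:{1..}. {..<M ^ n}"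
  for P :: "'w measure" and X :: "nat \<Rightarrow> nat \<Rightarrow> 'w \<Rightarrow> bool" and M :: nat +
  fixes p :: real
  assumes M_pos: "0 < M" and p: "0 < p" "p < 1"
    and prob_X: "\<And>n k. 1 \<le> n \<Longrightarrow> k < M ^ n \<Longrightarrow> prob {\<omega> \<in> space P. X n k \<omega>} = p"
begin

definition R :: "nat \<Rightarrow> (nat \<times> nat \<Rightarrow> bool) \<Rightarrow> nat set" where
  "R n v = retained M (\<lambda>m k. v (m, k)) n"

definition past :: "nat \<Rightarrow> (nat \<times> nat) set" where
  "past n = (SIGMA m:{1..n}. {..<M ^ m})"

definition next_level :: "nat \<Rightarrow> (nat \<times> nat) set" where
  "next_level n = {Suc n} \<times> {..<M ^ Suc n}"

lemma past_facts: "finite (past n)" "past n \<subseteq> (SIGMA n:{1..}. {..<M ^ n})"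
    "finite (next_level n)" "next_level n \<subseteq> (SIGMA n:{1..}. {..<M ^ n})" "past n \<inter> next_level n = {}"
  by (auto simp: past_def next_level_def)

lemma depends_on_R: "depends_on (past n) (R n)"
  using M_pos unfolding R_def past_def by (intro depends_onI retained_cong) auto

lemma finite_R [simp]: "finite (R n v)"
  by (simp add: R_def)

lemma R_Suc: "R (Suc n) v = {q \<in> children M (R n v). v (Suc n, q)}"
  using retained_Suc_children[OF M_pos, of "\<lambda>m k. v (m, k)" n] by (simp add: R_def del: retained.simps)

lemma children_R: "children M (R n v) \<subseteq> {..<M ^ Suc n}"
  unfolding R_def using M_pos retained_subset by (rule children_subset)

lemma finite_children_R [simp]: "finite (children M (R n v))"
  using M_pos by (intro finite_children) auto

lemma card_event: "{\<omega> \<in> space P. Q (card (R n (outcome \<omega>))) (card (R m (outcome \<omega>)))} \<in> events"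
proof (rule event_depends_on)
  have "depends_on (past (max n m)) (R n)" "depends_on (past (max n m)) (R m)"
    by (auto intro!: depends_on_mono[OF depends_on_R] simp: past_def)
  then show "depends_on (past (max n m)) (\<lambda>v. Q (card (R n v)) (card (R m v)))"
    unfolding depends_on_def by metis
qed (rule past_facts)+

text \<open>\<open>Z\<close> retained intervals have \<open>M * Z\<close> children, and a shortfall
  by the factor \<open>\<zeta>\<close> is a deviation of order \<open>Z\<close>, exponentially
  unlikely. Only a bound of order \<open>1 / z\<close> is kept, which suffices along a geometrically
  growing population.\<close>

lemma prob_slow_growth:
  fixes z \<zeta> :: real
  assumes "0 < z" "0 < \<zeta>" "\<zeta> < 1"
  shows "prob {\<omega> \<in> space P. z \<le> real (card (R n (outcome \<omega>)))
           \<and> card (R (Suc n) (outcome \<omega>)) < \<zeta> * (M * p) * card (R n (outcome \<omega>))}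
         \<le> 1 / ((1 - \<zeta>)\<^sup>2 * p\<^sup>2 * M * z)"
proof -
  \<comment> \<open>\<open>c * Z\<close> is Hoeffding's exponent for the deviation
    \<open>(1 - \<zeta>) * (M * p) * Z\<close> among \<open>M * Z\<close> trials of unit
    weight.\<close>
  define c where "c = 2 * (1 - \<zeta>)\<^sup>2 * p\<^sup>2 * M"
  have c: "0 < c"
    using assms p M_pos by (simp add: c_def)
  define Q where "Q v x \<longleftrightarrow> \<bar>\<Sum>q\<in>children M (R n v). of_bool (x (Suc n, q)) - p\<bar> \<ge> (1 - \<zeta>) * (M * p) * card (R n v)"
    for v x :: "nat \<times> nat \<Rightarrow> bool"
  have "prob {\<omega> \<in> space P. z \<le> real (card (R n (outcome \<omega>))) \<and> Q (outcome \<omega>) (outcome \<omega>)}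
    \<le> 2 * exp (- c * z) * prob {\<omega> \<in> space P. z \<le> real (card (R n (outcome \<omega>)))}"
  proof (rule prob_conditional_le[where J = "past n" and T = "next_level n" and Q = Q and G = "\<lambda>v. z \<le> real (card (R n v))"])
    show "depends_on (past n) (\<lambda>v. z \<le> real (card (R n v)))"
      using depends_on_R[of n] unfolding depends_on_def by metis
    show "depends_on (past n) (\<lambda>v. Q v x)" for x
      using depends_on_R[of n] unfolding depends_on_def Q_def by metis
    show "depends_on (next_level n) (Q v)" for v
    proof (rule depends_onI)
      fix x y :: "nat \<times> nat \<Rightarrow> bool" assume xy: "\<And>j. j \<in> next_level n \<Longrightarrow> x j = y j"
      have "(\<Sum>q\<in>children M (R n v). of_bool (x (Suc n, q)) - p) = (\<Sum>q\<in>children M (R n v). of_bool (y (Suc n, q)) - p)"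
      proof (rule sum.cong)
        fix q assume "q \<in> children M (R n v)"
        then have "q < M ^ Suc n"
          using children_R by blast
        then show "of_bool (x (Suc n, q)) - p = of_bool (y (Suc n, q)) - p"
          using xy[of "(Suc n, q)"] by (auto simp: next_level_def)
      qed simp
      then show "Q v x = Q v y"
        by (simp add: Q_def)
    qed
    fix v assume v: "z \<le> real (card (R n v))"
    define Z where "Z = real (card (R n v))"
    have Z: "0 < Z"
      using v assms by (simp add: Z_def)
    have "prob {\<omega> \<in> space P. \<bar>\<Sum>j\<in>{Suc n} \<times> children M (R n v). (of_bool (outcome \<omega> j) - p) * 1\<bar>
         \<ge> (1 - \<zeta>) * (M * p) * Z} \<le> 2 * exp (-2 * ((1 - \<zeta>) * (M * p) * Z)\<^sup>2 / (M * Z))"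
    proof (rule weighted_Hoeffding)
      show "{Suc n} \<times> children M (R n v) \<subseteq> (SIGMA n:{1..}. {..<M ^ n})"
        using children_R[of n v] by auto
      show "prob {\<omega> \<in> space P. (case j of (n, k) \<Rightarrow> X n k) \<omega>} = p"
        if "j \<in> {Suc n} \<times> children M (R n v)" for j
        using that children_R[of n v] prob_X[of "Suc n"] by auto
    qed (use Z assms p M_pos in \<open>auto simp: card_children Z_def card_cartesian_product\<close>)
    also have "-2 * ((1 - \<zeta>) * (M * p) * Z)\<^sup>2 / (M * Z) = - c * Z"
      using Z M_pos by (simp add: c_def field_simps power2_eq_square)
    also have "2 * exp (- c * Z) \<le> 2 * exp (- c * z)"
      using c v by (simp add: Z_def)
    finally show "prob {\<omega> \<in> space P. Q v (outcome \<omega>)} \<le> 2 * exp (- c * z)"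
      by (simp add: Q_def Z_def sum_singleton_times)
  qed (rule past_facts)+
  also have "\<dots> \<le> 2 * exp (- c * z)"
    by (simp add: mult_left_le)
  also have "\<dots> \<le> 2 * (1 / (c * z))"
  proof -
    have "c * z \<le> exp (c * z)"
      using exp_ge_add_one_self[of "c * z"] by linarith
    moreover have "0 < c * z"
      using c assms by simp
    ultimately show ?thesis
      by (simp add: exp_minus inverse_eq_divide frac_le)
  qed
  also have "\<dots> = 1 / ((1 - \<zeta>)\<^sup>2 * p\<^sup>2 * M * z)"
    by (simp add: c_def)
  finally have *: "prob {\<omega> \<in> space P. z \<le> real (card (R n (outcome \<omega>))) \<and> Q (outcome \<omega>) (outcome \<omega>)}
    \<le> 1 / ((1 - \<zeta>)\<^sup>2 * p\<^sup>2 * M * z)" .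
  have "Q v v" if "card (R (Suc n) v) < \<zeta> * (M * p) * card (R n v)" for v
  proof -
    have "(\<Sum>q\<in>children M (R n v). of_bool (v (Suc n, q)) - p) = card (R (Suc n) v) - M * p * card (R n v)"
      using M_pos by (simp add: sum_subtractf R_Suc card_children Int_def)
    then show ?thesis
      using that by (simp add: Q_def algebra_simps)
  qed
  moreover have "{\<omega> \<in> space P. z \<le> real (card (R n (outcome \<omega>))) \<and> Q (outcome \<omega>) (outcome \<omega>)} \<in> events"
  proof (rule event_depends_on[of "past (Suc n)"])
    show "depends_on (past (Suc n)) (\<lambda>v. z \<le> real (card (R n v)) \<and> Q v v)"
    proof (rule depends_onI)
      fix v w :: "nat \<times> nat \<Rightarrow> bool" assume vw: "\<And>j. j \<in> past (Suc n) \<Longrightarrow> v j = w j"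
      have R: "R n v = R n w"
        by (rule depends_onD[OF depends_on_R]) (use vw in \<open>auto simp: past_def\<close>)
      have "(\<Sum>q\<in>children M (R n v). of_bool (v (Suc n, q)) - p) = (\<Sum>q\<in>children M (R n w). of_bool (w (Suc n, q)) - p)"
      proof (rule sum.cong)
        fix q assume "q \<in> children M (R n w)"
        then have "q < M ^ Suc n"
          using children_R by blast
        then show "of_bool (v (Suc n, q)) - p = of_bool (w (Suc n, q)) - p"
          using vw[of "(Suc n, q)"] by (auto simp: past_def)
      qed (simp add: R)
      then show "(z \<le> real (card (R n v)) \<and> Q v v) = (z \<le> real (card (R n w)) \<and> Q w w)"
        by (simp add: Q_def R)
    qed
  qed (rule past_facts)+
  ultimately have "prob {\<omega> \<in> space P. z \<le> real (card (R n (outcome \<omega>)))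
           \<and> card (R (Suc n) (outcome \<omega>)) < \<zeta> * (M * p) * card (R n (outcome \<omega>))}
     \<le> prob {\<omega> \<in> space P. z \<le> real (card (R n (outcome \<omega>))) \<and> Q (outcome \<omega>) (outcome \<omega>)}"
    by (intro finite_measure_mono) auto
  with * show ?thesis
    by simp
qed

text \<open>Fewer than \<open>K\<close> intervals have fewer than \<open>M * K\<close> children, and
  these all fail with probability at least \<open>(1 - p) ^ (M * K)\<close>. As
  \<open>prob_conditional_le\<close> gives upper bounds, it is applied to the survival of some
  child.\<close>

lemma prob_extinction_step:
  "(1 - p) ^ (M * K) * prob {\<omega> \<in> space P. card (R n (outcome \<omega>)) \<in> {0<..<K}}
    \<le> prob {\<omega> \<in> space P. card (R n (outcome \<omega>)) \<in> {0<..<K} \<and> card (R (Suc n) (outcome \<omega>)) = 0}"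
proof -
  define G where "G v \<longleftrightarrow> card (R n v) \<in> {0<..<K}" for v
  define Q where "Q v x \<longleftrightarrow> (\<exists>q\<in>children M (R n v). x (Suc n, q))" for v x :: "nat \<times> nat \<Rightarrow> bool"
  have "prob {\<omega> \<in> space P. G (outcome \<omega>) \<and> Q (outcome \<omega>) (outcome \<omega>)}
    \<le> (1 - (1 - p) ^ (M * K)) * prob {\<omega> \<in> space P. G (outcome \<omega>)}"
  proof (rule prob_conditional_le[where J = "past n" and T = "next_level n" and Q = Q and G = G])
    show "depends_on (past n) G"
      using depends_on_R[of n] unfolding depends_on_def G_def by metis
    show "depends_on (past n) (\<lambda>v. Q v x)" for x
      using depends_on_R[of n] unfolding depends_on_def Q_def by metis
    have Q: "depends_on ({Suc n} \<times> children M (R n v)) (Q v)" for v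
      unfolding depends_on_def Q_def by blast
    have sub: "{Suc n} \<times> children M (R n v) \<subseteq> next_level n" for v
      using children_R[of n v] by (auto simp: next_level_def)
    then show "depends_on (next_level n) (Q v)" for v
      by (rule depends_on_mono[OF Q])
    fix v assume v: "G v"
    have "prob {\<omega> \<in> space P. Q v (outcome \<omega>)} = 1 - prob {\<omega> \<in> space P. \<forall>j\<in>{Suc n} \<times> children M (R n v). \<not> outcome \<omega> j}"
    proof -
      have "{\<omega> \<in> space P. Q v (outcome \<omega>)} \<in> events"
        by (rule event_depends_on[OF _ order_trans[OF sub past_facts(4)] Q]) simp
      from prob_compl[OF this] show ?thesis
        by (simp add: Q_def set_diff_eq Collect_conj_eq[symmetric] conj_disj_distribL cong: conj_cong)
    qed
    also have "prob {\<omega> \<in> space P. \<forall>j\<in>{Suc n} \<times> children M (R n v). \<not> outcome \<omega> j}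
      = (1 - p) ^ card ({Suc n} \<times> children M (R n v))"
    proof (rule prob_all_fail)
      show "{Suc n} \<times> children M (R n v) \<subseteq> (SIGMA n:{1..}. {..<M ^ n})"
        using children_R[of n v] by auto
      show "prob {\<omega> \<in> space P. (case j of (n, k) \<Rightarrow> X n k) \<omega>} = p"
        if "j \<in> {Suc n} \<times> children M (R n v)" for j
        using that children_R[of n v] prob_X[of "Suc n"] by auto
    qed simp
    also have "card ({Suc n} \<times> children M (R n v)) = M * card (R n v)"
      using M_pos by (simp add: card_cartesian_product card_children)
    also have "1 - (1 - p) ^ (M * card (R n v)) \<le> 1 - (1 - p) ^ (M * K)"
      using v p by (simp add: G_def power_decreasing)
    finally show "prob {\<omega> \<in> space P. Q v (outcome \<omega>)} \<le> 1 - (1 - p) ^ (M * K)" .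
  qed (rule past_facts)+
  moreover have "Q v v \<longleftrightarrow> card (R (Suc n) v) \<noteq> 0" for v
    by (auto simp: Q_def R_Suc)
  moreover have "prob {\<omega> \<in> space P. G (outcome \<omega>)} =
      prob {\<omega> \<in> space P. G (outcome \<omega>) \<and> card (R (Suc n) (outcome \<omega>)) \<noteq> 0}
      + prob {\<omega> \<in> space P. G (outcome \<omega>) \<and> card (R (Suc n) (outcome \<omega>)) = 0}"
    unfolding G_def
    by (subst finite_measure_Union[symmetric])
       (auto intro!: arg_cong[where f = prob] card_event[of "\<lambda>u v. u \<in> {0<..<K} \<and> v \<noteq> 0" n "Suc n", simplified]
          card_event[of "\<lambda>u v. u \<in> {0<..<K} \<and> v = 0" n "Suc n", simplified])
  ultimately show ?thesis
    by (simp add: G_def algebra_simps)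
qed

text \<open>A population dies out at most once, so the events of extinction right after level
  \<open>n\<close> are disjoint and have summable probabilities. Each has at least a fixed fraction
  of the probability that level \<open>n\<close> is small but nonempty.\<close>

lemma summable_prob_small:
  "summable (\<lambda>n. prob {\<omega> \<in> space P. card (R n (outcome \<omega>)) \<in> {0<..<K}})"
proof -
  define D where "D n = {\<omega> \<in> space P. card (R n (outcome \<omega>)) \<in> {0<..<K} \<and> card (R (Suc n) (outcome \<omega>)) = 0}" for n
  have D: "D n \<in> events" for n
    unfolding D_def by (rule card_event)
  have extinct: "R m v = {}" if "R n v = {}" "n \<le> m" for n m v
    using that(2,1) by (induction rule: dec_induct) (auto simp: R_Suc children_def)
  have disj: "disjoint_family D"
    unfolding disjoint_family_on_def
  proof (intro ballI impI)
    fix m n :: nat assume "m \<noteq> n"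
    have "D m \<inter> D n = {}" if "m < n" for m n
      using extinct[of "Suc m" _ n] that by (auto simp: D_def)
    then show "D m \<inter> D n = {}"
      using \<open>m \<noteq> n\<close> by (metis Int_commute nat_neq_iff)
  qed
  have "summable (\<lambda>n. prob (D n))"
    using finite_measure_UNION[OF _ disj] D by (auto simp: sums_iff)
  then have "summable (\<lambda>n. prob (D n) / (1 - p) ^ (M * K))"
    by (rule summable_divide)
  then show ?thesis
  proof (rule summable_comparison_test'[where N = 0])
    fix n
    show "norm (prob {\<omega> \<in> space P. card (R n (outcome \<omega>)) \<in> {0<..<K}}) \<le> prob (D n) / (1 - p) ^ (M * K)"
      using prob_extinction_step[of K n] p unfolding D_def by (simp add: field_simps)
  qed
qed

text \<open>
  Few retained intervals at level \<open>n\<close> is unlikely for large \<open>n\<close>, because it entails a fixed chance of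
  dying out in one step; starting from many intervals, slow growth ever after is unlikely.
\<close>

theorem AE_growth:
  assumes "0 < \<zeta>" "\<zeta> < 1" "1 < \<zeta> * (M * p)"
  shows "AE \<omega> in P. (\<forall>n. R n (outcome \<omega>) \<noteq> {}) \<longrightarrow>
     (\<exists>c>0. \<forall>\<^sub>F n in sequentially. c * (\<zeta> * (M * p)) ^ n \<le> card (R n (outcome \<omega>)))"
proof -
  define \<rho> where "\<rho> = \<zeta> * (M * p)"
  have \<rho>: "1 < \<rho>" "0 < \<rho>"
    using assms by (auto simp: \<rho>_def)
  define Z where "Z n \<omega> = card (R n (outcome \<omega>))" for n \<omega>
  define slow where "slow n = {\<omega> \<in> space P. Z (Suc n) \<omega> < \<rho> * Z n \<omega>}" for n
  define B where "B = {\<omega> \<in> space P. \<forall>n. 0 < Z n \<omega> \<and> (\<exists>m\<ge>n. \<omega> \<in> slow m)}"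
  have slow_sets [measurable]: "slow n \<in> events" for n
    unfolding slow_def Z_def by (rule card_event)
  have Z_sets [measurable]: "{\<omega> \<in> space P. 0 < Z n \<omega>} \<in> events" for n
    unfolding Z_def by (rule card_event)
  have B_sets [measurable]: "B \<in> events"
    unfolding B_def by measurable
  \<comment> \<open>\<open>c / K\<close> sums the bounds of \<open>prob_slow_growth\<close> for
    \<open>z = K * \<rho> ^ j\<close> over all \<open>j\<close>.\<close>
  define c where "c = 1 / ((1 - \<zeta>)\<^sup>2 * p\<^sup>2 * M) * (1 / (1 - 1 / \<rho>))"
  have B_le: "prob B \<le> c / K" if K: "0 < K" for K :: nat
  proof -
    \<comment> \<open>Up to the first slow step after level \<open>n\<close>, a population of at
      least \<open>K\<close> keeps growing by the factor \<open>\<rho>\<close>. So on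
      \<open>B\<close> either level \<open>n\<close> is small or some \<open>F j\<close> below
      occurs. Afterwards \<open>n\<close> and then \<open>K\<close> tend to infinity.\<close>
    have "prob B \<le> c / K + prob {\<omega> \<in> space P. Z n \<omega> \<in> {0<..<K}}" for n
    proof -
      define F where "F j = {\<omega> \<in> space P. K * \<rho> ^ j \<le> Z (n + j) \<omega> \<and> Z (Suc (n + j)) \<omega> < \<rho> * Z (n + j) \<omega>}" for j
      have F_sets: "F j \<in> events" for j
        unfolding F_def Z_def by (rule card_event)
      have F_le: "prob (F j) \<le> 1 / ((1 - \<zeta>)\<^sup>2 * p\<^sup>2 * M) / K * (1 / \<rho>) ^ j" for j
        using prob_slow_growth[of "K * \<rho> ^ j" \<zeta> "n + j"] K \<rho> assms
        by (simp add: F_def Z_def \<rho>_def power_one_over mult_ac)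
      have geo: "(\<lambda>j. 1 / ((1 - \<zeta>)\<^sup>2 * p\<^sup>2 * M) / K * (1 / \<rho>) ^ j) sums (1 / ((1 - \<zeta>)\<^sup>2 * p\<^sup>2 * M) / K * (1 / (1 - 1 / \<rho>)))"
        using \<rho> by (intro sums_mult geometric_sums) simp
      have F_summable: "summable (\<lambda>j. prob (F j))"
        by (rule summable_comparison_test'[OF sums_summable[OF geo], of 0]) (use F_le in simp)
      have "B \<subseteq> (\<Union>j. F j) \<union> {\<omega> \<in> space P. Z n \<omega> \<in> {0<..<K}}"
      proof
        fix \<omega> assume \<omega>: "\<omega> \<in> B"
        show "\<omega> \<in> (\<Union>j. F j) \<union> {\<omega> \<in> space P. Z n \<omega> \<in> {0<..<K}}"
        proof (cases "Z n \<omega> < K")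
          case False
          define j where "j = (LEAST j. \<omega> \<in> slow (n + j))"
          have "\<exists>j. \<omega> \<in> slow (n + j)"
            using \<omega> unfolding B_def by (auto dest!: spec[of _ n] simp: le_iff_add)
          then have j: "\<omega> \<in> slow (n + j)"
            unfolding j_def by (rule LeastI_ex)
          have "K * \<rho> ^ i \<le> Z (n + i) \<omega>" if "i \<le> j" for i
            using that
          proof (induction i)
            case (Suc i)
            then have "\<omega> \<notin> slow (n + i)"
              unfolding j_def by (intro not_less_Least) simp
            then have "\<rho> * Z (n + i) \<omega> \<le> Z (n + Suc i) \<omega>"
              using \<omega> by (simp add: slow_def B_def)
            moreover have "\<rho> * (K * \<rho> ^ i) \<le> \<rho> * Z (n + i) \<omega>"
              using Suc \<rho> by (intro mult_left_mono) auto
            ultimately show ?case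
              by (simp add: mult_ac)
          qed (use False in simp)
          then have "\<omega> \<in> F j"
            using j by (auto simp: F_def slow_def)
          then show ?thesis
            by blast
        qed (use \<omega> in \<open>auto simp: B_def\<close>)
      qed
      then have "prob B \<le> prob ((\<Union>j. F j) \<union> {\<omega> \<in> space P. Z n \<omega> \<in> {0<..<K}})"
        using F_sets card_event[of "\<lambda>u _. u \<in> {0<..<K}" n n]
        by (intro finite_measure_mono sets.Un sets.countable_UN) (auto simp: Z_def)
      also have "\<dots> \<le> prob (\<Union>j. F j) + prob {\<omega> \<in> space P. Z n \<omega> \<in> {0<..<K}}"
        using F_sets card_event[of "\<lambda>u _. u \<in> {0<..<K}" n n]
        by (intro measure_Un_le sets.countable_UN) (auto simp: Z_def)
      also have "prob (\<Union>j. F j) \<le> (\<Sum>j. prob (F j))"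
        using F_sets F_summable by (intro finite_measure_subadditive_countably) auto
      also have "\<dots> \<le> 1 / ((1 - \<zeta>)\<^sup>2 * p\<^sup>2 * M) / K * (1 / (1 - 1 / \<rho>))"
        using suminf_le[OF F_le F_summable sums_summable[OF geo]] sums_unique[OF geo] by simp
      also have "\<dots> = c / K"
        by (simp add: c_def)
      finally show ?thesis
        by simp
    qed
    moreover have "(\<lambda>n. c / K + prob {\<omega> \<in> space P. Z n \<omega> \<in> {0<..<K}}) \<longlonglongrightarrow> c / K + 0"
      unfolding Z_def by (intro tendsto_intros summable_LIMSEQ_zero summable_prob_small)
    ultimately show ?thesis
      using LIMSEQ_le_const[of "\<lambda>n. c / K + prob {\<omega> \<in> space P. Z n \<omega> \<in> {0<..<K}}" "c / K" "prob B"] by auto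
  qed
  have "(\<lambda>K. c / real (Suc K)) \<longlonglongrightarrow> 0"
    using LIMSEQ_Suc[OF lim_const_over_n[of c]] by simp
  then have "prob B \<le> 0"
    using B_le[of "Suc _"] by (intro LIMSEQ_le_const) auto
  then have "prob B = 0"
    by (simp add: measure_le_0_iff)
  then have "AE \<omega> in P. \<omega> \<notin> B"
    by (intro AE_not_in) (auto simp: null_sets_def emeasure_eq_measure)
  then show ?thesis
  proof (rule AE_mp, intro AE_I2 impI)
    fix \<omega> assume \<omega>: "\<omega> \<in> space P" "\<omega> \<notin> B" and alive: "\<forall>n. R n (outcome \<omega>) \<noteq> {}"
    have pos: "0 < Z n \<omega>" for n
      using alive by (simp add: Z_def card_gt_0_iff)
    with \<omega> obtain n where n: "\<And>m. n \<le> m \<Longrightarrow> \<omega> \<notin> slow m"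
      unfolding B_def by blast
    have *: "1 / \<rho> ^ n * \<rho> ^ m \<le> Z m \<omega>" if "n \<le> m" for m
      using that
    proof (induction rule: dec_induct)
      case base
      then show ?case
        using \<rho> pos[of n] by (simp add: Suc_leI)
    next
      case (step m)
      have "\<rho> * (1 / \<rho> ^ n * \<rho> ^ m) \<le> \<rho> * Z m \<omega>"
        using step \<rho> by (intro mult_left_mono) auto
      moreover have "\<rho> * Z m \<omega> \<le> Z (Suc m) \<omega>"
        using n[OF step.hyps(1)] \<omega> by (simp add: slow_def)
      ultimately show ?case
        by simp
    qed
    show "\<exists>c>0. \<forall>\<^sub>F n in sequentially. c * (\<zeta> * (M * p)) ^ n \<le> card (R n (outcome \<omega>))"
      using * \<rho> unfolding \<rho>_def[symmetric] Z_def
      by (intro exI[of _ "1 / \<rho> ^ n"] conjI eventually_sequentiallyI[of n]) auto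
  qed
qed

end

section \<open>Refining one coordinate at a time\<close>

context percolation_parameters
begin

text \<open>
  Time \<open>s\<close> of the exposure: the coordinates are refined cyclically, so that in the step from \<open>s\<close> to
  \<open>s + 1\<close> only coordinate \<open>s mod d\<close> moves, from level \<open>s div d\<close> to the next one.
\<close>

definition level :: "nat \<Rightarrow> nat \<Rightarrow> nat" where
  "level s j = (s + d - 1 - j) div d"

lemma d_pos [simp]: "0 < d" "d \<noteq> 0"
  using two_le_d by auto

lemma level_eq:
  assumes "j < d"
  shows "level s j = (if j < s mod d then Suc (s div d) else s div d)"
proof (cases "j < s mod d")
  case True
  have "s + d - 1 - j = (s mod d - 1 - j) + Suc (s div d) * d"
    using True div_mult_mod_eq[of s d] by simp
  then have "level s j = Suc (s div d) + (s mod d - 1 - j) div d"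
    unfolding level_def by (simp only: div_mult_self1[OF d_pos(2)])
  moreover have "s mod d - 1 - j < d"
    using mod_less_divisor[OF d_pos(1), of s] by linarith
  ultimately show ?thesis
    using True by simp
next
  case False
  have "s + d - 1 - j = (s mod d + d - 1 - j) + (s div d) * d"
    using assms div_mult_mod_eq[of s d] by simp
  then have "level s j = s div d + (s mod d + d - 1 - j) div d"
    unfolding level_def by (simp only: div_mult_self1[OF d_pos(2)])
  moreover have "s mod d + d - 1 - j < d"
    using False assms by linarith
  ultimately show ?thesis
    using False by simp
qed

lemma level_mult: "j < d \<Longrightarrow> level (n * d) j = n"
  by (simp add: level_eq)

lemma level_current: "level s (s mod d) = s div d"
  by (simp add: level_eq)

lemma level_Suc:
  assumes "j < d"
  shows "level (Suc s) j = (if j = s mod d then Suc (level s j) else level s j)"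
  using assms by (auto simp: level_eq mod_Suc div_Suc)

lemma level_le:
  assumes "j < d"
  shows "level s j \<le> Suc (s div d)" "level (Suc s) j \<le> Suc (s div d)"
  using assms by (simp_all add: level_Suc) (simp_all add: level_eq)

lemma level_mono: "s \<le> s' \<Longrightarrow> level s j \<le> level s' j"
  unfolding level_def by (intro div_le_mono) simp

text \<open>The added \<open>1\<close> gives \<open>threshold\<close> a deterministic lower bound,
  which absorbs the error between grid points.\<close>

definition density_sup :: "(nat \<Rightarrow> nat \<Rightarrow> nat \<Rightarrow> bool) \<Rightarrow> nat \<Rightarrow> nat set \<Rightarrow> real" where
  "density_sup x s S = 1 + (SUP t. sum_density x (level s) S t)"

lemma density_bdd: "S \<subseteq> {..<d} \<Longrightarrow> S \<noteq> {} \<Longrightarrow> bdd_above (range (sum_density x l S))"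
  using sum_density_le by (intro bdd_aboveI2)

lemma sum_density_le_sup:
  assumes "S \<subseteq> {..<d}" "S \<noteq> {}"
  shows "sum_density x (level s) S t \<le> density_sup x s S - 1"
  using cSUP_upper[OF UNIV_I density_bdd[OF assms]] by (simp add: density_sup_def)

lemma density_sup_ge_1:
  assumes "S \<subseteq> {..<d}" "S \<noteq> {}"
  shows "1 \<le> density_sup x s S"
  using sum_density_le_sup[OF assms, of x s 0] sum_density_nonneg[OF assms, of x "level s" 0] by linarith

lemma density_sup_le:
  assumes "\<And>t. sum_density x (level s) S t \<le> B"
  shows "density_sup x s S \<le> 1 + B"
  unfolding density_sup_def using assms by (auto intro: cSUP_least)

definition increment :: "(nat \<Rightarrow> nat \<Rightarrow> nat \<Rightarrow> bool) \<Rightarrow> nat \<Rightarrow> nat set \<Rightarrow> real \<Rightarrow> real" where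
  "increment x s S t =
     sum_density x (level (Suc s)) (insert (s mod d) S) t - sum_density x (level s) (insert (s mod d) S) t"

text \<open>Under the root stands \<open>p i\<close>, for \<open>i = s mod d\<close>, times the
  bounds on the largest child weight and on the sum of the child weights. The factor in front makes
  the probability of exceeding the threshold Gaussian in the level.\<close>

definition threshold :: "(nat \<Rightarrow> nat \<Rightarrow> nat \<Rightarrow> bool) \<Rightarrow> nat \<Rightarrow> nat set \<Rightarrow> real" where
  "threshold x s S = Suc (s div d) * sqrt (density_sup x s (insert (s mod d) S) * density_sup x s S
     / (M * p (s mod d)) ^ Suc (s div d))"

lemma increment_eq:
  assumes "S \<subseteq> {..<d}" "s mod d \<notin> S"
  shows "increment x s S t = (\<Sum>q\<in>children M (retained M (x (s mod d)) (s div d)).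
     (of_bool (x (s mod d) (Suc (s div d)) q) - p (s mod d)) * child_weight x (level s) S (s mod d) t q)"
proof -
  have "sum_density x (level (Suc s)) (insert (s mod d) S) =
    sum_density x ((level s)(s mod d := Suc (level s (s mod d)))) (insert (s mod d) S)"
    using assms by (intro sum_density_cong) (auto simp: level_Suc)
  then show ?thesis
    using sum_density_step[of S "s mod d" x "level s" t] assms by (simp add: increment_def level_current)
qed

definition p_all :: real where
  "p_all = (\<Prod>i<d. p i)"

lemma p_all_bounds: "0 < p_all" "p_all \<le> 1"
  unfolding p_all_def using p_range by (auto intro!: prod_pos prod_le_1 simp: less_imp_le)

lemma p_all_le: 
  assumes "i < d"
  shows "p_all \<le> p i"
proof -
  have "p_all = p i * (\<Prod>j\<in>{..<d} - {i}. p j)"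
    unfolding p_all_def using assms by (intro prod.remove) auto
  also have "\<dots> \<le> p i"
    using p_range by (intro mult_left_le prod_le_1) (auto simp: assms less_imp_le)
  finally show ?thesis .
qed

lemma p_all_power_le:
  assumes "S \<subseteq> {..<d}" "\<And>i. i \<in> S \<Longrightarrow> l i \<le> N"
  shows "p_all ^ N \<le> (\<Prod>i\<in>S. p i ^ l i)"
proof -
  have "p_all = (\<Prod>i\<in>{..<d} - S. p i) * (\<Prod>i\<in>S. p i)"
    unfolding p_all_def using assms by (intro prod.subset_diff) auto
  then have "p_all ^ N = (\<Prod>i\<in>S. p i ^ N) * (\<Prod>i\<in>{..<d} - S. p i ^ N)"
    by (simp only: power_mult_distrib prod_power_distrib mult.commute)
  also have "\<dots> \<le> (\<Prod>i\<in>S. p i ^ N)"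
    using p_range assms(1)
    by (intro mult_left_le prod_le_1 prod_nonneg) (auto simp: less_imp_le power_le_one subset_iff)
  also have "\<dots> \<le> (\<Prod>i\<in>S. p i ^ l i)"
    using p_range assms by (intro prod_mono) (auto simp: less_imp_le subset_iff intro!: power_decreasing)
  finally show ?thesis .
qed

lemma inverse_abs_le: "i < d \<Longrightarrow> 1 / \<bar>a i\<bar> \<le> density_constant"
  unfolding density_constant_def by (rule member_le_sum[of i]) auto

lemma density_constant_pos: "0 < density_constant"
  using inverse_abs_le[of 0] a_nonzero[of 0] by (simp add: order_less_le_trans[of 0 "1 / \<bar>a 0\<bar>"])

text \<open>Makes a deterministic grid possible: the constant is exponential in the level and
  independent of \<open>x\<close>.\<close>

lemma uniform_lipschitz:
  assumes S: "S \<subseteq> {..<d}" "i \<notin> S" "i < d" "S \<noteq> {}" and l: "\<And>j. j < d \<Longrightarrow> l j \<le> N"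
  shows "\<bar>sum_density x l (insert i S) t - sum_density x l (insert i S) t'\<bar>
    \<le> 2 * density_constant\<^sup>2 * (M / p_all) ^ N * \<bar>t - t'\<bar>"
proof -
  define c where "c = density_constant"
  have c: "0 < c"
    by (simp add: c_def density_constant_pos)
  define prodp where "prodp = (\<Prod>j\<in>S. p j ^ l j)"
  have prodp: "0 < prodp"
    unfolding prodp_def using p_range S by (intro prod_pos) auto
  have prodp_ge: "p_all ^ N \<le> p i ^ l i * prodp"
    using p_all_power_le[of "insert i S" l N] S l finite_indices[OF S(1)] by (auto simp: prodp_def)
  have "\<bar>sum_density x l (insert i S) t - sum_density x l (insert i S) t'\<bar>
    \<le> 2 * (c / prodp) * real M ^ l i / (\<bar>a i\<bar> * p i ^ l i) * \<bar>t - t'\<bar>"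
    unfolding c_def prodp_def by (rule sum_density_lipschitz[OF S sum_density_le[OF S(1,4)]])
  also have "2 * (c / prodp) * real M ^ l i / (\<bar>a i\<bar> * p i ^ l i) = 2 * c * (1 / \<bar>a i\<bar>) * (real M ^ l i / (p i ^ l i * prodp))"
    by simp
  also have "\<dots> \<le> 2 * c * c * (real M ^ N / p_all ^ N)"
  proof (intro mult_mono frac_le prodp_ge power_increasing l S)
    show "1 / \<bar>a i\<bar> \<le> c"
      unfolding c_def using S by (intro inverse_abs_le)
    show "1 \<le> real M"
      using two_le_M by simp
  qed (use c prodp p_range[OF S(3)] p_all_bounds in auto)
  finally show ?thesis
    by (simp add: c_def power2_eq_square power_divide mult_right_mono)
qed

text \<open>Write \<open>N = Suc (s div d)\<close>. As both suprema are at least \<open>1\<close>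
  and \<open>p i < 1\<close>, the expression under the root is at least \<open>M ^ (- N)\<close>,
  hence at least the square of \<open>M ^ (- N)\<close>.\<close>

lemma threshold_ge:
  assumes "S \<subseteq> {..<d}" "S \<noteq> {}"
  shows "1 / real M ^ Suc (s div d) \<le> threshold x s S"
proof -
  define i N where "i = s mod d" and "N = Suc (s div d)"
  have i: "i < d"
    by (simp add: i_def)
  have "1 / real M ^ N \<le> 1"
    using two_le_M by simp
  then have "(1 / real M ^ N)\<^sup>2 \<le> 1 / real M ^ N"
    unfolding power2_eq_square by (intro mult_left_le) auto
  also have "\<dots> \<le> 1 / (M * p i) ^ N"
    using p_range[OF i] by (intro divide_left_mono power_mono mult_left_le) (auto intro!: mult_pos_pos)
  also have "\<dots> \<le> density_sup x s (insert i S) * density_sup x s S / (M * p i) ^ N"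
  proof (rule divide_right_mono)
    have "1 * 1 \<le> density_sup x s (insert i S) * density_sup x s S"
      using assms i by (intro mult_mono density_sup_ge_1) (auto intro: order_trans[OF _ density_sup_ge_1])
    then show "1 \<le> density_sup x s (insert i S) * density_sup x s S"
      by simp
  qed (use p_range[OF i] in auto)
  finally have "1 / real M ^ N \<le> sqrt (density_sup x s (insert i S) * density_sup x s S / (M * p i) ^ N)"
    by (rule real_le_rsqrt)
  also have "\<dots> \<le> N * sqrt (density_sup x s (insert i S) * density_sup x s S / (M * p i) ^ N)"
    using \<open>1 / real M ^ N \<le> sqrt _\<close>[THEN order_trans[rotated], of 0] 
    by (intro order_trans[OF _ mult_right_mono[of 1 "real N"]]) (auto simp: N_def)
  finally show ?thesis
    by (simp only: threshold_def N_def i_def)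
qed

section \<open>The grid of test points\<close>

definition radius :: real where
  "radius = (\<Sum>i<d. \<bar>a i\<bar>)"

lemma radius_pos: "0 < radius"
  unfolding radius_def by (rule sum_pos2[of _ 0]) (use a_nonzero[of 0] in auto)

text \<open>Two Lipschitz bounds over the distance \<open>2 * radius / grid_base ^ N\<close> add up
  to \<open>8 * density_constant\<^sup>2 * radius * (M / p_all) ^ N / grid_base ^ N\<close>; the
  base brings this below \<open>1 / M ^ N\<close>. The maximum with \<open>1\<close> allows the
  constant to be raised to the power \<open>N\<close>.\<close>

definition grid_base :: nat where
  "grid_base = nat \<lceil>real M ^ 2 / p_all * max 1 (8 * density_constant\<^sup>2 * radius)\<rceil>"

definition grid :: "nat \<Rightarrow> nat \<Rightarrow> real" where
  "grid N j = radius * (2 * (real j / grid_base ^ N) - 1)"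

lemma grid_base_ge: "real M ^ 2 / p_all * max 1 (8 * density_constant\<^sup>2 * radius) \<le> grid_base"
  by (simp add: grid_base_def real_nat_ceiling_ge)

lemma grid_base_pos: "1 \<le> grid_base"
proof -
  have "0 < real M ^ 2 / p_all * max 1 (8 * density_constant\<^sup>2 * radius)"
    using p_all_bounds by simp
  then have "0 < real grid_base"
    using grid_base_ge by linarith
  then show ?thesis
    by simp
qed

lemma grid_dense:
  assumes "\<bar>t\<bar> \<le> radius"
  shows "\<exists>j\<le>grid_base ^ N. \<bar>t - grid N j\<bar> \<le> 2 * radius / grid_base ^ N"
proof -
  define g where "g = real (grid_base ^ N)"
  have g: "0 < g"
    using grid_base_pos by (simp add: g_def)
  define u where "u = (t / radius + 1) / 2 * g"
  have "u / g = (t / radius + 1) / 2"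
    using g by (simp add: u_def)
  then have t: "t = radius * (2 * (u / g) - 1)"
    using radius_pos by (simp only:) (simp add: field_simps)
  have "- 1 \<le> t / radius" "t / radius \<le> 1"
    using assms radius_pos by (auto simp: field_simps abs_le_iff)
  then have u: "0 \<le> u" "u \<le> g"
    using g by (auto simp: u_def)
  define j where "j = nat \<lfloor>u\<rfloor>"
  have j: "real j \<le> u" "u < real j + 1"
    using u unfolding j_def by linarith+
  have "real j \<le> g"
    using j u by linarith
  then have "j \<le> grid_base ^ N"
    unfolding g_def by (simp only: of_nat_le_iff)
  moreover have "t - grid N j = 2 * radius * (u - j) / g"
    using g by (simp add: t grid_def g_def field_simps)
  then have "\<bar>t - grid N j\<bar> \<le> 2 * radius / g"
    using j g radius_pos by (simp add: abs_mult divide_right_mono mult_left_le)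
  ultimately show ?thesis
    by (auto simp: g_def)
qed

text \<open>One \<open>threshold\<close> comes from a nearby grid point, the other pays for the
  variation of the two densities in between. Beyond \<open>radius\<close> both densities
  vanish.\<close>

lemma increment_le_of_grid:
  assumes S: "S \<subseteq> {..<d}" "S \<noteq> {}" "s mod d \<notin> S"
    and grid: "\<And>j. j \<le> grid_base ^ Suc (s div d) \<Longrightarrow> \<bar>increment x s S (grid (Suc (s div d)) j)\<bar> \<le> threshold x s S"
  shows "\<bar>increment x s S t\<bar> \<le> 2 * threshold x s S"
proof (cases "\<bar>t\<bar> \<le> radius")
  case True
  define N where "N = Suc (s div d)"
  define c where "c = 8 * density_constant\<^sup>2 * radius"
  obtain j where j: "j \<le> grid_base ^ N" "\<bar>t - grid N j\<bar> \<le> 2 * radius / grid_base ^ N"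
    using grid_dense[OF True] by blast
  have lip: "\<bar>sum_density x (level s') (insert (s mod d) S) t - sum_density x (level s') (insert (s mod d) S) (grid N j)\<bar>
    \<le> 2 * density_constant\<^sup>2 * (M / p_all) ^ N * \<bar>t - grid N j\<bar>" if "s' = s \<or> s' = Suc s" for s'
    by (rule uniform_lipschitz) (use S that level_le in \<open>auto simp: N_def\<close>)
  have "\<bar>increment x s S t\<bar> \<le> \<bar>increment x s S (grid N j)\<bar> + 2 * (2 * density_constant\<^sup>2 * (M / p_all) ^ N * \<bar>t - grid N j\<bar>)"
    using lip[of s] lip[of "Suc s"] unfolding increment_def by linarith
  also have "2 * (2 * density_constant\<^sup>2 * (M / p_all) ^ N * \<bar>t - grid N j\<bar>)
    \<le> 2 * (2 * density_constant\<^sup>2 * (M / p_all) ^ N * (2 * radius / grid_base ^ N))"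
    using j p_all_bounds by (intro mult_left_mono) auto
  also have "\<dots> = c * (M / p_all) ^ N / grid_base ^ N"
    by (simp add: c_def)
  also have "\<dots> \<le> 1 / real M ^ N"
  proof -
    have "max 1 c ^ 1 \<le> max 1 c ^ N"
      by (intro power_increasing) (auto simp: N_def)
    then have "c * (real M ^ 2 / p_all) ^ N \<le> max 1 c ^ N * (real M ^ 2 / p_all) ^ N"
      using p_all_bounds by (intro mult_right_mono) auto
    also have "\<dots> = (real M ^ 2 / p_all * max 1 c) ^ N"
      by (simp only: power_mult_distrib mult.commute)
    also have "\<dots> \<le> real grid_base ^ N"
      using grid_base_ge p_all_bounds by (intro power_mono) (auto simp: c_def)
    finally have *: "c * (real M ^ 2 / p_all) ^ N \<le> real grid_base ^ N" .
    have "c * (M / p_all) ^ N * real M ^ N = c * (real M ^ 2 / p_all) ^ N"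
      by (simp add: power_divide power2_eq_square power_mult_distrib)
    then have "c * (M / p_all) ^ N * real M ^ N \<le> real grid_base ^ N"
      using * by (simp only:)
    moreover have "u / g \<le> 1 / m" if "u * m \<le> g" "0 < m" "0 < g" for u g m :: real
      using that by (simp add: field_simps)
    ultimately show ?thesis
      using grid_base_pos by simp
  qed
  also have "\<dots> \<le> threshold x s S"
    unfolding N_def by (rule threshold_ge) fact+
  finally show ?thesis
    using grid[of j] j by (simp add: N_def)
next
  case False
  then have "increment x s S t = 0"
    using S by (simp add: increment_def sum_density_eq_0 radius_def)
  moreover have "0 \<le> threshold x s S"
    using threshold_ge[OF S(1,2), of s x] by (meson order_trans zero_le_divide_1_iff zero_le_power of_nat_0_le_iff)
  ultimately show ?thesis
    by simp
qed

end

text \<open>Serves the union bound, with \<open>q ^ s\<close> for the number of grid points. The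
  terms are \<open>s\<close>-th powers of a quantity tending to \<open>0\<close>.\<close>

lemma summable_gaussian:
  fixes q c :: real
  assumes "0 < q" "0 < c"
  shows "summable (\<lambda>s. q ^ s * exp (- c * real s ^ 2))"
proof (rule summable_comparison_test_ev)
  have "(\<lambda>s. q * exp (- c * real s)) \<longlonglongrightarrow> 0"
    using assms by real_asymp
  then have "\<forall>\<^sub>F s in sequentially. q * exp (- c * real s) < 1/2"
    by (rule order_tendstoD) simp
  then show "\<forall>\<^sub>F s in sequentially. norm (q ^ s * exp (- c * real s ^ 2)) \<le> (1/2) ^ s"
  proof (rule eventually_mono)
    fix s assume "q * exp (- c * real s) < 1/2"
    then have "(q * exp (- c * real s)) ^ s \<le> (1/2) ^ s"
      using assms by (intro power_mono) auto
    moreover have "(q * exp (- c * real s)) ^ s = q ^ s * exp (- c * real s ^ 2)"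
      by (simp add: power_mult_distrib exp_of_nat_mult[symmetric] power2_eq_square mult_ac)
    ultimately show "norm (q ^ s * exp (- c * real s ^ 2)) \<le> (1/2) ^ s"
      using assms by simp
  qed
qed simp

section \<open>Concentration of the increments\<close>

locale percolation_sum =
  independent_fractal_percolations P d M p X E + percolation_parameters d M p a
  for P :: "'w measure" and d M p X E a
begin

sublocale trials: independent_trials P "\<lambda>(i, n, k). X i n k" "SIGMA i:{..<d}. SIGMA n:{1..}. {..<M ^ n}"
  using indep_trials by unfold_locales

definition configuration :: "(nat \<times> nat \<times> nat \<Rightarrow> bool) \<Rightarrow> nat \<Rightarrow> nat \<Rightarrow> nat \<Rightarrow> bool" where
  "configuration v i n k = v (i, n, k)"

lemma configuration_outcome: "configuration (trials.outcome \<omega>) = (\<lambda>i n k. X i n k \<omega>)"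
  by (simp add: configuration_def trials.outcome_def fun_eq_iff)

text \<open>The trials revealed by time \<open>s\<close>; the coordinates may stand at different
  levels.\<close>

definition past :: "nat \<Rightarrow> (nat \<times> nat \<times> nat) set" where
  "past s = (SIGMA j:{..<d}. SIGMA m:{1..level s j}. {..<M ^ m})"

lemma past_facts: "finite (past s)" "past s \<subseteq> (SIGMA i:{..<d}. SIGMA n:{1..}. {..<M ^ n})"
  by (auto simp: past_def)

lemma past_mono: "past s \<subseteq> past (Suc s)"
proof -
  have "level s j \<le> level (Suc s) j" for j
    by (rule level_mono) simp
  then show ?thesis
    by (fastforce simp: past_def intro: le_trans)
qed

lemma retained_past:
  assumes "\<And>j. j \<in> past s \<Longrightarrow> v j = w j" "j < d"
  shows "retained M (configuration v j) (level s j) = retained M (configuration w j) (level s j)"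
  by (rule retained_cong) (use assms in \<open>auto simp: configuration_def past_def\<close>)

lemma sum_density_past:
  assumes "\<And>j. j \<in> past s \<Longrightarrow> v j = w j" "S \<subseteq> {..<d}"
  shows "sum_density (configuration v) (level s) S = sum_density (configuration w) (level s) S"
  using assms by (intro sum_density_cong retained_past) auto

lemma threshold_past:
  assumes "\<And>j. j \<in> past s \<Longrightarrow> v j = w j" "S \<subseteq> {..<d}"
  shows "threshold (configuration v) s S = threshold (configuration w) s S"
proof -
  have "density_sup (configuration v) s S' = density_sup (configuration w) s S'" if "S' \<subseteq> {..<d}" for S'
    unfolding density_sup_def using sum_density_past[OF assms(1) that] by simp
  then show ?thesis
    using assms by (simp add: threshold_def)
qed

lemma event_large_increment:
  assumes "S \<subseteq> {..<d}"
  shows "{\<omega> \<in> space P. threshold (configuration (trials.outcome \<omega>)) s S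
           \<le> \<bar>increment (configuration (trials.outcome \<omega>)) s S t\<bar>} \<in> events"
proof (rule trials.event_depends_on[OF past_facts])
  show "depends_on (past (Suc s)) (\<lambda>v. threshold (configuration v) s S \<le> \<bar>increment (configuration v) s S t\<bar>)"
  proof (rule depends_onI)
    fix v w :: "nat \<times> nat \<times> nat \<Rightarrow> bool" assume vw: "\<And>j. j \<in> past (Suc s) \<Longrightarrow> v j = w j"
    then have vw': "\<And>j. j \<in> past s \<Longrightarrow> v j = w j"
      using past_mono by blast
    have sub: "insert (s mod d) S \<subseteq> {..<d}"
      using assms by auto
    have "increment (configuration v) s S t = increment (configuration w) s S t"
      using sum_density_past[of "Suc s" v w, OF vw sub] sum_density_past[of s v w, OF vw' sub]
      by (simp add: increment_def)
    then show "(threshold (configuration v) s S \<le> \<bar>increment (configuration v) s S t\<bar>) =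
      (threshold (configuration w) s S \<le> \<bar>increment (configuration w) s S t\<bar>)"
      using threshold_past[of s v w, OF vw' assms] by simp
  qed
qed

text \<open>Given the past, the sum of squared weights is at most \<open>b\<close>, the bound on the
  largest weight times the bound on the total weight, and the squared threshold is
  \<open>(Suc n)\<^sup>2 * p i * b\<close>. So the random suprema cancel from Hoeffding's
  exponent.\<close>

lemma prob_large_increment:
  assumes S: "S \<subseteq> {..<d}" "S \<noteq> {}" "s mod d \<notin> S"
  shows "prob {\<omega> \<in> space P. threshold (configuration (trials.outcome \<omega>)) s S
           \<le> \<bar>increment (configuration (trials.outcome \<omega>)) s S t\<bar>}
     \<le> 2 * exp (- 2 * p_all * (Suc (s div d))\<^sup>2)"
proof -
  define i n where "i = s mod d" and "n = s div d"
  have i: "i < d" "level s i = n" "i \<notin> S"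
    using S by (auto simp: i_def n_def level_current)
  note p = p_range[OF i(1)]
  define ch where "ch v = children M (retained M (configuration v i) n)" for v
  define w where "w v = child_weight (configuration v) (level s) S i t" for v
  \<comment> \<open>The whole next level of coordinate \<open>i\<close>, so that \<open>T\<close>
    does not depend on the past, although only children of retained intervals enter the sum.\<close>
  define T where "T = {i} \<times> {Suc n} \<times> {..<M ^ Suc n}"
  define Q where "Q v x \<longleftrightarrow> threshold (configuration v) s S
      \<le> \<bar>\<Sum>q\<in>ch v. (of_bool (x (i, Suc n, q)) - p i) * w v q\<bar>" for v x :: "nat \<times> nat \<times> nat \<Rightarrow> bool"
  have ch: "ch v \<subseteq> {..<M ^ Suc n}" "finite (ch v)" for v
    unfolding ch_def by (intro children_subset finite_children retained_subset finite_retained M_pos)+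
  have Q: "Q v v \<longleftrightarrow> threshold (configuration v) s S \<le> \<bar>increment (configuration v) s S t\<bar>" for v
    unfolding Q_def increment_eq[OF S(1,3)] by (simp add: ch_def w_def configuration_def i_def n_def)
  \<comment> \<open>No past has to be excluded, because the threshold adapts to it.\<close>
  have "prob {\<omega> \<in> space P. True \<and> Q (trials.outcome \<omega>) (trials.outcome \<omega>)}
    \<le> 2 * exp (- 2 * p_all * (Suc n)\<^sup>2) * prob {\<omega> \<in> space P. True}"
  proof (rule trials.prob_conditional_le[where J = "past s" and T = T and Q = Q and G = "\<lambda>_. True"])
    show "past s \<inter> T = {}"
      using i by (auto simp: past_def T_def)
    show "T \<subseteq> (SIGMA i:{..<d}. SIGMA n:{1..}. {..<M ^ n})"
      using i by (auto simp: T_def)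
    show "depends_on (past s) (\<lambda>v. Q v x)" for x
    proof (rule depends_onI)
      fix u v :: "nat \<times> nat \<times> nat \<Rightarrow> bool" assume uv: "\<And>j. j \<in> past s \<Longrightarrow> u j = v j"
      have "ch u = ch v"
        using retained_past[of s u v, OF uv i(1)] i by (simp add: ch_def)
      moreover have "sum_cdf (configuration u) (level s) S = sum_cdf (configuration v) (level s) S"
        using uv S by (intro sum_cdf_cong retained_past) auto
      then have "w u = w v"
        by (simp add: w_def child_weight_def fun_eq_iff)
      ultimately show "Q u x = Q v x"
        using threshold_past[of s u v, OF uv S(1)] by (simp add: Q_def)
    qed
    show "depends_on T (Q v)" for v
    proof (rule depends_onI)
      fix x y :: "nat \<times> nat \<times> nat \<Rightarrow> bool" assume xy: "\<And>j. j \<in> T \<Longrightarrow> x j = y j"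
      have "(\<Sum>q\<in>ch v. (of_bool (x (i, Suc n, q)) - p i) * w v q) = (\<Sum>q\<in>ch v. (of_bool (y (i, Suc n, q)) - p i) * w v q)"
      proof (rule sum.cong)
        fix q assume "q \<in> ch v"
        then have "(i, Suc n, q) \<in> T"
          using ch by (auto simp: T_def)
        then show "(of_bool (x (i, Suc n, q)) - p i) * w v q = (of_bool (y (i, Suc n, q)) - p i) * w v q"
          using xy by simp
      qed simp
      then show "Q v x = Q v y"
        by (simp add: Q_def)
    qed
    show "prob {\<omega> \<in> space P. Q v (trials.outcome \<omega>)} \<le> 2 * exp (- 2 * p_all * (Suc n)\<^sup>2)" for v
    proof -
      define x where "x = configuration v"
      define B B' where "B = density_sup x s (insert i S)" and "B' = density_sup x s S"
      have S': "insert i S \<subseteq> {..<d}" "insert i S \<noteq> {}"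
        using S i by auto
      have B: "1 \<le> B" "1 \<le> B'"
        unfolding B_def B'_def using S S' by (auto intro: density_sup_ge_1)
      define b where "b = B' / (M * p i) ^ Suc n * (B / p i)"
      have b: "0 < b"
        using B p by (auto simp: b_def intro!: mult_pos_pos divide_pos_pos)
      define W where "W = (\<lambda>(i::nat, n::nat, q). w v q)"
      have w_nonneg: "0 \<le> w v q" for q
        unfolding w_def using S i by (intro child_weight_nonneg)
      have w_le: "w v q \<le> B' / (M * p i) ^ Suc n" for q
      proof -
        have "sum_density x (level s) S t \<le> B'" for t
          using sum_density_le_sup[OF S(1,2), of x s t] by (simp add: B'_def)
        from child_weight_le[OF S(1) i(1) S(2) this, of t q] show ?thesis
          by (simp add: w_def x_def i)
      qed
      have sum_w: "(\<Sum>q\<in>ch v. w v q) \<le> B / p i"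
        using sum_child_weight[OF S(1) i(1,3), of x "level s" t] sum_density_le_sup[OF S', of x s t] p
        by (simp add: ch_def w_def x_def i B_def divide_right_mono)
      have reindex: "(\<Sum>j\<in>{i} \<times> {Suc n} \<times> ch v. f j) = (\<Sum>q\<in>ch v. f (i, Suc n, q))" for f :: "_ \<Rightarrow> real"
        by (rule sum.reindex_bij_witness[of _ "\<lambda>q. (i, Suc n, q)" "snd \<circ> snd"]) auto
      define r where "r = threshold x s S"
      have "0 < 1 / real M ^ Suc (s div d)"
        by simp
      then have r: "0 < r"
        using threshold_ge[OF S(1,2), of s x] unfolding r_def by linarith
      have "prob {\<omega> \<in> space P. \<bar>\<Sum>j\<in>{i} \<times> {Suc n} \<times> ch v. (of_bool (trials.outcome \<omega> j) - p i) * W j\<bar> \<ge> r}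
        \<le> 2 * exp (- 2 * r\<^sup>2 / b)"
      proof (rule trials.weighted_Hoeffding)
        show "{i} \<times> {Suc n} \<times> ch v \<subseteq> (SIGMA i:{..<d}. SIGMA n:{1..}. {..<M ^ n})"
          using ch[of v] i by auto
        show "prob {\<omega> \<in> space P. (case j of (i, n, k) \<Rightarrow> X i n k) \<omega>} = p i" if "j \<in> {i} \<times> {Suc n} \<times> ch v" for j
          using that ch[of v] i prob_retain[of i "Suc n"] by auto
        text \<open>The sum of squares is at most the maximum times the sum of the weights.\<close>
        have "(\<Sum>j\<in>{i} \<times> {Suc n} \<times> ch v. (W j)\<^sup>2) = (\<Sum>q\<in>ch v. w v q * w v q)"
          by (simp add: reindex W_def power2_eq_square)
        also have "\<dots> \<le> (\<Sum>q\<in>ch v. B' / (M * p i) ^ Suc n * w v q)"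
          by (intro sum_mono mult_right_mono w_le w_nonneg)
        also have "\<dots> = B' / (M * p i) ^ Suc n * (\<Sum>q\<in>ch v. w v q)"
          by (simp add: sum_distrib_left)
        also have "\<dots> \<le> b"
          unfolding b_def using B p by (intro mult_left_mono sum_w) auto
        finally show "(\<Sum>j\<in>{i} \<times> {Suc n} \<times> ch v. (W j)\<^sup>2) \<le> b" .
      qed (use r ch w_nonneg in \<open>auto simp: W_def\<close>)
      also have "- 2 * r\<^sup>2 / b = - 2 * p i * (Suc n)\<^sup>2"
      proof -
        have "r\<^sup>2 = (Suc n)\<^sup>2 * (B * B' / (M * p i) ^ Suc n)"
          unfolding r_def threshold_def i_def[symmetric] n_def[symmetric] B_def[symmetric] B'_def[symmetric] power_mult_distrib
          using B p by (subst real_sqrt_pow2) auto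
        also have "\<dots> = (Suc n)\<^sup>2 * p i * b"
          using p by (simp add: b_def mult_ac)
        finally show ?thesis
          using b by simp
      qed
      also have "2 * exp (- 2 * p i * (Suc n)\<^sup>2) \<le> 2 * exp (- 2 * p_all * (Suc n)\<^sup>2)"
        using p_all_le[OF i(1)] by (auto intro!: mult_right_mono)
      finally show ?thesis
        by (simp add: Q_def reindex W_def r_def x_def)
    qed
  qed (use past_facts in \<open>simp_all add: T_def depends_on_def\<close>)
  then show ?thesis
    by (simp add: Q n_def prob_space)
qed

text \<open>Borel-Cantelli, with at most \<open>2 * grid_base ^ Suc s\<close> grid points against a
  tail of order \<open>exp (- c * s\<^sup>2)\<close>.\<close>

lemma AE_increment_set:
  assumes S: "S \<subseteq> {..<d}" "S \<noteq> {}"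
  shows "AE \<omega> in P. \<forall>\<^sub>F s in sequentially. s mod d \<notin> S \<longrightarrow>
     (\<forall>t. \<bar>increment (\<lambda>i n k. X i n k \<omega>) s S t\<bar> \<le> 2 * threshold (\<lambda>i n k. X i n k \<omega>) s S)"
proof -
  define x where "x \<omega> = configuration (trials.outcome \<omega>)" for \<omega>
  define N where "N s = Suc (s div d)" for s
  define A where "A s = (if s mod d \<in> S then {} else
    (\<Union>j\<le>grid_base ^ N s. {\<omega> \<in> space P. threshold (x \<omega>) s S \<le> \<bar>increment (x \<omega>) s S (grid (N s) j)\<bar>}))" for s
  have A_sets: "A s \<in> events" for s
    unfolding A_def x_def using event_large_increment[OF S(1)] by auto
  have A_le: "prob (A s) \<le> 4 * grid_base * (grid_base ^ s * exp (- (2 * p_all / (real d)\<^sup>2) * real s ^ 2))" for s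
  proof (cases "s mod d \<in> S")
    case False
    have N: "N s \<le> Suc s" "real s / d \<le> N s"
    proof -
      show "N s \<le> Suc s"
        by (simp add: N_def)
      have "s < N s * d"
        using dividend_less_div_times[of d s] by (simp add: N_def)
      then have "real s \<le> real (N s) * real d"
        by (metis less_imp_le of_nat_le_iff of_nat_mult)
      then show "real s / d \<le> N s"
        by (simp add: divide_le_eq)
    qed
    have "prob (A s) \<le> (\<Sum>j\<le>grid_base ^ N s. prob {\<omega> \<in> space P. threshold (x \<omega>) s S \<le> \<bar>increment (x \<omega>) s S (grid (N s) j)\<bar>})"
      unfolding A_def if_not_P[OF False] x_def using event_large_increment[OF S(1)]
      by (intro finite_measure_subadditive_finite) auto
    also have "\<dots> \<le> (\<Sum>j\<le>grid_base ^ N s. 2 * exp (- 2 * p_all * (real (N s))\<^sup>2))"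
      unfolding x_def N_def using prob_large_increment[OF S False] by (intro sum_mono) simp
    also have "\<dots> = real (1 + grid_base ^ N s) * (2 * exp (- 2 * p_all * (real (N s))\<^sup>2))"
      by simp
    also have "\<dots> \<le> real (2 * grid_base ^ Suc s) * (2 * exp (- (2 * p_all / (real d)\<^sup>2) * real s ^ 2))"
    proof (rule mult_mono)
      have "1 \<le> grid_base ^ Suc s" "grid_base ^ N s \<le> grid_base ^ Suc s"
        using grid_base_pos N by (auto intro: one_le_power power_increasing simp del: power_Suc)
      then have "1 + grid_base ^ N s \<le> 2 * grid_base ^ Suc s"
        by linarith
      then show "real (1 + grid_base ^ N s) \<le> real (2 * grid_base ^ Suc s)"
        by (simp only: of_nat_le_iff)
      have "(real s / d)\<^sup>2 \<le> (real (N s))\<^sup>2"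
        using N by (intro power_mono) auto
      then have "2 * p_all * (real s / d)\<^sup>2 \<le> 2 * p_all * (real (N s))\<^sup>2"
        using p_all_bounds by (intro mult_left_mono) auto
      then show "2 * exp (- 2 * p_all * (real (N s))\<^sup>2) \<le> 2 * exp (- (2 * p_all / (real d)\<^sup>2) * real s ^ 2)"
        by (simp add: power_divide)
    qed auto
    also have "\<dots> = 4 * grid_base * (grid_base ^ s * exp (- (2 * p_all / (real d)\<^sup>2) * real s ^ 2))"
      by simp
    finally show ?thesis .
  qed (simp add: A_def)
  have "summable (\<lambda>s. 4 * real grid_base * (real grid_base ^ s * exp (- (2 * p_all / (real d)\<^sup>2) * real s ^ 2)))"
    using grid_base_pos p_all_bounds by (intro summable_mult summable_gaussian) auto
  then have "summable (\<lambda>s. prob (A s))"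
    by (rule summable_comparison_test'[where N = 0]) (use A_le in simp)
  then have "AE \<omega> in P. \<forall>\<^sub>F s in sequentially. \<omega> \<in> space P - A s"
    using A_sets by (intro borel_cantelli_AE1) (auto simp: emeasure_eq_measure)
  then show ?thesis
  proof (rule eventually_mono)
    fix \<omega> assume "\<forall>\<^sub>F s in sequentially. \<omega> \<in> space P - A s"
    then show "\<forall>\<^sub>F s in sequentially. s mod d \<notin> S \<longrightarrow>
     (\<forall>t. \<bar>increment (\<lambda>i n k. X i n k \<omega>) s S t\<bar> \<le> 2 * threshold (\<lambda>i n k. X i n k \<omega>) s S)"
    proof (rule eventually_mono, intro impI allI)
      fix s t assume \<omega>: "\<omega> \<in> space P - A s" "s mod d \<notin> S"
      show "\<bar>increment (\<lambda>i n k. X i n k \<omega>) s S t\<bar> \<le> 2 * threshold (\<lambda>i n k. X i n k \<omega>) s S"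
        unfolding configuration_outcome[symmetric] x_def[symmetric]
        by (rule increment_le_of_grid) (use S \<omega> in \<open>auto simp: A_def N_def not_le less_imp_le\<close>)
    qed
  qed
qed

theorem AE_increment:
  "AE \<omega> in P. \<forall>\<^sub>F s in sequentially. \<forall>S. S \<subseteq> {..<d} \<longrightarrow> S \<noteq> {} \<longrightarrow> s mod d \<notin> S \<longrightarrow>
     (\<forall>t. \<bar>increment (\<lambda>i n k. X i n k \<omega>) s S t\<bar> \<le> 2 * threshold (\<lambda>i n k. X i n k \<omega>) s S)"
proof -
  have "AE \<omega> in P. \<forall>S\<in>Pow {..<d} - {{}}. \<forall>\<^sub>F s in sequentially. s mod d \<notin> S \<longrightarrow>
     (\<forall>t. \<bar>increment (\<lambda>i n k. X i n k \<omega>) s S t\<bar> \<le> 2 * threshold (\<lambda>i n k. X i n k \<omega>) s S)"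
    using AE_increment_set by (intro AE_finite_allI) auto
  then show ?thesis
  proof (rule eventually_mono)
    fix \<omega> assume "\<forall>S\<in>Pow {..<d} - {{}}. \<forall>\<^sub>F s in sequentially. s mod d \<notin> S \<longrightarrow>
     (\<forall>t. \<bar>increment (\<lambda>i n k. X i n k \<omega>) s S t\<bar> \<le> 2 * threshold (\<lambda>i n k. X i n k \<omega>) s S)"
    then have "\<forall>\<^sub>F s in sequentially. \<forall>S\<in>Pow {..<d} - {{}}. s mod d \<notin> S \<longrightarrow>
     (\<forall>t. \<bar>increment (\<lambda>i n k. X i n k \<omega>) s S t\<bar> \<le> 2 * threshold (\<lambda>i n k. X i n k \<omega>) s S)"
      by (intro eventually_ball_finite) auto
    then show "\<forall>\<^sub>F s in sequentially. \<forall>S. S \<subseteq> {..<d} \<longrightarrow> S \<noteq> {} \<longrightarrow> s mod d \<notin> S \<longrightarrow>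
     (\<forall>t. \<bar>increment (\<lambda>i n k. X i n k \<omega>) s S t\<bar> \<le> 2 * threshold (\<lambda>i n k. X i n k \<omega>) s S)"
      by (rule eventually_mono) auto
  qed
qed

end

section \<open>Growth of the densities\<close>

lemma tendsto_Suc_times_power:
  fixes r :: real
  assumes "0 \<le> r" "r < 1"
  shows "(\<lambda>s. real (Suc s) * r ^ s) \<longlonglongrightarrow> 0"
proof -
  have "(\<lambda>s. real s * r ^ s + r ^ s) \<longlonglongrightarrow> 0 + 0"
    using assms by (intro tendsto_add powser_times_n_limit_0 LIMSEQ_power_zero) auto
  then show ?thesis
    by (simp add: algebra_simps)
qed

text \<open>If \<open>b s\<close> has order \<open>\<sigma> ^ s\<close>, the added term has order
  \<open>s * (\<mu> / \<sigma>) ^ (s / 2) * \<sigma> ^ s\<close>, eventually below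
  \<open>(\<sigma> - 1) * \<sigma> ^ s\<close> because \<open>\<mu> < \<sigma>\<close>. So the bound
  reproduces itself.\<close>

lemma power_growth:
  fixes b :: "nat \<Rightarrow> real"
  assumes "1 < \<sigma>" "0 < \<mu>" "\<mu> < \<sigma>" "0 \<le> C" "\<And>s. 0 \<le> b s"
    and step: "\<forall>\<^sub>F s in sequentially. b (Suc s) \<le> b s + 2 * Suc s * sqrt (C * \<mu> ^ s) * sqrt (b s)"
  shows "\<exists>K>0. \<forall>s. b s \<le> K * \<sigma> ^ s"
proof -
  define r where "r = sqrt (\<mu> / \<sigma>)"
  have r: "0 \<le> r" "r < 1"
    using assms by (auto simp: r_def)
  have "(\<lambda>s. 2 * sqrt C * (real (Suc s) * r ^ s)) \<longlonglongrightarrow> 2 * sqrt C * 0"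
    by (intro tendsto_intros tendsto_Suc_times_power r)
  then have "\<forall>\<^sub>F s in sequentially. 2 * sqrt C * (real (Suc s) * r ^ s) < \<sigma> - 1"
    using assms(1) by (intro order_tendstoD(2)[of _ 0]) auto
  with step have "\<forall>\<^sub>F s in sequentially. b (Suc s) \<le> b s + 2 * Suc s * sqrt (C * \<mu> ^ s) * sqrt (b s)
      \<and> 2 * sqrt C * (real (Suc s) * r ^ s) < \<sigma> - 1"
    by (rule eventually_conj)
  then obtain s1 where s1: "\<And>s. s1 \<le> s \<Longrightarrow> b (Suc s) \<le> b s + 2 * Suc s * sqrt (C * \<mu> ^ s) * sqrt (b s)"
      "\<And>s. s1 \<le> s \<Longrightarrow> 2 * sqrt C * (real (Suc s) * r ^ s) < \<sigma> - 1"
    unfolding eventually_sequentially by blast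
  \<comment> \<open>Dominates \<open>b\<close> up to \<open>s1\<close>; being at least
    \<open>1\<close>, it also gives
    \<open>sqrt (\<sigma> ^ s * b s) \<le> K * \<sigma> ^ s\<close>.\<close>
  define K where "K = 1 + (\<Sum>s\<le>s1. b s)"
  have K: "1 \<le> K"
    unfolding K_def using assms by (auto intro: sum_nonneg)
  have small: "b s \<le> K * \<sigma> ^ s" if "s \<le> s1" for s
  proof -
    have "b s \<le> (\<Sum>s\<le>s1. b s)"
      using that assms by (intro member_le_sum) auto
    then have "b s * 1 \<le> K * \<sigma> ^ s"
      using assms K by (intro mult_mono one_le_power) (auto simp: K_def)
    then show ?thesis
      by simp
  qed
  have "b s \<le> K * \<sigma> ^ s" if "s1 \<le> s" for s
    using that
  proof (induction rule: dec_induct)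
    case (step s)
    have "sqrt (\<mu> ^ s) = r ^ s * sqrt (\<sigma> ^ s)"
      using assms by (simp add: r_def real_sqrt_power[symmetric] real_sqrt_mult[symmetric] power_divide)
    then have "2 * Suc s * sqrt (C * \<mu> ^ s) * sqrt (b s)
      = 2 * sqrt C * (real (Suc s) * r ^ s) * (sqrt (\<sigma> ^ s) * sqrt (b s))"
      by (simp add: real_sqrt_mult)
    also have "\<dots> \<le> (\<sigma> - 1) * (sqrt (\<sigma> ^ s) * sqrt (b s))"
      using s1(2)[OF step.hyps(1)] assms by (intro mult_right_mono) auto
    also have "\<dots> \<le> (\<sigma> - 1) * (K * \<sigma> ^ s)"
    proof (rule mult_left_mono)
      have "sqrt (\<sigma> ^ s) * sqrt (b s) = sqrt (\<sigma> ^ s * b s)"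
        by (simp add: real_sqrt_mult)
      also have "\<dots> \<le> sqrt ((K * \<sigma> ^ s)\<^sup>2)"
      proof (rule real_sqrt_le_mono)
        have "\<sigma> ^ s * b s \<le> (K * \<sigma> ^ s) * (K * \<sigma> ^ s)"
          using step.IH assms K by (intro mult_mono) (auto simp: mult_ge1_I)
        then show "\<sigma> ^ s * b s \<le> (K * \<sigma> ^ s)\<^sup>2"
          by (simp add: power2_eq_square)
      qed
      also have "\<dots> = K * \<sigma> ^ s"
        using K assms by simp
      finally show "sqrt (\<sigma> ^ s) * sqrt (b s) \<le> K * \<sigma> ^ s" .
    qed (use assms in simp)
    finally have "b (Suc s) \<le> K * \<sigma> ^ s + (\<sigma> - 1) * (K * \<sigma> ^ s)"
      using s1(1)[OF step.hyps(1)] step.IH by linarith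
    then show ?case
      by (simp add: algebra_simps)
  qed (use small in simp)
  then show ?thesis
    using small K by (intro exI[of _ K]) (metis le_cases less_le_trans zero_less_one)
qed

context percolation_parameters
begin

text \<open>
  All exponential rates are measured per time step, that is, as \<open>d\<close>-th roots of the rates per level:
  \<open>M ^ (1 - D)\<close> per level, with \<open>D = (\<Sum>i\<in>S. 1 + ln (p i) / ln M)\<close> the expected dimension of the sum over
  \<open>S\<close>, corresponds to \<open>defect S\<close>.
\<close>

definition rate :: "nat \<Rightarrow> real" where
  "rate i = root d (M * p i)"

definition defect :: "nat set \<Rightarrow> real" where
  "defect S = root d M / (\<Prod>i\<in>S. rate i)"

lemma all_nonempty: "{..<d} \<noteq> {}"
  by (metis d_pos(1) empty_iff lessThan_iff)

lemma rate_pos: "i < d \<Longrightarrow> 0 < rate i"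
  using p_range by (simp add: rate_def)

lemma rate_power: "i < d \<Longrightarrow> rate i ^ d = M * p i"
  using p_range by (simp add: rate_def less_imp_le)

lemma defect_pos: "S \<subseteq> {..<d} \<Longrightarrow> 0 < defect S"
  unfolding defect_def using rate_pos by (auto intro!: divide_pos_pos prod_pos)

lemma defect_remove:
  assumes "S \<subseteq> {..<d}" "i \<in> S"
  shows "defect (S - {i}) / rate i = defect S"
  using assms finite_indices[OF assms(1)] by (simp add: defect_def prod.remove[of S i] mult.commute)

text \<open>The hypothesis on the product reads \<open>M < (\<Prod>i<d. M * p i)\<close>: the
  expected dimensions add up to more than \<open>1\<close>.\<close>

lemma defect_full: "defect {..<d} < 1"
proof -
  have "real M powi (- int d + 1) = real M / real M ^ d"
    using power_int_diff[of "real M" 1 "int d"] by simp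
  then have "real M < real M ^ d * (\<Prod>i<d. p i)"
    using supercritical by (simp add: pos_divide_less_eq mult.commute)
  then have "root d M < root d (real M ^ d * (\<Prod>i<d. p i))"
    by simp
  also have "real M ^ d * (\<Prod>i<d. p i) = (\<Prod>i<d. rate i) ^ d"
    by (simp add: prod_power_distrib rate_power prod.distrib)
  also have "root d \<dots> = (\<Prod>i<d. rate i)"
    using rate_pos by (intro real_root_power_cancel prod_nonneg) (auto simp: less_imp_le)
  finally have "root d M < (\<Prod>i<d. rate i)" .
  moreover have "0 < (\<Prod>i<d. rate i)"
    using rate_pos by (intro prod_pos) auto
  ultimately show ?thesis
    by (simp add: defect_def)
qed

definition small_increments :: "(nat \<Rightarrow> nat \<Rightarrow> nat \<Rightarrow> bool) \<Rightarrow> bool" where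
  "small_increments x \<longleftrightarrow> (\<forall>\<^sub>F s in sequentially. \<forall>S. S \<subseteq> {..<d} \<longrightarrow> S \<noteq> {} \<longrightarrow> s mod d \<notin> S \<longrightarrow>
     (\<forall>t. \<bar>increment x s S t\<bar> \<le> 2 * threshold x s S))"

text \<open>As \<open>s \<le> d * Suc (s div d)\<close> and \<open>1 < M * p i\<close>, the power
  per level is at least \<open>rate i ^ s\<close>, which removes the rounding.\<close>

lemma threshold_le:
  assumes "\<And>i. i < d \<Longrightarrow> 1 < M * p i" "S \<subseteq> {..<d}" "S \<noteq> {}"
  shows "threshold x s S \<le> Suc s * sqrt (density_sup x s (insert (s mod d) S) * density_sup x s S / rate (s mod d) ^ s)"
proof -
  define i n where "i = s mod d" and "n = s div d"
  have i: "i < d"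
    by (simp add: i_def)
  have "1 < rate i"
    unfolding rate_def using assms(1)[OF i] by simp
  have "s \<le> d * Suc n"
    using dividend_less_div_times[of d s] by (simp add: n_def mult.commute)
  then have "rate i ^ s \<le> rate i ^ (d * Suc n)"
    using \<open>1 < rate i\<close> by (intro power_increasing) auto
  also have "\<dots> = (M * p i) ^ Suc n"
    by (simp only: power_mult rate_power[OF i])
  finally have *: "rate i ^ s \<le> (M * p i) ^ Suc n" .
  have "0 \<le> density_sup x s (insert i S) * density_sup x s S"
    using density_sup_ge_1[of S x s] density_sup_ge_1[of "insert i S" x s] assms i by simp
  then have "threshold x s S \<le> Suc n * sqrt (density_sup x s (insert i S) * density_sup x s S / rate i ^ s)"
    unfolding threshold_def i_def[symmetric] n_def[symmetric]
    using * rate_pos[OF i] p_range[OF i]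
    by (intro mult_left_mono real_sqrt_le_mono divide_left_mono) auto
  also have "\<dots> \<le> Suc s * sqrt (density_sup x s (insert i S) * density_sup x s S / rate i ^ s)"
    using \<open>0 \<le> density_sup x s (insert i S) * density_sup x s S\<close> rate_pos[OF i]
    by (intro mult_right_mono) (auto simp: n_def)
  finally show ?thesis
    by (simp add: i_def)
qed

text \<open>Dividing the bound for \<open>S - {i}\<close> by \<open>rate i\<close> turns
  \<open>defect (S - {i})\<close> into \<open>defect S\<close>, which supplies
  \<open>power_growth\<close> with a rate \<open>\<mu>\<close> just below the desired
  \<open>\<sigma>\<close>. The strict inequality needed there costs one factor \<open>\<eta>\<close>
  per coordinate.\<close>

theorem density_sup_growth:
  assumes "\<And>i. i < d \<Longrightarrow> 1 < M * p i" "small_increments x" "1 < \<eta>" "S \<subseteq> {..<d}" "S \<noteq> {}"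
  shows "\<exists>K>0. \<forall>s. density_sup x s S \<le> K * (max 1 (defect S) * \<eta> ^ card S) ^ s"
  using assms(4,5)
proof (induction "card S" arbitrary: S rule: less_induct)
  case less
  define \<sigma> where "\<sigma> = max 1 (defect S) * \<eta> ^ card S"
  have finS: "finite S"
    using less.prems finite_indices by blast
  then have "card S > 0"
    using less.prems by (simp add: card_gt_0_iff)
  then have "1 < \<eta> ^ card S"
    using assms(3) by simp
  then have \<sigma>: "1 < \<sigma>"
    unfolding \<sigma>_def by (rule less_le_trans) (use assms(3) in simp)
  show ?case
  proof (cases "card S = 1")
    case True
    then obtain i where S: "S = {i}"
      by (metis card_1_singletonE)
    then have i: "i < d"
      using less.prems by auto
    note p = p_range[OF i]
    \<comment> \<open>For one coordinate the defect is the rate per time step of the trivial density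
      bound \<open>p i ^ (- n)\<close>.\<close>
    have "defect S = root d (1 / p i)"
      unfolding defect_def S rate_def using p
      by (simp add: real_root_divide real_root_mult)
    moreover have "1 * defect S \<le> \<eta> ^ card S * max 1 (defect S)"
      using assms(3) defect_pos[OF less.prems(1)] by (intro mult_mono) (auto simp: S)
    ultimately have \<sigma>_ge: "root d (1 / p i) \<le> \<sigma>"
      unfolding \<sigma>_def by (simp add: mult.commute)
    define K where "K = 1 + 1 / \<bar>a i\<bar> / p i"
    have "density_sup x s S \<le> K * \<sigma> ^ s" for s
    proof -
      have "(1 / p i) ^ (s div d) = root d (1 / p i) ^ (d * (s div d))"
        using p by (simp add: power_mult)
      also have "\<dots> \<le> root d (1 / p i) ^ s"
        using p by (intro power_increasing) auto
      also have "\<dots> \<le> \<sigma> ^ s"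
        using p by (intro power_mono \<sigma>_ge) auto
      finally have *: "1 / \<bar>a i\<bar> / p i * (1 / p i) ^ (s div d) \<le> 1 / \<bar>a i\<bar> / p i * \<sigma> ^ s"
        using p by (intro mult_left_mono) auto
      have "density_sup x s S \<le> 1 + 1 / \<bar>a i\<bar> / p i ^ level s i"
        unfolding S by (intro density_sup_le sum_density_singleton_le i)
      also have "\<dots> \<le> 1 + 1 / \<bar>a i\<bar> / p i ^ Suc (s div d)"
        using p by (intro add_left_mono divide_left_mono power_decreasing level_le i) auto
      also have "1 / \<bar>a i\<bar> / p i ^ Suc (s div d) = 1 / \<bar>a i\<bar> / p i * (1 / p i) ^ (s div d)"
        by (simp add: power_one_over)
      finally have "density_sup x s S \<le> 1 + 1 / \<bar>a i\<bar> / p i * \<sigma> ^ s"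
        using * by linarith
      also have "\<dots> \<le> 1 * \<sigma> ^ s + 1 / \<bar>a i\<bar> / p i * \<sigma> ^ s"
        using \<sigma> by simp
      finally show ?thesis
        by (simp add: K_def distrib_right)
    qed
    moreover have "0 < K"
      using p by (simp add: K_def add_pos_nonneg)
    ultimately show ?thesis
      unfolding \<sigma>_def by blast
  next
    case False
    define \<mu> where "\<mu> = max 1 (defect S) * \<eta> ^ (card S - 1)"
    have \<mu>: "0 < \<mu>"
      unfolding \<mu>_def using assms(3) by (auto intro!: mult_pos_pos)
    have "\<sigma> = \<mu> * \<eta>"
      unfolding \<sigma>_def \<mu>_def using \<open>card S > 0\<close> by (simp add: power_eq_if)
    then have "\<mu> < \<sigma>"
      using \<mu> assms(3) by simp
    have S': "S - {i} \<subseteq> {..<d}" "S - {i} \<noteq> {}" "card (S - {i}) = card S - 1" if "i \<in> S" for i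
    proof -
      show c: "card (S - {i}) = card S - 1"
        using that finS by simp
      show "S - {i} \<noteq> {}"
      proof
        assume "S - {i} = {}"
        then have "card (S - {i}) = 0"
          by (simp only: card.empty)
        then show False
          using c False \<open>card S > 0\<close> by linarith
      qed
    qed (use less.prems in auto)
    have "\<forall>i\<in>S. \<exists>K>0. \<forall>s. density_sup x s (S - {i}) \<le> K * (max 1 (defect (S - {i})) * \<eta> ^ card (S - {i})) ^ s"
      using S' \<open>card S > 0\<close> by (intro ballI less.hyps) auto
    then obtain K where K: "\<And>i. i \<in> S \<Longrightarrow> K i > 0"
      "\<And>i s. i \<in> S \<Longrightarrow> density_sup x s (S - {i}) \<le> K i * (max 1 (defect (S - {i})) * \<eta> ^ card (S - {i})) ^ s"
      by metis
    define C where "C = (\<Sum>i\<in>S. K i)"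
    have C: "0 \<le> C"
      unfolding C_def using K(1) by (intro sum_nonneg less_imp_le)
    have bound: "density_sup x s (S - {i}) / rate i ^ s \<le> C * \<mu> ^ s" if i: "i \<in> S" for i s
    proof -
      have id: "i < d"
        using less.prems i by auto
      have "1 \<le> rate i"
        unfolding rate_def using assms(1)[OF id] by simp
      \<comment> \<open>Here \<open>1 < M * p i\<close> keeps \<open>1 / rate i\<close> from
        exceeding \<open>max 1 (defect S)\<close>.\<close>
      then have "1 / rate i \<le> 1"
        by simp
      moreover have "max 1 (defect (S - {i})) / rate i = max (1 / rate i) (defect S)"
        using defect_remove[OF less.prems(1) i] \<open>1 \<le> rate i\<close> by (simp add: max_divide_distrib_right)
      ultimately have "max 1 (defect (S - {i})) / rate i \<le> max 1 (defect S)"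
        by linarith
      then have "max 1 (defect (S - {i})) / rate i * \<eta> ^ (card S - 1) \<le> \<mu>"
        unfolding \<mu>_def using assms(3) by (intro mult_right_mono) auto
      then have "(max 1 (defect (S - {i})) / rate i * \<eta> ^ (card S - 1)) ^ s \<le> \<mu> ^ s"
        using rate_pos[OF id] assms(3) by (intro power_mono mult_nonneg_nonneg divide_nonneg_pos) auto
      moreover have "K i \<le> C"
        unfolding C_def using i finS K by (intro member_le_sum) (auto simp: less_imp_le)
      ultimately have "K i * (max 1 (defect (S - {i})) / rate i * \<eta> ^ (card S - 1)) ^ s \<le> C * \<mu> ^ s"
        using C rate_pos[OF id] assms(3)
        by (intro mult_mono zero_le_power mult_nonneg_nonneg divide_nonneg_pos) auto
      moreover have "density_sup x s (S - {i}) / rate i ^ s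
        \<le> K i * (max 1 (defect (S - {i})) * \<eta> ^ (card S - 1)) ^ s / rate i ^ s"
        using K(2)[OF i, of s] S'[OF i] rate_pos[OF id] by (intro divide_right_mono) auto
      ultimately show ?thesis
        by (simp add: power_mult_distrib power_divide)
    qed
    have b_nonneg: "0 \<le> density_sup x s S" for s
      using density_sup_ge_1[OF less.prems, of x s] by simp
    have "\<exists>K>0. \<forall>s. density_sup x s S \<le> K * \<sigma> ^ s"
    proof (rule power_growth[OF \<sigma> \<mu> \<open>\<mu> < \<sigma>\<close> C b_nonneg])
      show "\<forall>\<^sub>F s in sequentially. density_sup x (Suc s) S \<le>
        density_sup x s S + 2 * Suc s * sqrt (C * \<mu> ^ s) * sqrt (density_sup x s S)"
        using assms(2) unfolding small_increments_def
      proof (rule eventually_mono)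
        fix s assume *: "\<forall>S. S \<subseteq> {..<d} \<longrightarrow> S \<noteq> {} \<longrightarrow> s mod d \<notin> S \<longrightarrow> (\<forall>t. \<bar>increment x s S t\<bar> \<le> 2 * threshold x s S)"
        define i where "i = s mod d"
        show "density_sup x (Suc s) S \<le> density_sup x s S + 2 * Suc s * sqrt (C * \<mu> ^ s) * sqrt (density_sup x s S)"
        proof (cases "i \<in> S")
          case True
          have ins: "insert (s mod d) (S - {i}) = S"
            using True by (auto simp: i_def)
          have "threshold x s (S - {i}) \<le> Suc s * sqrt (density_sup x s S * (density_sup x s (S - {i}) / rate i ^ s))"
            using threshold_le[OF assms(1) S'(1,2)[OF True], of x s] unfolding ins by (simp add: i_def)
          also have "\<dots> \<le> Suc s * sqrt (density_sup x s S * (C * \<mu> ^ s))"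
            using bound[OF True, of s] b_nonneg by (intro mult_left_mono real_sqrt_le_mono) auto
          also have "\<dots> = Suc s * sqrt (C * \<mu> ^ s) * sqrt (density_sup x s S)"
            by (simp add: real_sqrt_mult)
          finally have thr: "threshold x s (S - {i}) \<le> Suc s * sqrt (C * \<mu> ^ s) * sqrt (density_sup x s S)" .
          have "sum_density x (level (Suc s)) S t \<le> density_sup x s S - 1 + 2 * threshold x s (S - {i})" for t
            using *[rule_format, of "S - {i}" t] S'[OF True] sum_density_le_sup[OF less.prems, of x s t]
            unfolding increment_def ins by (auto simp: i_def)
          then have "density_sup x (Suc s) S \<le> 1 + (density_sup x s S - 1 + 2 * threshold x s (S - {i}))"
            by (rule density_sup_le)
          moreover have "2 * threshold x s (S - {i}) \<le> 2 * (Suc s * sqrt (C * \<mu> ^ s) * sqrt (density_sup x s S))"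
            using thr by simp
          moreover have "2 * (Suc s * sqrt (C * \<mu> ^ s) * sqrt (density_sup x s S)) = 2 * Suc s * sqrt (C * \<mu> ^ s) * sqrt (density_sup x s S)"
            by simp
          ultimately show ?thesis
            by linarith
        next
          case False
          then have "sum_density x (level (Suc s)) S = sum_density x (level s) S"
            using less.prems by (intro sum_density_cong) (auto simp: level_Suc i_def subset_iff)
          then have "density_sup x (Suc s) S = density_sup x s S"
            by (simp add: density_sup_def)
          then show ?thesis
            using b_nonneg C \<mu> by simp
        qed
      qed
    qed
    then show ?thesis
      by (simp add: \<sigma>_def)
  qed
qed

text \<open>Up to powers of \<open>\<eta>\<close>, the full density stays bounded, since
  \<open>defect {..<d} < 1\<close>, and the supremum for the other coordinates divided by
  \<open>rate i ^ s\<close> decays like \<open>\<theta> ^ s\<close>. The quantifier over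
  \<open>\<delta>\<close> precedes \<open>x\<close> because \<open>\<zeta>\<close> is later chosen
  between \<open>\<delta>\<close> and \<open>1\<close>, independently of the outcome.\<close>

theorem increments_geometric:
  assumes "\<And>i. i < d \<Longrightarrow> 1 < M * p i"
  shows "\<exists>\<delta>>0. \<delta> < 1 \<and> (\<forall>x. small_increments x \<longrightarrow> (\<exists>D>0. \<forall>\<^sub>F s in sequentially. \<forall>t.
    \<bar>sum_density x (level (Suc s)) {..<d} t - sum_density x (level s) {..<d} t\<bar> \<le> D * \<delta> ^ s))"
proof -
  define \<theta> where "\<theta> = Max (insert (defect {..<d}) ((\<lambda>i. 1 / rate i) ` {..<d}))"
  have rate: "1 < rate i" if "i < d" for i
    unfolding rate_def using assms[OF that] by simp
  have \<theta>: "\<theta> < 1" "defect {..<d} \<le> \<theta>" "\<And>i. i < d \<Longrightarrow> 1 / rate i \<le> \<theta>"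
    unfolding \<theta>_def using defect_full rate by (auto simp: divide_less_eq_1)
  have \<theta>0: "0 < \<theta>"
    using \<theta>(2) defect_pos[of "{..<d}"] by simp
  \<comment> \<open>The \<open>4 * d\<close>-th root gives
    \<open>\<theta> * \<eta> ^ (2 * d) = sqrt \<theta>\<close>: the accumulated slack uses up half
    of the decay.\<close>
  define \<eta> where "\<eta> = root (4 * d) (1 / \<theta>)"
  have \<eta>: "1 < \<eta>"
    using \<theta> \<theta>0 by (simp add: \<eta>_def)
  have "\<eta> ^ (2 * d) = sqrt (1 / \<theta>)"
  proof (rule real_sqrt_unique[symmetric])
    have "(\<eta> ^ (2 * d))\<^sup>2 = \<eta> ^ (4 * d)"
      by (simp add: power_mult[symmetric] mult.commute)
    also have "\<dots> = 1 / \<theta>"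
      unfolding \<eta>_def using \<theta>0 by (intro real_root_pow_pos2) auto
    finally show "(\<eta> ^ (2 * d))\<^sup>2 = 1 / \<theta>" .
  qed (use \<eta> in auto)
  then have \<eta>\<theta>: "\<theta> * \<eta> ^ (2 * d) = sqrt \<theta>"
    using \<theta>0 by (simp add: real_sqrt_divide real_div_sqrt less_imp_le)
  \<comment> \<open>\<open>r\<close> is the decay of the threshold, apart from the factor
    \<open>Suc s\<close>; one more root in \<open>\<delta>\<close> makes room for that
    factor.\<close>
  define r where "r = sqrt (sqrt \<theta>)"
  define \<delta> where "\<delta> = sqrt r"
  have r: "0 < r" "r < 1" "r = \<delta> * \<delta>" "0 < \<delta>" "\<delta> < 1"
    using \<theta> \<theta>0 by (auto simp: r_def \<delta>_def)
  show ?thesis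
  proof (rule exI[of _ \<delta>], intro conjI allI impI r(4,5))
    fix x assume x: "small_increments x"
    have ex: "\<exists>K>0. \<forall>s. density_sup x s S \<le> K * (max 1 (defect S) * \<eta> ^ card S) ^ s" if "S \<subseteq> {..<d}" "S \<noteq> {}" for S
      using density_sup_growth[OF assms x \<eta> that] by blast
    obtain K0 where K0: "0 < K0" "\<And>s. density_sup x s {..<d} \<le> K0 * (max 1 (defect {..<d}) * \<eta> ^ card {..<d}) ^ s"
      using ex[OF order_refl all_nonempty] by auto
    have S': "{..<d} - {i} \<subseteq> {..<d}" "{..<d} - {i} \<noteq> {}" "card ({..<d} - {i}) = d - 1" if "i < d" for i
    proof -
      show "card ({..<d} - {i}) = d - 1"
        using that by simp
      then show "{..<d} - {i} \<noteq> {}"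
        using two_le_d by (metis card.empty diff_is_0_eq not_less_eq_eq numeral_2_eq_2 le_antisym diff_le_self One_nat_def)
    qed auto
    have "\<forall>i\<in>{..<d}. \<exists>K>0. \<forall>s. density_sup x s ({..<d} - {i}) \<le> K * (max 1 (defect ({..<d} - {i})) * \<eta> ^ card ({..<d} - {i})) ^ s"
      using S' by (intro ballI ex) auto
    then obtain K where K: "\<And>i. i < d \<Longrightarrow> K i > 0"
      "\<And>i s. i < d \<Longrightarrow> density_sup x s ({..<d} - {i}) \<le> K i * (max 1 (defect ({..<d} - {i})) * \<eta> ^ card ({..<d} - {i})) ^ s"
      unfolding Ball_def lessThan_iff by metis
    define C where "C = (\<Sum>i<d. K i)"
    have C: "0 \<le> C"
      unfolding C_def using K(1) by (intro sum_nonneg less_imp_le) auto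
    have thr: "threshold x s ({..<d} - {s mod d}) \<le> sqrt (K0 * C) * (Suc s * r ^ s)" for s
    proof -
      define i where "i = s mod d"
      have i: "i < d"
        by (simp add: i_def)
      have "max 1 (defect ({..<d} - {i})) / rate i \<le> \<theta>"
        using defect_remove[of "{..<d}" i] \<theta> rate_pos[OF i] i by (simp add: max_divide_distrib_right)
      then have "max 1 (defect ({..<d} - {i})) / rate i * \<eta> ^ (d - 1) \<le> \<theta> * \<eta> ^ d"
        using \<eta> \<theta>0 by (intro mult_mono power_increasing) auto
      then have m1: "(max 1 (defect ({..<d} - {i})) / rate i * \<eta> ^ (d - 1)) ^ s \<le> (\<theta> * \<eta> ^ d) ^ s"
        using rate_pos[OF i] \<eta> by (intro power_mono mult_nonneg_nonneg divide_nonneg_pos) auto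
      have m2: "K i \<le> C"
        unfolding C_def using i K by (intro member_le_sum) (auto simp: less_imp_le)
      have "density_sup x s ({..<d} - {i}) / rate i ^ s
        \<le> K i * (max 1 (defect ({..<d} - {i})) * \<eta> ^ (d - 1)) ^ s / rate i ^ s"
        using K(2)[OF i, of s] S'[OF i] rate_pos[OF i] by (intro divide_right_mono) auto
      also have "\<dots> = K i * (max 1 (defect ({..<d} - {i})) / rate i * \<eta> ^ (d - 1)) ^ s"
        by (simp add: power_mult_distrib power_divide)
      also have "\<dots> \<le> C * (\<theta> * \<eta> ^ d) ^ s"
        using C rate_pos[OF i] \<eta> m1 m2
        by (intro mult_mono zero_le_power mult_nonneg_nonneg divide_nonneg_pos) auto
      finally have b1: "density_sup x s ({..<d} - {i}) / rate i ^ s \<le> C * (\<theta> * \<eta> ^ d) ^ s" .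
      have b2: "density_sup x s {..<d} \<le> K0 * (\<eta> ^ d) ^ s"
        using K0(2)[of s] defect_full by (simp add: max_def)
      have nonneg: "0 \<le> density_sup x s ({..<d} - {i})" "0 \<le> density_sup x s {..<d}"
        using density_sup_ge_1[OF S'(1,2)[OF i], of x s] density_sup_ge_1[OF order_refl all_nonempty, of x s] by auto
      have ins: "insert (s mod d) ({..<d} - {i}) = {..<d}"
        using i by (auto simp: i_def)
      have "threshold x s ({..<d} - {i}) \<le> Suc s * sqrt (density_sup x s {..<d} * (density_sup x s ({..<d} - {i}) / rate i ^ s))"
        using threshold_le[OF assms S'(1,2)[OF i], of x s] unfolding ins by (simp add: i_def)
      also have "\<dots> \<le> Suc s * sqrt ((K0 * (\<eta> ^ d) ^ s) * (C * (\<theta> * \<eta> ^ d) ^ s))"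
        using b1 b2 nonneg rate_pos[OF i] K0(1) \<eta>
        by (intro mult_left_mono real_sqrt_le_mono mult_mono) auto
      also have "(K0 * (\<eta> ^ d) ^ s) * (C * (\<theta> * \<eta> ^ d) ^ s) = K0 * C * (\<theta> * \<eta> ^ (2 * d)) ^ s"
      proof -
        have "\<theta> * \<eta> ^ (2 * d) = \<eta> ^ d * (\<theta> * \<eta> ^ d)"
          by (simp add: mult_2 power_add)
        then show ?thesis
          by (simp only: power_mult_distrib mult_ac)
      qed
      also have "\<dots> = K0 * C * sqrt \<theta> ^ s"
        by (simp only: \<eta>\<theta>)
      also have "sqrt \<dots> = sqrt (K0 * C) * r ^ s"
        by (simp add: real_sqrt_mult r_def real_sqrt_power)
      finally show ?thesis
        by (simp add: i_def mult_ac)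
    qed
    define D where "D = 1 + 2 * sqrt (K0 * C)"
    have D: "0 < D"
      unfolding D_def using K0 C by (simp add: add_pos_nonneg)
    have "\<forall>\<^sub>F s in sequentially. real (Suc s) * \<delta> ^ s < 1"
      using r by (intro order_tendstoD(2)[OF tendsto_Suc_times_power]) auto
    with x have "\<forall>\<^sub>F s in sequentially. \<forall>t.
      \<bar>sum_density x (level (Suc s)) {..<d} t - sum_density x (level s) {..<d} t\<bar> \<le> D * \<delta> ^ s"
      unfolding small_increments_def
    proof (rule eventually_elim2)
      fix s
      assume *: "\<forall>S. S \<subseteq> {..<d} \<longrightarrow> S \<noteq> {} \<longrightarrow> s mod d \<notin> S \<longrightarrow> (\<forall>t. \<bar>increment x s S t\<bar> \<le> 2 * threshold x s S)"
        and s: "real (Suc s) * \<delta> ^ s < 1"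
      have ins: "insert (s mod d) ({..<d} - {s mod d}) = {..<d}"
        by auto
      have "Suc s * r ^ s = (real (Suc s) * \<delta> ^ s) * \<delta> ^ s"
        by (simp add: r power_mult_distrib)
      also have "\<dots> \<le> 1 * \<delta> ^ s"
        using s r by (intro mult_right_mono) auto
      finally have "2 * (sqrt (K0 * C) * (Suc s * r ^ s)) \<le> 2 * (sqrt (K0 * C) * \<delta> ^ s)"
        using K0 C by (intro mult_left_mono) auto
      also have "\<dots> \<le> D * \<delta> ^ s"
        using r by (simp add: D_def distrib_right)
      finally have "2 * threshold x s ({..<d} - {s mod d}) \<le> D * \<delta> ^ s"
        using thr[of s] by linarith
      moreover have "\<bar>increment x s ({..<d} - {s mod d}) t\<bar> \<le> 2 * threshold x s ({..<d} - {s mod d})" for t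
        using *[rule_format, of "{..<d} - {s mod d}" t] S'[of "s mod d"] by simp
      ultimately show "\<forall>t. \<bar>sum_density x (level (Suc s)) {..<d} t - sum_density x (level s) {..<d} t\<bar> \<le> D * \<delta> ^ s"
        unfolding increment_def ins by (meson order_trans)
    qed
    with D show "\<exists>D>0. \<forall>\<^sub>F s in sequentially. \<forall>t.
      \<bar>sum_density x (level (Suc s)) {..<d} t - sum_density x (level s) {..<d} t\<bar> \<le> D * \<delta> ^ s"
      by blast
  qed
qed

end

section \<open>Sums of nested compact sets\<close>

lemma algebraic_sum_0: "algebraic_sum 0 a S = {0}"
  by (auto simp: algebraic_sum_def)

lemma algebraic_sum_Suc:
  "algebraic_sum (Suc n) a S = {u + v | u v. u \<in> algebraic_sum n a S \<and> v \<in> (*) (a n) ` S n}"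
proof (intro equalityI subsetI)
  fix t assume "t \<in> algebraic_sum (Suc n) a S"
  then show "t \<in> {u + v | u v. u \<in> algebraic_sum n a S \<and> v \<in> (*) (a n) ` S n}"
    unfolding algebraic_sum_def by fastforce
next
  fix t assume "t \<in> {u + v | u v. u \<in> algebraic_sum n a S \<and> v \<in> (*) (a n) ` S n}"
  then obtain e y where e: "\<forall>i<n. e i \<in> S i" "y \<in> S n" "t = (\<Sum>i<n. a i * e i) + a n * y"
    unfolding algebraic_sum_def by auto
  have "(\<Sum>i<n. a i * (e(n := y)) i) = (\<Sum>i<n. a i * e i)"
    by (rule sum.cong) auto
  then show "t \<in> algebraic_sum (Suc n) a S"
    unfolding algebraic_sum_def using e by (intro CollectI exI[of _ "e(n := y)"]) (auto simp: less_Suc_eq)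
qed

text \<open>The first summands of the representations of \<open>t\<close> at stage \<open>m\<close>
  form a compact set \<open>C m\<close>. These sets are nested and nonempty, and a common point
  works at all stages.\<close>

lemma Inter_compact_sums:
  fixes A B :: "nat \<Rightarrow> real set"
  assumes "\<And>m. compact (A m)" "\<And>m. compact (B m)" "decseq A" "decseq B"
  shows "(\<Inter>m. {u + v | u v. u \<in> A m \<and> v \<in> B m}) \<subseteq> {u + v | u v. u \<in> (\<Inter>m. A m) \<and> v \<in> (\<Inter>m. B m)}"
proof
  fix t assume t: "t \<in> (\<Inter>m. {u + v | u v. u \<in> A m \<and> v \<in> B m})"
  define C where "C m = A m \<inter> (\<lambda>v. t - v) ` B m" for m
  have "\<Inter>(range C) \<noteq> {}"
  proof (rule compact_nest)
    show "compact (C m)" for m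
      unfolding C_def using assms
      by (intro compact_Int compact_continuous_image continuous_intros) auto
    show "C m \<noteq> {}" for m
    proof -
      obtain u v where "u \<in> A m" "v \<in> B m" "t = u + v"
        using t by blast
      then have "u \<in> C m"
        unfolding C_def by (auto intro!: image_eqI[of _ _ v])
      then show ?thesis
        by blast
    qed
    show "C n \<subseteq> C m" if "m \<le> n" for m n
      unfolding C_def using decseqD[OF assms(3) that] decseqD[OF assms(4) that] by blast
  qed
  then obtain u where u: "\<And>m. u \<in> C m"
    by blast
  have "u \<in> A m" "t - u \<in> B m" for m
    using u[of m] by (auto simp: C_def)
  then show "t \<in> {u + v | u v. u \<in> (\<Inter>m. A m) \<and> v \<in> (\<Inter>m. B m)}"
    by (intro CollectI exI[of _ u] exI[of _ "t - u"]) auto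
qed

text \<open>The three claims are proved together because the inclusion for one more summand uses
  compactness and monotonicity of the shorter sums.\<close>

lemma algebraic_sum_nested:
  assumes "\<And>i m. i < n \<Longrightarrow> compact (L i m)" "\<And>i. i < n \<Longrightarrow> decseq (L i)"
  shows "(\<forall>m. compact (algebraic_sum n a (\<lambda>i. L i m)))
    \<and> decseq (\<lambda>m. algebraic_sum n a (\<lambda>i. L i m))
    \<and> (\<Inter>m. algebraic_sum n a (\<lambda>i. L i m)) \<subseteq> algebraic_sum n a (\<lambda>i. \<Inter>m. L i m)"
  using assms
proof (induction n)
  case 0
  show ?case
    by (simp add: algebraic_sum_0 decseq_def)
next
  case (Suc n)
  define A where "A m = algebraic_sum n a (\<lambda>i. L i m)" for m
  define B where "B m = (*) (a n) ` L n m" for m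
  have A: "compact (A m)" "decseq A" "(\<Inter>m. A m) \<subseteq> algebraic_sum n a (\<lambda>i. \<Inter>m. L i m)" for m
  proof -
    have L: "\<And>i m. i < n \<Longrightarrow> compact (L i m)" "\<And>i. i < n \<Longrightarrow> decseq (L i)"
      using Suc.prems by auto
    show "compact (A m)" "decseq A" "(\<Inter>m. A m) \<subseteq> algebraic_sum n a (\<lambda>i. \<Inter>m. L i m)"
      unfolding A_def using Suc.IH[OF L] by blast+
  qed
  have L: "compact (L n m)" "decseq (L n)" for m
    using Suc.prems by auto
  have B: "compact (B m)" "decseq B" for m
    unfolding B_def using L
    by (auto intro!: compact_continuous_image continuous_intros decseq_SucI image_mono simp: decseq_Suc_iff)
  have eq: "algebraic_sum (Suc n) a (\<lambda>i. L i m) = {u + v | u v. u \<in> A m \<and> v \<in> B m}" for m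
    unfolding algebraic_sum_Suc A_def B_def ..
  have compact_sum: "compact (algebraic_sum (Suc n) a (\<lambda>i. L i m))" for m
    unfolding eq by (rule compact_sums[OF A(1) B(1)])
  have decseq_sum: "decseq (\<lambda>m. algebraic_sum (Suc n) a (\<lambda>i. L i m))"
    unfolding eq using A(2) B(2) by (fastforce simp: decseq_def)
  have B_Inter: "(\<Inter>m. B m) \<subseteq> (*) (a n) ` (\<Inter>m. L n m)" 
  \<comment> \<open>Division by \<open>a n\<close> recovers the point unless \<open>a n = 0\<close>;
    then the image is \<open>{0}\<close>, and compactness provides a point of the
    intersection.\<close>
  proof (cases "a n = 0")
    case True
    show ?thesis
    proof
      fix v assume "v \<in> (\<Inter>m. B m)"
      then have "L n m \<noteq> {}" "v = 0" for m
        using True by (auto simp: B_def)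
      moreover have "(\<Inter>m. L n m) \<noteq> {}"
        by (rule compact_nest) (use L calculation in \<open>auto simp: decseq_def\<close>)
      ultimately show "v \<in> (*) (a n) ` (\<Inter>m. L n m)"
        using True by auto
    qed
  next
    case False
    then show ?thesis
      by (auto simp: B_def intro!: image_eqI[of _ _ "_ / a n"])
  qed
  have "(\<Inter>m. algebraic_sum (Suc n) a (\<lambda>i. L i m)) = (\<Inter>m. {u + v | u v. u \<in> A m \<and> v \<in> B m})"
    by (simp only: eq)
  also have "\<dots> \<subseteq> {u + v | u v. u \<in> (\<Inter>m. A m) \<and> v \<in> (\<Inter>m. B m)}"
    by (rule Inter_compact_sums[OF A(1) B(1) A(2) B(2)])
  also have "\<dots> \<subseteq> {u + v | u v. u \<in> algebraic_sum n a (\<lambda>i. \<Inter>m. L i m) \<and> v \<in> (*) (a n) ` (\<Inter>m. L n m)}"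
  proof
    fix t assume "t \<in> {u + v | u v. u \<in> (\<Inter>m. A m) \<and> v \<in> (\<Inter>m. B m)}"
    then obtain u v where "t = u + v" "u \<in> (\<Inter>m. A m)" "v \<in> (\<Inter>m. B m)"
      by (elim CollectE exE conjE) (rule that)
    then show "t \<in> {u + v | u v. u \<in> algebraic_sum n a (\<lambda>i. \<Inter>m. L i m) \<and> v \<in> (*) (a n) ` (\<Inter>m. L n m)}"
      using subsetD[OF A(3)] subsetD[OF B_Inter] by (intro CollectI exI[of _ u] exI[of _ v] conjI)
  qed
  also have "\<dots> = algebraic_sum (Suc n) a (\<lambda>i. \<Inter>m. L i m)"
    by (rule algebraic_sum_Suc[symmetric])
  finally have "(\<Inter>m. algebraic_sum (Suc n) a (\<lambda>i. L i m)) \<subseteq> algebraic_sum (Suc n) a (\<lambda>i. \<Inter>m. L i m)" .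
  with compact_sum decseq_sum show ?case
    by blast
qed

section \<open>Conclusion\<close>

context percolation_parameters
begin

text \<open>At time \<open>n * d\<close> all coordinates stand at level \<open>n\<close>. Some
  density value has order at least \<open>\<zeta> ^ (n * d)\<close>, while all later increments
  together have order \<open>\<delta> ^ (n * d)\<close>, which is smaller for large
  \<open>n\<close>.\<close>

lemma contains_interval_of_growth:
  assumes \<delta>: "0 < \<delta>" "\<delta> < \<zeta>" "\<zeta> < 1"
    and D: "0 < D" "\<forall>\<^sub>F s in sequentially. \<forall>t.
      \<bar>sum_density x (level (Suc s)) {..<d} t - sum_density x (level s) {..<d} t\<bar> \<le> D * \<delta> ^ s"
    and growth: "\<And>i. i < d \<Longrightarrow> \<exists>c>0. \<forall>\<^sub>F n in sequentially. c * (\<zeta> * (M * p i)) ^ n \<le> card (retained M (x i) n)"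
  shows "contains_interval (algebraic_sum d a (\<lambda>i. percolation_set M (x i)))"
proof -
  define f where "f s = sum_density x (level s) {..<d}" for s
  have "\<forall>i\<in>{..<d}. \<exists>c>0. \<forall>\<^sub>F n in sequentially. c * (\<zeta> * (M * p i)) ^ n \<le> card (retained M (x i) n)"
    using growth by simp
  then obtain c where c: "\<And>i. i < d \<Longrightarrow> 0 < c i"
    "\<And>i. i < d \<Longrightarrow> \<forall>\<^sub>F n in sequentially. c i * (\<zeta> * (M * p i)) ^ n \<le> card (retained M (x i) n)"
    unfolding Ball_def lessThan_iff by metis
  define c' where "c' = (\<Prod>i<d. c i) / (2 * (\<Sum>i<d. \<bar>a i\<bar>) + 1)"
  have sum_a: "0 < 2 * (\<Sum>i<d. \<bar>a i\<bar>) + 1"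
    by (intro add_nonneg_pos mult_nonneg_nonneg sum_nonneg) auto
  have c': "0 < c'"
    unfolding c'_def using c(1) sum_a by (intro divide_pos_pos prod_pos) auto
  have "\<forall>\<^sub>F n in sequentially. \<forall>i\<in>{..<d}. c i * (\<zeta> * (M * p i)) ^ n \<le> card (retained M (x i) n)"
    using c(2) by (intro eventually_ball_finite) auto
  moreover have "\<forall>\<^sub>F n in sequentially. \<forall>s\<ge>n. \<forall>t. \<bar>f (Suc s) t - f s t\<bar> \<le> D * \<delta> ^ s"
    using D(2) unfolding f_def eventually_sequentially by (meson order_trans)
  moreover have "\<forall>\<^sub>F n in sequentially. D / (1 - \<delta>) * ((\<delta> / \<zeta>) ^ d) ^ n < c'"
  proof -
    have "(\<delta> / \<zeta>) ^ d < 1"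
      using \<delta> by (intro power_less_one_iff[THEN iffD2]) auto
    then have "(\<lambda>n. D / (1 - \<delta>) * ((\<delta> / \<zeta>) ^ d) ^ n) \<longlonglongrightarrow> D / (1 - \<delta>) * 0"
      using \<delta> by (intro tendsto_intros LIMSEQ_power_zero) auto
    then show ?thesis
      using c' by (intro order_tendstoD(2)) auto
  qed
  ultimately have "\<forall>\<^sub>F n in sequentially. (\<forall>i\<in>{..<d}. c i * (\<zeta> * (M * p i)) ^ n \<le> card (retained M (x i) n))
      \<and> (\<forall>s\<ge>n. \<forall>t. \<bar>f (Suc s) t - f s t\<bar> \<le> D * \<delta> ^ s) \<and> D / (1 - \<delta>) * ((\<delta> / \<zeta>) ^ d) ^ n < c'"
    by eventually_elim simp
  then obtain n where card: "\<And>i. i < d \<Longrightarrow> c i * (\<zeta> * (M * p i)) ^ n \<le> card (retained M (x i) n)"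
    and step: "\<And>s t. n \<le> s \<Longrightarrow> \<bar>f (Suc s) t - f s t\<bar> \<le> D * \<delta> ^ s"
    and small: "D / (1 - \<delta>) * ((\<delta> / \<zeta>) ^ d) ^ n < c'"
  proof -
    assume that: "\<And>n. (\<And>i. i < d \<Longrightarrow> c i * (\<zeta> * (M * p i)) ^ n \<le> card (retained M (x i) n)) \<Longrightarrow>
        (\<And>s t. n \<le> s \<Longrightarrow> \<bar>f (Suc s) t - f s t\<bar> \<le> D * \<delta> ^ s) \<Longrightarrow>
        D / (1 - \<delta>) * ((\<delta> / \<zeta>) ^ d) ^ n < c' \<Longrightarrow> thesis"
    assume "\<forall>\<^sub>F n in sequentially. (\<forall>i\<in>{..<d}. c i * (\<zeta> * (M * p i)) ^ n \<le> card (retained M (x i) n))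
      \<and> (\<forall>s\<ge>n. \<forall>t. \<bar>f (Suc s) t - f s t\<bar> \<le> D * \<delta> ^ s) \<and> D / (1 - \<delta>) * ((\<delta> / \<zeta>) ^ d) ^ n < c'"
    from eventually_happens'[OF sequentially_bot this] show thesis
      by (elim exE conjE) (rule that, auto)
  qed
  \<comment> \<open>The geometric series of all increment bounds from time \<open>n * d\<close>
    on.\<close>
  define G where "G = D * \<delta> ^ (n * d) / (1 - \<delta>)"
  obtain t0 where t0: "(\<Prod>i<d. mass x i (level (n * d) i)) / (2 * (\<Sum>i<d. \<bar>a i\<bar>) + 1) \<le> f (n * d) t0"
    using sum_density_ge[OF order_refl all_nonempty, of x "level (n * d)"] unfolding f_def by blast
  have "(\<Prod>i<d. c i * \<zeta> ^ n) \<le> (\<Prod>i<d. mass x i (level (n * d) i))"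
  proof (rule prod_mono)
    fix i assume "i \<in> {..<d}"
    then have i: "i < d"
      by simp
    have "c i * \<zeta> ^ n * (M * p i) ^ n \<le> card (retained M (x i) n)"
      using card[OF i] by (simp add: power_mult_distrib mult_ac)
    then show "0 \<le> c i * \<zeta> ^ n \<and> c i * \<zeta> ^ n \<le> mass x i (level (n * d) i)"
      using c(1)[OF i] \<delta> p_range[OF i] by (simp add: mass_def level_mult[OF i] pos_le_divide_eq)
  qed
  then have "c' * \<zeta> ^ (n * d) \<le> (\<Prod>i<d. mass x i (level (n * d) i)) / (2 * (\<Sum>i<d. \<bar>a i\<bar>) + 1)"
    unfolding c'_def using sum_a by (simp add: prod.distrib power_mult divide_right_mono)
  moreover have "G < c' * \<zeta> ^ (n * d)"
  proof -
    have "G = D / (1 - \<delta>) * ((\<delta> / \<zeta>) ^ d) ^ n * \<zeta> ^ (n * d)"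
      using \<delta> by (simp add: G_def power_divide power_mult[symmetric] mult.commute)
    also have "\<dots> < c' * \<zeta> ^ (n * d)"
      using small \<delta> by (intro mult_strict_right_mono) auto
    finally show ?thesis .
  qed
  ultimately have G: "G < f (n * d) t0"
    using t0 by linarith
  define K where "K = 2 * density_constant\<^sup>2 * (M / p_all) ^ n"
  have K: "0 < K"
    unfolding K_def using density_constant_pos p_all_bounds by (intro mult_pos_pos) auto
  have lip: "\<bar>f (n * d) t - f (n * d) t'\<bar> \<le> K * \<bar>t - t'\<bar>" for t t'
  proof -
    have "insert 0 ({..<d} - {0}) = {..<d}"
      by auto
    moreover have "{..<d} - {0} \<noteq> {}"
      using two_le_d by (auto simp: set_eq_iff intro!: exI[of _ 1])
    ultimately show ?thesis
      using uniform_lipschitz[of "{..<d} - {0}" 0 "level (n * d)" n x t t'] 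
      unfolding f_def K_def by (auto simp: level_mult)
  qed
  \<comment> \<open>Within this distance the Lipschitz bound costs half of the margin at
    \<open>t0\<close>.\<close>
  define r where "r = (f (n * d) t0 - G) / (2 * K)"
  have r: "0 < r"
    using G K by (simp add: r_def)
  have pos: "G < f (n * d) t" if "t \<in> {t0..t0 + r}" for t
  proof -
    have "K * \<bar>t0 - t\<bar> \<le> K * r"
      using that K by (intro mult_left_mono) auto
    also have "K * r < f (n * d) t0 - G"
      using K G by (simp add: r_def)
    finally show ?thesis
      using lip[of t0 t] by linarith
  qed
  \<comment> \<open>\<open>G * (1 - \<delta> ^ k)\<close> is the sum of the first \<open>k\<close>
    increment bounds.\<close>
  have f_lower: "f (n * d) t - G * (1 - \<delta> ^ k) \<le> f (n * d + k) t" for k t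
  proof (induction k)
    case (Suc k)
    have "n \<le> n * d + k"
      using two_le_d by (simp add: trans_le_add1)
    from step[OF this, of t] have "f (n * d + k) t - D * \<delta> ^ (n * d + k) \<le> f (n * d + Suc k) t"
      by simp
    moreover have "D * \<delta> ^ (n * d + k) = G * (1 - \<delta>) * \<delta> ^ k"
      using \<delta> by (simp add: G_def power_add)
    ultimately have "f (n * d) t - G * (1 - \<delta> ^ k) - G * (1 - \<delta>) * \<delta> ^ k \<le> f (n * d + Suc k) t"
      using Suc by linarith
    then show ?case
      by (simp add: algebra_simps)
  qed simp
  have G_nonneg: "0 \<le> G"
    using \<delta> D(1) by (simp add: G_def)
  have "{t0..t0 + r} \<subseteq> algebraic_sum d a (\<lambda>i. percolation_set M (x i))"
  proof
    fix t assume t: "t \<in> {t0..t0 + r}"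
    have at: "t \<in> algebraic_sum d a (\<lambda>i. level_set M (x i) m)" if nm: "n \<le> m" for m
    proof -
      obtain k where k: "m * d = n * d + k"
        using le_Suc_ex[OF mult_le_mono1[OF nm, of d]] by blast
      have "G * (1 - \<delta> ^ k) \<le> G"
        using G_nonneg \<delta> by (intro mult_left_le) auto
      then have "0 < f (m * d) t"
        using f_lower[of t k] pos[OF t] unfolding k by linarith
      then obtain e where "\<forall>i\<in>{..<d}. e i \<in> level_set M (x i) (level (m * d) i)" "t = (\<Sum>i<d. a i * e i)"
        using sum_density_nonzeroD[OF order_refl all_nonempty, of x "level (m * d)" t] unfolding f_def by auto
      then show ?thesis
        unfolding algebraic_sum_def by (auto simp: level_mult)
    qed
    note nested = algebraic_sum_nested[of d "\<lambda>i. level_set M (x i)" a,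
        OF compact_level_set level_set_antimono[OF M_pos(1)]]
    note dec = nested[THEN conjunct2, THEN conjunct1]
    have "t \<in> algebraic_sum d a (\<lambda>i. level_set M (x i) m)" for m
      using at[of "max n m"] decseqD[OF dec, of m "max n m"] by auto
    moreover have "(\<Inter>m. algebraic_sum d a (\<lambda>i. level_set M (x i) m)) \<subseteq> algebraic_sum d a (\<lambda>i. \<Inter>m. level_set M (x i) m)"
      by (rule nested[THEN conjunct2, THEN conjunct2])
    ultimately show "t \<in> algebraic_sum d a (\<lambda>i. percolation_set M (x i))"
      unfolding percolation_set_eq by blast
  qed
  then show ?thesis
    unfolding contains_interval_def using r by (intro exI[of _ t0] exI[of _ "t0 + r"]) auto
qed

end

text \<open>Used to extract the trials of one coordinate from the joint family, along
  \<open>(n, k) \<mapsto> (i, n, k)\<close>.\<close>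

lemma (in prob_space) indep_vars_reindex:
  assumes "indep_vars M' X I" "inj_on f J" "f ` J \<subseteq> I"
  shows "indep_vars (\<lambda>j. M' (f j)) (\<lambda>j. X (f j)) J"
  unfolding indep_vars_def2
proof (intro conjI ballI)
  show "random_variable (M' (f j)) (X (f j))" if "j \<in> J" for j
    using assms that by (auto simp: indep_vars_def2)
  show "indep_sets (\<lambda>j. {X (f j) -` A \<inter> space M |A. A \<in> sets (M' (f j))}) J"
  proof (rule indep_setsI)
    show "{X (f j) -` A \<inter> space M |A. A \<in> sets (M' (f j))} \<subseteq> events" if "j \<in> J" for j
    proof -
      have "random_variable (M' (f j)) (X (f j))"
        using assms that by (auto simp: indep_vars_def2)
      then show ?thesis
        by (auto dest: measurable_sets)
    qed
    fix A K assume K: "K \<noteq> {}" "K \<subseteq> J" "finite K"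
      and A: "\<forall>j\<in>K. A j \<in> {X (f j) -` A \<inter> space M |A. A \<in> sets (M' (f j))}"
    have inj: "inj_on f K"
      using assms(2) K(2) by (rule inj_on_subset)
    define B where "B i = A (the_inv_into K f i)" for i
    have B: "B (f j) = A j" if "j \<in> K" for j
      using that inj by (simp add: B_def the_inv_into_f_f)
    have "prob (\<Inter>i\<in>f ` K. B i) = (\<Prod>i\<in>f ` K. prob (B i))"
    proof (rule indep_setsD)
      show "indep_sets (\<lambda>i. {X i -` A \<inter> space M |A. A \<in> sets (M' i)}) I"
        using assms(1) by (simp add: indep_vars_def2)
      show "\<forall>i\<in>f ` K. B i \<in> {X i -` A \<inter> space M |A. A \<in> sets (M' i)}"
        using A B by auto
    qed (use K assms(3) in auto)
    then show "prob (\<Inter>j\<in>K. A j) = (\<Prod>j\<in>K. prob (A j))"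
      using B inj by (simp add: prod.reindex)
  qed
qed

context single_percolation
begin

text \<open>
  When \<open>d \<ge> 3\<close>, the hypothesis of the theorem allows \<open>M * p i \<le> 1\<close> for some \<open>i\<close>. Then the expected
  number of retained intervals stays bounded, so on survival it lies between \<open>1\<close> and a large constant
  with high probability, which becomes unlikely at late levels by \<open>summable_prob_small\<close>.
\<close>

lemma AE_extinction:
  assumes "M * p \<le> 1"
  shows "AE \<omega> in P. \<exists>n. R n (outcome \<omega>) = {}"
proof -
  have mem_event: "{\<omega> \<in> space P. q \<in> R n (outcome \<omega>)} \<in> events" for q n
    using depends_on_R[of n] by (intro event_depends_on[OF past_facts(1,2)[of n]]) (auto simp: depends_on_def)
  \<comment> \<open>Retention requires a retained parent and a successful trial of its own;
    conditioning on the past gives one factor \<open>p\<close> per level.\<close>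
  have mem: "prob {\<omega> \<in> space P. q \<in> R n (outcome \<omega>)} \<le> p ^ n" if "q < M ^ n" for q n
    using that
  proof (induction n arbitrary: q)
    case (Suc n)
    have "prob {\<omega> \<in> space P. q div M \<in> R n (outcome \<omega>) \<and> outcome \<omega> (Suc n, q)}
      \<le> p * prob {\<omega> \<in> space P. q div M \<in> R n (outcome \<omega>)}"
    proof (rule prob_conditional_le[where J = "past n" and T = "next_level n" and Q = "\<lambda>_ x. x (Suc n, q)"
          and G = "\<lambda>v. q div M \<in> R n v"])
      show "depends_on (past n) (\<lambda>v. q div M \<in> R n v)"
        using depends_on_R[of n] unfolding depends_on_def by metis
      show "depends_on (next_level n) (\<lambda>x. x (Suc n, q))"
        using Suc.prems by (intro depends_onI) (auto simp: next_level_def)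
      show "prob {\<omega> \<in> space P. outcome \<omega> (Suc n, q)} \<le> p"
        using prob_X[of "Suc n" q] Suc.prems by (simp add: outcome_def)
    qed (use past_facts in \<open>auto simp: depends_on_def\<close>)
    also have "\<dots> \<le> p * p ^ n"
      using Suc.prems p M_pos by (intro mult_left_mono Suc.IH) (auto simp: div_less_iff_less_mult mult.commute)
    finally show ?case
      by (simp add: R_Suc children_def)
  qed (simp add: R_def)
  \<comment> \<open>Markov's inequality, with expected number at most
    \<open>(M * p) ^ n\<close>.\<close>
  have markov: "K * prob {\<omega> \<in> space P. K \<le> card (R n (outcome \<omega>))} \<le> 1" for K n :: nat
  proof -
    have ev: "{\<omega> \<in> space P. K \<le> card (R n (outcome \<omega>))} \<in> events"
      using card_event[of "\<lambda>u _. K \<le> u" n n] .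
    have "K * prob {\<omega> \<in> space P. K \<le> card (R n (outcome \<omega>))}
       = expectation (\<lambda>\<omega>. real K * indicat_real {\<omega> \<in> space P. K \<le> card (R n (outcome \<omega>))} \<omega>)"
      using ev by simp
    also have "\<dots> \<le> expectation (\<lambda>\<omega>. \<Sum>q<M ^ n. indicat_real {\<omega> \<in> space P. q \<in> R n (outcome \<omega>)} \<omega>)"
    proof (rule integral_mono)
      fix \<omega> assume "\<omega> \<in> space P"
      then have "(\<Sum>q<M ^ n. indicat_real {\<omega> \<in> space P. q \<in> R n (outcome \<omega>)} \<omega>) = real (card (R n (outcome \<omega>) \<inter> {..<M ^ n}))"
        by (simp add: indicator_def Int_def conj_commute)
      also have "R n (outcome \<omega>) \<inter> {..<M ^ n} = R n (outcome \<omega>)"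
        using retained_subset by (auto simp: R_def)
      finally show "real K * indicat_real {\<omega> \<in> space P. K \<le> card (R n (outcome \<omega>))} \<omega>
        \<le> (\<Sum>q<M ^ n. indicat_real {\<omega> \<in> space P. q \<in> R n (outcome \<omega>)} \<omega> :: real)"
        by (simp add: indicator_def)
    qed (use ev mem_event in \<open>auto intro!: integrable_real_indicator simp: emeasure_eq_measure\<close>)
    also have "\<dots> = (\<Sum>q<M ^ n. prob {\<omega> \<in> space P. q \<in> R n (outcome \<omega>)})"
      using mem_event by (subst Bochner_Integration.integral_sum)
        (auto intro!: integrable_real_indicator simp: emeasure_eq_measure)
    also have "\<dots> \<le> (\<Sum>q<M ^ n. p ^ n)"
      using mem by (intro sum_mono) auto
    also have "\<dots> = (M * p) ^ n"
      by (simp add: power_mult_distrib)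
    also have "\<dots> \<le> 1"
      using assms p by (intro power_le_one) auto
    finally show ?thesis .
  qed
  define B where "B = {\<omega> \<in> space P. \<forall>n. 0 < card (R n (outcome \<omega>))}"
  have B_sets: "B \<in> events"
    unfolding B_def using card_event[of "\<lambda>u _. 0 < u"] by (intro sets.sets_Collect_countable_All) auto
  have B_le: "prob B \<le> 1 / K" if K: "0 < K" for K :: nat
  proof -
    have "prob B \<le> 1 / K + prob {\<omega> \<in> space P. card (R n (outcome \<omega>)) \<in> {0<..<K}}" for n
    proof -
      have ev: "{\<omega> \<in> space P. K \<le> card (R n (outcome \<omega>))} \<in> events"
        "{\<omega> \<in> space P. card (R n (outcome \<omega>)) \<in> {0<..<K}} \<in> events"
        using card_event[of "\<lambda>u _. K \<le> u" n n] card_event[of "\<lambda>u _. u \<in> {0<..<K}" n n] by auto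
      have "prob B \<le> prob ({\<omega> \<in> space P. K \<le> card (R n (outcome \<omega>))} \<union> {\<omega> \<in> space P. card (R n (outcome \<omega>)) \<in> {0<..<K}})"
        using ev by (intro finite_measure_mono sets.Un) (auto simp: B_def)
      also have "\<dots> \<le> prob {\<omega> \<in> space P. K \<le> card (R n (outcome \<omega>))} + prob {\<omega> \<in> space P. card (R n (outcome \<omega>)) \<in> {0<..<K}}"
        using ev by (intro measure_Un_le)
      also have "prob {\<omega> \<in> space P. K \<le> card (R n (outcome \<omega>))} \<le> 1 / K"
        using markov[of K n] K by (simp add: field_simps)
      finally show ?thesis
        by simp
    qed
    moreover have "(\<lambda>n. 1 / K + prob {\<omega> \<in> space P. card (R n (outcome \<omega>)) \<in> {0<..<K}}) \<longlonglongrightarrow> 1 / K + 0"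
      by (intro tendsto_intros summable_LIMSEQ_zero summable_prob_small)
    ultimately show ?thesis
      using LIMSEQ_le_const[of "\<lambda>n. 1 / K + prob {\<omega> \<in> space P. card (R n (outcome \<omega>)) \<in> {0<..<K}}" "1 / K" "prob B"] by auto
  qed
  have "(\<lambda>K. 1 / real (Suc K)) \<longlonglongrightarrow> 0"
    using LIMSEQ_Suc[OF lim_const_over_n[of 1]] by simp
  then have "prob B \<le> 0"
    using B_le[of "Suc _"] by (intro LIMSEQ_le_const) auto
  then have "prob B = 0"
    by (simp add: measure_le_0_iff)
  then have "AE \<omega> in P. \<omega> \<notin> B"
    using B_sets by (intro AE_not_in) (auto simp: null_sets_def emeasure_eq_measure)
  then show ?thesis
    by (rule AE_mp) (auto intro!: AE_I2 simp: B_def card_gt_0_iff)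
qed

end

section \<open>Assembling the almost sure statement\<close>

context percolation_sum
begin

lemma single_percolation:
  assumes "i < d"
  shows "single_percolation P (X i) M (p i)"
proof unfold_locales
  have "indep_vars (\<lambda>_. count_space UNIV) (\<lambda>j. (\<lambda>(i, n, k). X i n k) (i, j)) (SIGMA n:{1..}. {..<M ^ n})"
    by (rule indep_vars_reindex[OF indep_trials]) (use assms in \<open>auto simp: inj_on_def\<close>)
  then show "indep_vars (\<lambda>_. count_space UNIV) (\<lambda>(n, k). X i n k) (SIGMA n:{1..}. {..<M ^ n})"
    by (simp add: case_prod_unfold)
qed (use p_range[OF assms] prob_retain[OF assms] in auto)

lemma single_outcome:
  assumes "i < d"
  shows "single_percolation.R M n (independent_trials.outcome (\<lambda>(n, k). X i n k) \<omega>) = retained M (\<lambda>n k. X i n k \<omega>) n"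
proof -
  interpret single: single_percolation P "X i" M "p i"
    by (rule single_percolation) fact
  show ?thesis
    by (simp add: single.R_def single.outcome_def)
qed

lemma AE_single_growth:
  assumes "i < d" "0 < \<zeta>" "\<zeta> < 1" "1 < \<zeta> * (M * p i)"
  shows "AE \<omega> in P. (\<forall>n. retained M (\<lambda>n k. X i n k \<omega>) n \<noteq> {}) \<longrightarrow>
     (\<exists>c>0. \<forall>\<^sub>F n in sequentially. c * (\<zeta> * (M * p i)) ^ n \<le> card (retained M (\<lambda>n k. X i n k \<omega>) n))"
  using single_percolation.AE_growth[OF single_percolation assms(2-4)] assms(1)
  by (simp add: single_outcome)

lemma AE_single_extinction:
  assumes "i < d" "M * p i \<le> 1"
  shows "AE \<omega> in P. \<exists>n. retained M (\<lambda>n k. X i n k \<omega>) n = {}"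
  using single_percolation.AE_extinction[OF single_percolation assms(2)] assms(1)
  by (simp add: single_outcome)

lemma retained_nonempty:
  assumes "\<omega> \<in> space P" "i < d" "E i \<omega> \<noteq> {}"
  shows "retained M (\<lambda>n k. X i n k \<omega>) n \<noteq> {}"
  using assms E_eq[OF assms(2,1)] by (auto simp: percolation_set_def)

theorem AE_contains_interval:
  "AE \<omega> in P. (\<forall>i<d. E i \<omega> \<noteq> {}) \<longrightarrow> contains_interval (algebraic_sum d a (\<lambda>i. E i \<omega>))"
proof (cases "\<exists>i<d. M * p i \<le> 1")
  \<comment> \<open>One percolation dies out almost surely, so the event conditioned on is
    null.\<close>
  case True
  then obtain i where i: "i < d" "M * p i \<le> 1"
    by blast
  from AE_single_extinction[OF this] show ?thesis
    by (rule AE_mp) (use i retained_nonempty in \<open>auto intro!: AE_I2\<close>)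
next
  case False
  then have supercrit: "\<And>i. i < d \<Longrightarrow> 1 < M * p i"
    by (meson not_le)
  obtain \<delta> where \<delta>: "0 < \<delta>" "\<delta> < 1" "\<And>x. small_increments x \<Longrightarrow> \<exists>D>0. \<forall>\<^sub>F s in sequentially. \<forall>t.
    \<bar>sum_density x (level (Suc s)) {..<d} t - sum_density x (level s) {..<d} t\<bar> \<le> D * \<delta> ^ s"
    using increments_geometric[OF supercrit] by blast
  \<comment> \<open>\<open>\<zeta>\<close> is taken above \<open>m\<close>: beyond
    \<open>\<delta>\<close>, so that the mass outweighs the increments, and beyond
    \<open>1 / (M * p i)\<close>, so that the growth theorem applies.\<close>
  define m where "m = Max (insert \<delta> ((\<lambda>i. 1 / (M * p i)) ` {..<d}))"
  have "m < 1"
  proof -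
    have "1 / (M * p i) < 1" if "i < d" for i
      using supercrit[OF that] by (subst divide_less_eq_1_pos) linarith+
    then show ?thesis
      unfolding m_def using \<delta> by auto
  qed
  then obtain \<zeta> where \<zeta>: "m < \<zeta>" "\<zeta> < 1"
    using dense by blast
  have m: "\<delta> \<le> m" "\<And>i. i < d \<Longrightarrow> 1 / (M * p i) \<le> m"
    unfolding m_def by auto
  have "\<delta> < \<zeta>"
    using m \<zeta> by linarith
  have \<zeta>_p: "1 < \<zeta> * (M * p i)" if "i < d" for i
  proof -
    have "1 / (M * p i) < \<zeta>"
      using m(2)[OF that] \<zeta>(1) by linarith
    then show ?thesis
      using p_range[OF that] by (simp add: pos_divide_less_eq)
  qed
  have "AE \<omega> in P. \<forall>i\<in>{..<d}. (\<forall>n. retained M (\<lambda>n k. X i n k \<omega>) n \<noteq> {}) \<longrightarrow>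
     (\<exists>c>0. \<forall>\<^sub>F n in sequentially. c * (\<zeta> * (M * p i)) ^ n \<le> card (retained M (\<lambda>n k. X i n k \<omega>) n))"
    using AE_single_growth[OF _ _ \<zeta>(2) \<zeta>_p] \<delta>(1) \<open>\<delta> < \<zeta>\<close> by (intro AE_finite_allI) auto
  with AE_increment AE_space show ?thesis
  proof eventually_elim
    fix \<omega>
    assume inc: "\<forall>\<^sub>F s in sequentially. \<forall>S. S \<subseteq> {..<d} \<longrightarrow> S \<noteq> {} \<longrightarrow> s mod d \<notin> S \<longrightarrow>
     (\<forall>t. \<bar>increment (\<lambda>i n k. X i n k \<omega>) s S t\<bar> \<le> 2 * threshold (\<lambda>i n k. X i n k \<omega>) s S)"
      and \<omega>: "\<omega> \<in> space P"
      and growth: "\<forall>i\<in>{..<d}. (\<forall>n. retained M (\<lambda>n k. X i n k \<omega>) n \<noteq> {}) \<longrightarrow>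
     (\<exists>c>0. \<forall>\<^sub>F n in sequentially. c * (\<zeta> * (M * p i)) ^ n \<le> card (retained M (\<lambda>n k. X i n k \<omega>) n))"
    show "(\<forall>i<d. E i \<omega> \<noteq> {}) \<longrightarrow> contains_interval (algebraic_sum d a (\<lambda>i. E i \<omega>))"
    proof
      assume ne: "\<forall>i<d. E i \<omega> \<noteq> {}"
      have "small_increments (\<lambda>i n k. X i n k \<omega>)"
        using inc by (simp add: small_increments_def)
      from \<delta>(3)[OF this] obtain D where D: "0 < D" "\<forall>\<^sub>F s in sequentially. \<forall>t.
        \<bar>sum_density (\<lambda>i n k. X i n k \<omega>) (level (Suc s)) {..<d} t - sum_density (\<lambda>i n k. X i n k \<omega>) (level s) {..<d} t\<bar> \<le> D * \<delta> ^ s"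
        by blast
      have "contains_interval (algebraic_sum d a (\<lambda>i. percolation_set M (\<lambda>n k. X i n k \<omega>)))"
        by (rule contains_interval_of_growth[OF \<delta>(1) \<open>\<delta> < \<zeta>\<close> \<zeta>(2) D])
           (use growth ne retained_nonempty[OF \<omega>] in auto)
      moreover have "algebraic_sum d a (\<lambda>i. percolation_set M (\<lambda>n k. X i n k \<omega>)) = algebraic_sum d a (\<lambda>i. E i \<omega>)"
        unfolding algebraic_sum_def using E_eq \<omega> by auto
      ultimately show "contains_interval (algebraic_sum d a (\<lambda>i. E i \<omega>))"
        by simp
    qed
  qed
qed

end

text \<open>Conditioning is an almost sure implication, so nothing is divided by the probability of
  survival, which is zero when some \<open>M * p i \<le> 1\<close>.\<close>

theorem theorem17:
  fixes d M :: nat and p a :: "nat \<Rightarrow> real"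
    and P :: "'w measure"
    and X :: "nat \<Rightarrow> nat \<Rightarrow> nat \<Rightarrow> 'w \<Rightarrow> bool"
    and E :: "nat \<Rightarrow> 'w \<Rightarrow> real set"
  assumes "2 \<le> d" and "2 \<le> M"
    and "\<And>i. i < d \<Longrightarrow> 0 < p i \<and> p i < 1"
    and "independent_fractal_percolations P d M p X E"
    and "(\<Prod>i<d. p i) > real M powi (- int d + 1)"
    and "\<And>i. i < d \<Longrightarrow> a i \<noteq> 0"
  shows "AE \<omega> in P. (\<forall>i<d. E i \<omega> \<noteq> {}) \<longrightarrow>
           contains_interval (algebraic_sum d a (\<lambda>i. E i \<omega>))"
proof -
  interpret independent_fractal_percolations P d M p X E
    by fact
  interpret percolation_sum P d M p X E a
    by unfold_locales (use assms in auto)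
  show ?thesis
    by (rule AE_contains_interval)
qed

end
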